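(* Let $G$ be a transitive subgroup of $\mathrm{Homeo}(\mathbb{S}^1)$ which contains a non-constant continuous path. If $G$ is continuously $k$-transitive for some $k>3$, then the closure of $G$ in $\mathrm{Homeo}(\mathbb{S}^1)$ is $\mathrm{Homeo}(\mathbb{S}^1)$.
   Context: $\mathrm{Homeo}(\mathbb{S}^1)$ is the group of orientation-preserving homeomorphisms of the circle with the uniform topology, induced by the metric $d(g_1,g_2)=\sup_{x}\max\{d_{\mathbb{S}^1}(g_1(x),g_2(x)),d_{\mathbb{S}^1}(g_1^{-1}(x),g_2^{-1}(x))\}$; subgroups carry the subspace topology. A subgroup $G$ is transitive if for all $x,y\in\mathbb{S}^1$ there is $f\in G$ with $f(x)=y$. A path in a space $X$ is a continuous map $[0,1]\to X$. $P_n\subset(\mathbb{S}^1)^n$ is the space of $n$-tuples of pairwise distinct points, with the subspace topology. A pair of paths $\mathcal{X},\mathcal{Y}\colon[0,1]\to P_n$, $\mathcal{X}(t)=(x_1(t),\dots,x_n(t))$, $\mathcal{Y}(t)=(y_1(t),\dots,y_n(t))$, is compatible if there is a path $h\colon[0,1]\to\mathrm{Homeo}(\mathbb{S}^1)$ with $h(t)(x_i(t))=y_i(t)$ for all $i,t$. $G$ is continuously $n$-transitive if for every compatible pair of paths $\mathcal{X},\mathcal{Y}\colon[0,1]\to P_n$ there is a path $g\colon[0,1]\to G$ with $g(t)(x_i(t))=y_i(t)$ for all $i,t$. *)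

theory Defs
  imports "HOL-Analysis.Analysis" "HOL-Algebra.Bij"
begin

abbreviation S1 :: "complex set" where
  "S1 \<equiv> sphere 0 1"

text \<open>
  A circle map preserves orientation if it has a strictly increasing continuous lift along the
  covering \<^term>\<open>cis\<close> of \<^term>\<open>S1\<close> by the real line, commuting with the deck transformation.
\<close>

definition orientation_preserving :: "(complex \<Rightarrow> complex) \<Rightarrow> bool" where
  "orientation_preserving g \<longleftrightarrow>
     (\<exists>F :: real \<Rightarrow> real. continuous_on UNIV F \<and> strict_mono F \<and>
        (\<forall>t. F (t + 2 * pi) = F t + 2 * pi) \<and> (\<forall>t. g (cis t) = cis (F t)))"

text \<open>
  Maps of the circle are extensional functions (as in \<^term>\<open>Bij S1\<close>), so that equality of functions
  is equality of circle maps.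
\<close>

definition homeo_S1 :: "(complex \<Rightarrow> complex) set" where
  "homeo_S1 = {g \<in> Bij S1. homeomorphism S1 S1 g (inv_into S1 g) \<and> orientation_preserving g}"

definition Homeo_S1 :: "(complex \<Rightarrow> complex) monoid" where
  "Homeo_S1 = (BijGroup S1) \<lparr>carrier := homeo_S1\<rparr>"

text \<open>
  The distance on \<^term>\<open>S1\<close> is the chordal one, which is bi-Lipschitz equivalent to arc length.
  The value 0 off \<^term>\<open>homeo_S1\<close> only serves to meet the totality requirements of
  \<^locale>\<open>Metric_space\<close>.
\<close>

definition homeo_dist :: "(complex \<Rightarrow> complex) \<Rightarrow> (complex \<Rightarrow> complex) \<Rightarrow> real" where
  "homeo_dist g1 g2 =
     (if g1 \<in> homeo_S1 \<and> g2 \<in> homeo_S1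
      then SUP x\<in>S1. max (dist (g1 x) (g2 x)) (dist (inv_into S1 g1 x) (inv_into S1 g2 x))
      else 0)"

definition Homeo_top :: "(complex \<Rightarrow> complex) topology" where
  "Homeo_top = Metric_space.mtopology homeo_S1 homeo_dist"

definition transitive_on_S1 :: "(complex \<Rightarrow> complex) set \<Rightarrow> bool" where
  "transitive_on_S1 G \<longleftrightarrow> (\<forall>x\<in>S1. \<forall>y\<in>S1. \<exists>f\<in>G. f x = y)"

definition contains_nonconstant_path :: "(complex \<Rightarrow> complex) set \<Rightarrow> bool" where
  "contains_nonconstant_path G \<longleftrightarrow>
     (\<exists>g. pathin (subtopology Homeo_top G) g \<and> (\<exists>s\<in>{0..1}. \<exists>t\<in>{0..1}. g s \<noteq> g t))"

text \<open>The space of \<open>n\<close>-tuples, indexed by \<^term>\<open>{..<n}\<close>, of pairwise distinct points of the circle.\<close>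

definition P_top :: "nat \<Rightarrow> (nat \<Rightarrow> complex) topology" where
  "P_top n = subtopology (product_topology (\<lambda>i. top_of_set S1) {..<n}) {x. inj_on x {..<n}}"

definition compatible :: "nat \<Rightarrow> (real \<Rightarrow> nat \<Rightarrow> complex) \<Rightarrow> (real \<Rightarrow> nat \<Rightarrow> complex) \<Rightarrow> bool" where
  "compatible n X Y \<longleftrightarrow>
     (\<exists>h. pathin Homeo_top h \<and> (\<forall>t\<in>{0..1}. \<forall>i<n. h t (X t i) = Y t i))"

definition continuously_transitive :: "nat \<Rightarrow> (complex \<Rightarrow> complex) set \<Rightarrow> bool" where
  "continuously_transitive n G \<longleftrightarrow>
     (\<forall>X Y. pathin (P_top n) X \<and> pathin (P_top n) Y \<and> compatible n X Y \<longrightarrow>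
        (\<exists>g. pathin (subtopology Homeo_top G) g \<and>
             (\<forall>t\<in>{0..1}. \<forall>i<n. g t (X t i) = Y t i)))"

lemma S1_eq_cis: "x \<in> S1 \<longleftrightarrow> (\<exists>t. x = cis t)"
proof
  assume "x \<in> S1"
  then have "x = cis (Arg x)"
    using rcis_cmod_Arg[of x] by (simp add: rcis_def)
  then show "\<exists>t. x = cis t" ..
qed auto

lemma homeo_S1_in_S1:
  assumes "g \<in> homeo_S1" "x \<in> S1"
  shows "g x \<in> S1" "inv_into S1 g x \<in> S1"
  using assms Bij_imp_funcset[of g S1] Bij_inv_into_mem[of g S1 x] by (auto simp: homeo_S1_def)

lemma id_in_homeo_S1: "(\<lambda>x\<in>S1. x) \<in> homeo_S1"
proof -
  have B: "(\<lambda>x\<in>S1. x) \<in> Bij S1" by (rule id_Bij)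
  have inv: "inv_into S1 (\<lambda>x\<in>S1. x) y = y" if "y \<in> S1" for y
    by (rule inv_into_f_eq) (use that in \<open>auto simp: inj_on_def\<close>)
  have "homeomorphism S1 S1 (\<lambda>x\<in>S1. x) (inv_into S1 (\<lambda>x\<in>S1. x))"
    by (rule homeomorphism_cong[OF homeomorphism_ident[of S1]]) (auto simp: inv simp del: mem_sphere)
  moreover have "orientation_preserving (\<lambda>x\<in>S1. x)"
    unfolding orientation_preserving_def
    by (rule exI[of _ "\<lambda>t. t"]) (auto simp: strict_mono_def)
  ultimately show ?thesis using B by (simp add: homeo_S1_def)
qed

lemma compose_in_homeo_S1:
  assumes "g \<in> homeo_S1" "f \<in> homeo_S1"
  shows "compose S1 g f \<in> homeo_S1"
proof -
  have g: "g \<in> Bij S1" "homeomorphism S1 S1 g (inv_into S1 g)" "orientation_preserving g"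
    and f: "f \<in> Bij S1" "homeomorphism S1 S1 f (inv_into S1 f)" "orientation_preserving f"
    using assms by (auto simp: homeo_S1_def)
  have B: "compose S1 g f \<in> Bij S1" using g f by (simp add: compose_Bij)
  have bg: "bij_betw g S1 S1" and bf: "bij_betw f S1 S1" and bc: "bij_betw (compose S1 g f) S1 S1"
    using g f B by (auto simp: Bij_def)
  have inv: "inv_into S1 (compose S1 g f) y = (inv_into S1 f \<circ> inv_into S1 g) y" if "y \<in> S1" for y
  proof (rule inv_into_f_eq)
    show "inj_on (compose S1 g f) S1" using bc by (simp add: bij_betw_def)
    have m: "inv_into S1 g y \<in> S1" using Bij_inv_into_mem[OF g(1) that] .
    show m': "(inv_into S1 f \<circ> inv_into S1 g) y \<in> S1"
      using Bij_inv_into_mem[OF f(1) m] by simp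
    show "compose S1 g f ((inv_into S1 f \<circ> inv_into S1 g) y) = y"
      using m' m that bf bg by (simp add: compose_eq bij_betw_inv_into_right del: mem_sphere)
  qed
  have "homeomorphism S1 S1 (compose S1 g f) (inv_into S1 (compose S1 g f))"
    by (rule homeomorphism_cong[OF homeomorphism_compose[OF f(2) g(2)]])
       (auto simp: inv compose_eq simp del: mem_sphere)
  moreover have "orientation_preserving (compose S1 g f)"
  proof -
    obtain F where F: "continuous_on UNIV F" "strict_mono F" "\<And>t. F (t + 2 * pi) = F t + 2 * pi"
      "\<And>t. g (cis t) = cis (F t)" using g(3) unfolding orientation_preserving_def by blast
    obtain H where H: "continuous_on UNIV H" "strict_mono H" "\<And>t. H (t + 2 * pi) = H t + 2 * pi"
      "\<And>t. f (cis t) = cis (H t)" using f(3) unfolding orientation_preserving_def by blast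
    show ?thesis unfolding orientation_preserving_def
    proof (intro exI[of _ "F \<circ> H"] conjI allI)
      show "continuous_on UNIV (F \<circ> H)"
        using F(1) H(1) by (metis continuous_on_compose continuous_on_subset subset_UNIV)
      show "strict_mono (F \<circ> H)" using F(2) H(2) by (simp add: strict_mono_def)
    qed (auto simp: F H compose_eq)
  qed
  ultimately show ?thesis using B by (simp add: homeo_S1_def)
qed

lemma inv_in_homeo_S1:
  assumes "g \<in> homeo_S1"
  shows "restrict (inv_into S1 g) S1 \<in> homeo_S1"
proof -
  have g: "g \<in> Bij S1" "homeomorphism S1 S1 g (inv_into S1 g)" "orientation_preserving g"
    using assms by (auto simp: homeo_S1_def)
  let ?h = "restrict (inv_into S1 g) S1"
  have B: "?h \<in> Bij S1" using g(1) by (rule restrict_inv_into_Bij)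
  have bg: "bij_betw g S1 S1" and bh: "bij_betw ?h S1 S1" using g(1) B by (auto simp: Bij_def)
  have inv: "inv_into S1 ?h y = g y" if "y \<in> S1" for y
  proof (rule inv_into_f_eq)
    show "inj_on ?h S1" using bh by (simp add: bij_betw_def)
    show m: "g y \<in> S1" using bg that by (rule bij_betw_apply)
    show "?h (g y) = y" using m that bg by (simp add: bij_betw_inv_into_left del: mem_sphere)
  qed
  have "homeomorphism S1 S1 ?h (inv_into S1 ?h)"
    by (rule homeomorphism_cong[OF homeomorphism_symD[OF g(2)]]) (auto simp: inv simp del: mem_sphere)
  moreover have "orientation_preserving ?h"
  proof -
    obtain F where F: "continuous_on UNIV F" "strict_mono F" "\<And>t. F (t + 2 * pi) = F t + 2 * pi"
      "\<And>t. g (cis t) = cis (F t)" using g(3) unfolding orientation_preserving_def by blast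
    have Fn: "F (t + real n * (2 * pi)) = F t + real n * (2 * pi)" for n t
    proof (induction n)
      case (Suc n)
      have "F (t + real (Suc n) * (2 * pi)) = F ((t + real n * (2 * pi)) + 2 * pi)"
        by (simp add: algebra_simps)
      also have "\<dots> = F t + real (Suc n) * (2 * pi)"
        unfolding F(3) Suc.IH by (simp add: algebra_simps)
      finally show ?case .
    qed simp
    have "\<exists>x. F x = y" for y
    proof -
      obtain n :: nat where n: "\<bar>y - F 0\<bar> < real n * (2 * pi)"
        using reals_Archimedean3[of "2 * pi"] by auto
      have "F (real n * (2 * pi)) = F 0 + real n * (2 * pi)" using Fn[of 0 n] by simp
      moreover have "F (- (real n * (2 * pi))) = F 0 - real n * (2 * pi)"
        using Fn[of "- (real n * (2 * pi))" n] by simp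
      ultimately have "F (- (real n * (2 * pi))) \<le> y" "y \<le> F (real n * (2 * pi))"
        using n by linarith+
      moreover have "continuous_on {- (real n * (2 * pi))..real n * (2 * pi)} F"
        using F(1) continuous_on_subset by blast
      moreover have "- (real n * (2 * pi)) \<le> real n * (2 * pi)" by simp
      ultimately show ?thesis by (meson IVT')
    qed
    then have surj: "surj F" by (metis surjI)
    have inj: "inj F" using F(2) by (rule strict_mono_imp_inj_on)
    let ?F = "inv_into UNIV F"
    have FF: "F (?F t) = t" for t using surj by (simp add: surj_f_inv_f)
    have FF': "?F (F t) = t" for t using inj by simp
    have lt: "?F s < ?F t" if "s < t" for s t
      using that F(2) FF by (metis strict_mono_less)
    show ?thesis unfolding orientation_preserving_def
    proof (intro exI[of _ ?F] conjI allI)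
      have "range ?F = UNIV" using inj by (simp add: inj_imp_surj_inv)
      then show "continuous_on UNIV ?F"
        by (intro continuous_onI_mono) (use lt in \<open>auto simp: le_less\<close>)
      show "strict_mono ?F" using lt by (simp add: strict_mono_def)
      show "?F (t + 2 * pi) = ?F t + 2 * pi" for t
        by (metis F(3) FF FF')
      show "?h (cis t) = cis (?F t)" for t
      proof -
        have "g (cis (?F t)) = cis t" by (simp add: F(4) FF)
        then show ?thesis using bg
          by (metis S1_eq_cis bij_betw_inv_into_left restrict_apply)
      qed
    qed
  qed
  ultimately show ?thesis using B by (simp add: homeo_S1_def)
qed

lemma m_inv_BijGroup:
  assumes "g \<in> Bij S"
  shows "inv\<^bsub>BijGroup S\<^esub> g = restrict (inv_into S g) S"
proof -
  interpret group "BijGroup S" by (rule group_BijGroup)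
  show ?thesis
    by (rule inv_equality)
       (use assms in \<open>auto simp: BijGroup_def restrict_inv_into_Bij Bij_compose_restrict_eq\<close>)
qed

lemma subgroup_homeo_S1: "subgroup homeo_S1 (BijGroup S1)"
proof
  show "homeo_S1 \<subseteq> carrier (BijGroup S1)" by (auto simp: homeo_S1_def BijGroup_def)
  show "\<one>\<^bsub>BijGroup S1\<^esub> \<in> homeo_S1" using id_in_homeo_S1 by (simp add: BijGroup_def)
  show "g \<otimes>\<^bsub>BijGroup S1\<^esub> f \<in> homeo_S1" if "g \<in> homeo_S1" "f \<in> homeo_S1" for g f
    using that compose_in_homeo_S1[OF that] by (simp add: BijGroup_def homeo_S1_def)
  show "inv\<^bsub>BijGroup S1\<^esub> g \<in> homeo_S1" if "g \<in> homeo_S1" for g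
    using that inv_in_homeo_S1[OF that] by (subst m_inv_BijGroup) (simp_all add: homeo_S1_def)
qed

lemma group_Homeo_S1: "group Homeo_S1"
  unfolding Homeo_S1_def
  using subgroup_homeo_S1 group_BijGroup by (rule subgroup.subgroup_is_group)

lemma Metric_space_homeo: "Metric_space homeo_S1 homeo_dist"
proof -
  define D where "D = (\<lambda>g1 g2 x. max (dist (g1 x) (g2 x))
    (dist (inv_into S1 g1 x) (inv_into S1 g2 x)))"
  have D: "homeo_dist g1 g2 = (if g1 \<in> homeo_S1 \<and> g2 \<in> homeo_S1 then SUP x\<in>S1. D g1 g2 x else 0)"
    for g1 g2 by (simp add: homeo_dist_def D_def)
  have d2: "dist a b \<le> 2" if "a \<in> S1" "b \<in> S1" for a b
    using that norm_triangle_ineq4[of a b] by (simp add: dist_norm)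
  have bdd: "bdd_above (D g1 g2 ` S1)" if "g1 \<in> homeo_S1" "g2 \<in> homeo_S1" for g1 g2
    unfolding D_def
    by (rule bdd_aboveI2[of _ _ 2]) (use that in \<open>blast intro: max.boundedI d2 homeo_S1_in_S1\<close>)
  have le: "D g1 g2 x \<le> homeo_dist g1 g2" if "g1 \<in> homeo_S1" "g2 \<in> homeo_S1" "x \<in> S1" for g1 g2 x
    using cSUP_upper[OF that(3) bdd[OF that(1,2)]] that(1,2) by (simp add: D)
  have D0: "0 \<le> D g1 g2 x" for g1 g2 x by (simp add: D_def le_max_iff_disj)
  have one: "(1::complex) \<in> S1" by simp
  show ?thesis
  proof
    show "0 \<le> homeo_dist g1 g2" for g1 g2
    proof (cases "g1 \<in> homeo_S1 \<and> g2 \<in> homeo_S1")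
      case True
      then show ?thesis using le[of g1 g2 1] D0[of g1 g2 1] one by linarith
    qed (auto simp: homeo_dist_def)
    show "homeo_dist g1 g2 = homeo_dist g2 g1" for g1 g2
      by (simp add: homeo_dist_def dist_commute conj_commute)
    show "homeo_dist g1 g2 = 0 \<longleftrightarrow> g1 = g2" if g: "g1 \<in> homeo_S1" "g2 \<in> homeo_S1" for g1 g2
    proof
      assume 0: "homeo_dist g1 g2 = 0"
      have "g1 x = g2 x" if "x \<in> S1" for x
        using le[OF g that] 0 by (simp add: D_def)
      moreover have "g1 \<in> extensional S1" "g2 \<in> extensional S1"
        using g by (auto simp: homeo_S1_def Bij_def)
      ultimately show "g1 = g2" by (metis extensionalityI)
    next
      assume "g1 = g2"
      then have "D g1 g2 = (\<lambda>x. 0)" by (simp add: D_def)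
      moreover have "(SUP x\<in>S1. 0::real) = 0" using one by (intro cSUP_const) blast
      ultimately show "homeo_dist g1 g2 = 0" using g by (simp add: D)
    qed
    show "homeo_dist f h \<le> homeo_dist f g + homeo_dist g h"
      if fgh: "f \<in> homeo_S1" "g \<in> homeo_S1" "h \<in> homeo_S1" for f g h
    proof -
      have "D f h x \<le> homeo_dist f g + homeo_dist g h" if "x \<in> S1" for x
      proof -
        have "D f h x \<le> D f g x + D g h x"
          unfolding D_def
          using dist_triangle[of "f x" "h x" "g x"]
            dist_triangle[of "inv_into S1 f x" "inv_into S1 h x" "inv_into S1 g x"]
          by linarith
        also have "\<dots> \<le> homeo_dist f g + homeo_dist g h"
          using le[OF fgh(1,2) that] le[OF fgh(2,3) that] by linarith
        finally show ?thesis .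
      qed
      then have "(SUP x\<in>S1. D f h x) \<le> homeo_dist f g + homeo_dist g h"
        by (intro cSUP_least) (use one in blast)+
      then show ?thesis using fgh by (simp add: D)
    qed
  qed
qed

end

(*
  For a finite set A of points let K A be the union of all continua through the identity in the
  pointwise stabilizer of A in G. Orbits of K A are connected, so K A is transitive on each
  component of the complement of A as soon as it has no fixed points outside A; call n tight if this
  holds for all A with n points. Tightness of all n makes G n-transitive (preserving the cyclic order)
  for all n, hence dense. Continuous k-transitivity makes k - 1 tight, and if n >= 3
  is tight, then so is n + 1, in two steps.

  (1) K A is not trivial if A has n + 1 points. Otherwise take B with n - 1 points. Since the
  stabilizer of a point in K B is again of the form K (A mountain climbing argument for continua),
  nontrivial elements of K B fix at most one point outside B, and K B acts on two different arcs. The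
  stabilizers of p in the first and q in the second arc are abelian by Hoelder's theorem, and K B is
  their product, so by Ito's theorem it has commuting commutators. This contradicts the existence of
  elements with fixed points in both arcs.

  (2) If K A is not trivial, then its fixed points are isolated at A, from both sides. If there were
  further ones, let psi(x) be the next fixed point of K (B + x) after x. The iterates of
  psi at x converge to a point l, which is not the end of the component since fixed points are
  isolated there. As psi commutes with K (B + l), which is transitive slightly below l, the iterates
  of psi at every w slightly below l converge to l as well. Applying this to l and to some l' slightly below l gives a contradiction.
*)

theory Submission
  imports Defs
begin

text \<open>Continua replace paths because of the stabilizer step: from a connected family ending at
  an element that fixes a point, one has to extract a connected family inside the stabilizer of that
  point. Two paths with the same range of heights cannot in general be climbed simultaneously along
  paths, but for continua the pairs of equal height always have a component joining the two ends.
  Transitivity of \<open>K A\<close> needs no more than that, since it only uses that evaluation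
  maps a continuum to a connected set.

  The bound \<open>k > 3\<close> gives the starting value k - 1 \<ge> 3: the set B with n - 1 points
  needs at least two points for its complement to have two arcs.

  The contradiction in (1) comes from an element without fixed points in either arc that commutes
  with its conjugates under the stabilizer of p. A comparison at p and one at an iterate of p give
  opposite inequalities on the first arc.

  In (2), a single nontrivial \<open>K A\<close> yields isolation everywhere: the end of a gap
  between fixed points can be exchanged into the finite set, and G carries any pointed set with n +
  1 points to any other.\<close>

section \<open>Groups acting on the line\<close>

text \<open>Avoids the clash of \<open>inv\<close> with the inverse of a group record.\<close>

abbreviation "rinv \<equiv> inv_into UNIV :: (real \<Rightarrow> real) \<Rightarrow> real \<Rightarrow> real"

definition incr :: "(real \<Rightarrow> real) \<Rightarrow> bool" where
  "incr f \<longleftrightarrow> strict_mono f \<and> surj f"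

lemma incr_less: "incr f \<Longrightarrow> f x < f y \<longleftrightarrow> x < y"
  by (simp add: incr_def strict_mono_less)

lemma incr_le: "incr f \<Longrightarrow> f x \<le> f y \<longleftrightarrow> x \<le> y"
  by (simp add: incr_def strict_mono_less_eq)

lemma incr_eq: "incr f \<Longrightarrow> f x = f y \<longleftrightarrow> x = y"
  by (simp add: incr_def strict_mono_eq)

lemma incr_continuous: "incr f \<Longrightarrow> continuous_on S f"
proof -
  assume f: "incr f"
  then have "continuous_on UNIV f"
    by (intro continuous_onI_mono) (auto simp: incr_def strict_mono_less_eq)
  then show ?thesis by (rule continuous_on_subset) auto
qed

lemma incr_inv1: "incr f \<Longrightarrow> rinv f (f x) = x"
  by (simp add: incr_def strict_mono_imp_inj_on)

lemma incr_inv2: "incr f \<Longrightarrow> f (rinv f x) = x"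
  by (simp add: incr_def surj_f_inv_f)

lemma incr_inv_eq: "incr f \<Longrightarrow> rinv f x = y \<longleftrightarrow> x = f y"
  using incr_inv1 incr_inv2 by metis

text \<open>A plain set of maps, so that point stabilizers inside it are again instances.\<close>

locale line_group =
  fixes L :: "(real \<Rightarrow> real) set"
  assumes incr: "f \<in> L \<Longrightarrow> incr f"
    and id_in: "id \<in> L"
    and comp_in: "f \<in> L \<Longrightarrow> g \<in> L \<Longrightarrow> f \<circ> g \<in> L"
    and inv_in: "f \<in> L \<Longrightarrow> rinv f \<in> L"
begin

lemmas less = incr_less[OF incr] and le = incr_le[OF incr] and eq = incr_eq[OF incr]
  and inv1[simp] = incr_inv1[OF incr] and inv2[simp] = incr_inv2[OF incr]

lemma pow_in: "f \<in> L \<Longrightarrow> (f ^^ n) \<in> L"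
  by (induction n) (auto simp: id_in comp_in)

lemma ordered_on_interval:
  assumes f: "f \<in> L" and g: "g \<in> L" and I: "x \<in> {a<..<b}" "y \<in> {a<..<b}"
    and ne: "\<And>t. t \<in> {a<..<b} \<Longrightarrow> f t \<noteq> g t" and x: "f x < g x"
  shows "f y < g y"
proof (rule ccontr)
  assume "\<not> f y < g y"
  then have y: "f y > g y" using ne[OF I(2)] by simp
  have c: "continuous_on S (\<lambda>t. f t - g t)" for S
    using incr_continuous[OF incr[OF f]] incr_continuous[OF incr[OF g]] by (intro continuous_intros)
  have "\<exists>t. t \<in> {a<..<b} \<and> f t - g t = 0"
  proof (cases "x \<le> y")
    case True
    from IVT'[of "\<lambda>t. f t - g t" x 0 y] True x y c
    obtain t where "x \<le> t" "t \<le> y" "f t - g t = 0" by auto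
    then show ?thesis using I by (intro exI[of _ t]) auto
  next
    case False
    from IVT2'[of "\<lambda>t. f t - g t" x 0 y] False x y c
    obtain t where "y \<le> t" "t \<le> x" "f t - g t = 0" by auto
    then show ?thesis using I by (intro exI[of _ t]) auto
  qed
  then show False using ne by force
qed

text \<open>The supremum of the orbit of a point under the powers of \<open>f\<close> is fixed by \<open>f\<close>.\<close>

lemma powers_unbounded:
  assumes f: "f \<in> L" and x: "x \<in> {a<..<b}" and y: "y < b" and pos: "\<And>t. t \<in> {a<..<b} \<Longrightarrow> t < f t"
  shows "\<exists>n. y < (f ^^ n) x"
proof (rule ccontr)
  assume "\<not> ?thesis"
  then have le: "(f ^^ n) x \<le> y" for n by (simp add: not_less)
  define s where "s = (SUP n. (f ^^ n) x)"
  have bdd: "bdd_above (range (\<lambda>n. (f ^^ n) x))" using le by (auto simp: bdd_above_def)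
  have up: "(f ^^ n) x \<le> s" for n unfolding s_def by (rule cSUP_upper[OF _ bdd]) auto
  have sy: "s \<le> y" unfolding s_def by (rule cSUP_least) (auto simp: le)
  have "x \<le> s" using up[of 0] by simp
  then have sI: "s \<in> {a<..<b}" using x y sy by auto
  \<comment> \<open>An iterate that exceeds f^-1 s is mapped by f to one that exceeds s.\<close>
  have "rinv f s < s"
    using pos[OF sI] less[OF f, of "rinv f s" s] f by simp
  then obtain n where "rinv f s < (f ^^ n) x"
    unfolding s_def using less_cSUP_iff[OF _ bdd] by auto
  then have "f (rinv f s) < f ((f ^^ n) x)" using less[OF f] by blast
  then have "s < (f ^^ Suc n) x" using f by simp
  then show False using up[of "Suc n"] by linarith
qed

lemma no_fixed_point_sign:
  assumes f: "f \<in> L" and ne: "\<And>t. t \<in> {a<..<b} \<Longrightarrow> f t \<noteq> t" and x: "x \<in> {a<..<b}" "y \<in> {a<..<b}" "x < f x"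
  shows "y < f y"
  using ordered_on_interval[OF id_in f x(1,2)] ne x(3) by force

end

text \<open>A simply transitive action on the interval, where a fixed point forces the identity on
  the whole line. Two elements that agree at one point of the interval therefore coincide, and
  comparing values at any point gives the same linear order on the group.\<close>

locale free_line_group = line_group +
  fixes a b :: real
  assumes pres: "f \<in> L \<Longrightarrow> t \<in> {a<..<b} \<Longrightarrow> f t \<in> {a<..<b}"
    and free: "f \<in> L \<Longrightarrow> t \<in> {a<..<b} \<Longrightarrow> f t = t \<Longrightarrow> f = id"
    and trans: "s \<in> {a<..<b} \<Longrightarrow> t \<in> {a<..<b} \<Longrightarrow> \<exists>f\<in>L. f s = t"
    and ne: "a < b"
begin

lemma ord:
  assumes "f \<in> L" "g \<in> L" "x \<in> {a<..<b}" "y \<in> {a<..<b}" "f x < g x"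
  shows "f y < g y"
proof (rule ordered_on_interval[OF assms(1-4) _ assms(5)])
  fix t assume t: "t \<in> {a<..<b}"
  show "f t \<noteq> g t"
  proof
    assume e: "f t = g t"
    have "rinv f \<circ> g = id"
      using free[OF comp_in[OF inv_in[OF assms(1)] assms(2)] t] e assms(1) by (metis inv1 o_apply)
    then have "rinv f (g x) = x" by (metis comp_apply id_apply)
    then have "g x = f x" using assms(1) by (metis inv2)
    then show False using assms(5) by simp
  qed
qed

lemma ord_le:
  assumes "f \<in> L" "g \<in> L" "x \<in> {a<..<b}" "y \<in> {a<..<b}" "f x \<le> g x"
  shows "f y \<le> g y"
  using ord[OF assms(2,1,4,3)] assms(5) by linarith

text \<open>Suppose g f < f g at x. Then the commutator c of f and g is positive, and there is a
  positive d with d^2 \<le> c. Squeezing f and g between consecutive powers of d gives f g <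
  d^(i+j+2) \<le> d^2 g f \<le> c g f = f g at x. The reverse inequality follows by swapping f and
  g.\<close>

lemma pos_commute_aux:
  assumes f: "f \<in> L" and g: "g \<in> L" and x: "x \<in> {a<..<b}" and fx: "x < f x" and gx: "x < g x"
  shows "f (g x) \<le> g (f x)"
proof (rule ccontr)
  assume "\<not> ?thesis"
  then have lt: "g (f x) < f (g x)" by simp
  have gf: "g (f x) \<in> {a<..<b}" using pres f g x by blast
  define c where "c = f \<circ> g \<circ> rinv f \<circ> rinv g"
  have c: "c \<in> L" unfolding c_def by (intro comp_in inv_in f g)
  have cgf: "c (g (f x)) = f (g x)" using f g by (simp add: c_def)
  have cpos: "y < c y" if "y \<in> {a<..<b}" for y
    using ord[OF id_in c gf that] lt cgf by simp
  \<comment> \<open>A point strictly between x and c x splits c into two positive factors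
    \<open>d1\<close> and \<open>d2\<close>; the smaller of the two has a square below c.\<close>
  obtain y where y: "x < y" "y < c x" using dense[OF cpos[OF x]] by blast
  have "c x \<in> {a<..<b}" using pres[OF c x] .
  then have yI: "y \<in> {a<..<b}" using x y by auto
  obtain d1 where d1: "d1 \<in> L" "d1 x = y" using trans[OF x yI] by blast
  define d2 where "d2 = rinv d1 \<circ> c"
  have d2: "d2 \<in> L" unfolding d2_def by (intro comp_in inv_in d1 c)
  have d12: "d1 (d2 t) = c t" for t using d1(1) by (simp add: d2_def)
  have d2x: "x < d2 x" using less[OF d1(1), of x "d2 x"] d12[of x] d1 y by simp
  have "\<exists>d\<in>L. x < d x \<and> (\<forall>t\<in>{a<..<b}. d (d t) \<le> c t)"
  proof (cases "d1 x \<le> d2 x")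
    case True
    have "d1 (d1 t) \<le> c t" if "t \<in> {a<..<b}" for t
      using ord_le[OF d1(1) d2 x that True] le[OF d1(1)] d12 by metis
    then show ?thesis using d1 y by auto
  next
    case False
    then have "d2 (d2 t) \<le> c t" if "t \<in> {a<..<b}" for t
      using ord_le[OF d2 d1(1) x pres[OF d2 that]] d12[of t] by simp
    then show ?thesis using d2 d2x by auto
  qed
  then obtain d where d: "d \<in> L" "x < d x" and dd: "\<And>t. t \<in> {a<..<b} \<Longrightarrow> d (d t) \<le> c t" by blast
  have dpos: "t < d t" if "t \<in> {a<..<b}" for t
    using ord[OF id_in d(1) x that] d(2) by simp
  have arch: "\<exists>n. (d ^^ n) x \<le> h x \<and> h x < (d ^^ Suc n) x" if h: "h \<in> L" "x < h x" for h
  proof -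
    have ex: "\<exists>n. h x < (d ^^ n) x"
      using powers_unbounded[OF d(1) x _ dpos] pres[OF h(1) x] by simp
    define n where "n = (LEAST n. h x < (d ^^ n) x)"
    have n: "h x < (d ^^ n) x" unfolding n_def using ex by (rule LeastI_ex)
    have "n \<noteq> 0" using n h(2) by (intro notI) simp
    then obtain m where m: "n = Suc m" by (cases n) auto
    have "\<not> h x < (d ^^ m) x" using not_less_Least[of m "\<lambda>n. h x < (d ^^ n) x"] m
      unfolding n_def by simp
    then show ?thesis using n m by (intro exI[of _ m]) auto
  qed
  obtain i where i: "(d ^^ i) x \<le> f x" "f x < (d ^^ Suc i) x" using arch[OF f fx] by blast
  obtain j where j: "(d ^^ j) x \<le> g x" "g x < (d ^^ Suc j) x" using arch[OF g gx] by blast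
  have P: "(d ^^ k) \<in> L" for k by (rule pow_in[OF d(1)])
  have "f (g x) < (d ^^ Suc i) (g x)"
    by (rule ord[OF f P x pres[OF g x] i(2)])
  also have "\<dots> < (d ^^ Suc i) ((d ^^ Suc j) x)"
    using less[OF P] j(2) by blast
  also have "\<dots> = d (d ((d ^^ j) ((d ^^ i) x)))"
    by (metis (no_types, lifting) comp_apply funpow.simps(2) funpow_add add.commute funpow_swap1)
  also have "\<dots> \<le> d (d ((d ^^ j) (f x)))"
    using le[OF d(1)] le[OF P] i(1) by blast
  also have "\<dots> \<le> d (d (g (f x)))"
    using le[OF d(1)] ord_le[OF P g x pres[OF f x] j(1)] by blast
  also have "\<dots> \<le> c (g (f x))" by (rule dd[OF gf])
  also have "\<dots> = f (g x)" by (rule cgf)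
  finally show False by simp
qed

lemma pos_commute:
  assumes "f \<in> L" "g \<in> L" "x \<in> {a<..<b}" "x < f x" "x < g x"
  shows "f \<circ> g = g \<circ> f"
proof -
  have "f (g x) = g (f x)"
    using pos_commute_aux[OF assms] pos_commute_aux[OF assms(2,1,3,5,4)] by simp
  then have "(rinv (g \<circ> f) \<circ> (f \<circ> g)) x = x"
    by (metis assms(1,2) comp_apply comp_in inv1)
  then have e: "rinv (g \<circ> f) \<circ> (f \<circ> g) = id"
    by (intro free[OF _ assms(3)]) (auto intro!: comp_in inv_in assms)
  have "(g \<circ> f) (rinv (g \<circ> f) ((f \<circ> g) t)) = (f \<circ> g) t" for t
    using comp_in[OF assms(2,1)] by (rule inv2)
  then show ?thesis using e by (metis comp_apply id_apply ext)
qed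

text \<open>Hoelder's theorem, in the special case of a simply transitive action.\<close>

theorem abelian:
  assumes f: "f \<in> L" and g: "g \<in> L"
  shows "f (g t) = g (f t)"
proof -
  define x where "x = (a + b) / 2"
  have x: "x \<in> {a<..<b}" using ne by (auto simp: x_def)
  have pos: "\<exists>h\<in>L. x < h x \<and> (f = h \<or> f = rinv h)" if "f \<in> L" "f \<noteq> id" for f
  proof (cases "x < f x")
    case False
    then have "f x < x" using free[OF that(1) x] that(2) by force
    then have "x < rinv f x" using less[OF that(1), of x "rinv f x"] that(1) by simp
    moreover have "f = rinv (rinv f)"
      using incr[OF that(1)] by (simp add: incr_def inv_inv_eq bij_def strict_mono_imp_inj_on)
    ultimately show ?thesis using inv_in[OF that(1)] by blast
  qed (use that in auto)
  show ?thesis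
  proof (cases "f = id \<or> g = id")
    case False
    obtain h where h: "h \<in> L" "x < h x" "f = h \<or> f = rinv h" using pos[OF f] False by blast
    obtain k where k: "k \<in> L" "x < k x" "g = k \<or> g = rinv k" using pos[OF g] False by blast
    have hk: "h (k t) = k (h t)" for t
      using pos_commute[OF h(1) k(1) x h(2) k(2)] by (metis comp_apply)
    have i1: "rinv h (k t) = k (rinv h t)" for t
      using hk[of "rinv h t"] h(1) by (metis inv1 inv2)
    have i2: "h (rinv k t) = rinv k (h t)" for t
      using hk[of "rinv k t"] k(1) by (metis inv1 inv2)
    have i3: "rinv h (rinv k t) = rinv k (rinv h t)" for t
      using i1[of "rinv k t"] k(1) by (metis inv1 inv2)
    show ?thesis using h(3) k(3) hk i1 i2 i3 by auto
  qed auto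
qed

end

section \<open>Groups acting on two intervals\<close>

text \<open>The abstract form of \<open>K B\<close> acting on two arcs of the complement of
  \<open>B\<close>. In \<open>uniq\<close> fixed points are counted over both arcs together;
  \<open>tr2\<close> and \<open>tr1\<close> say that the stabilizer of a point in one arc is
  transitive on the other arc.\<close>

locale two_interval_group = line_group +
  fixes a1 b1 a2 b2 p q :: real
  assumes disj: "b1 \<le> a2"
    and pres1: "f \<in> L \<Longrightarrow> t \<in> {a1<..<b1} \<Longrightarrow> f t \<in> {a1<..<b1}"
    and pres2: "f \<in> L \<Longrightarrow> t \<in> {a2<..<b2} \<Longrightarrow> f t \<in> {a2<..<b2}"
    and uniq: "f \<in> L \<Longrightarrow> s \<in> {a1<..<b1} \<union> {a2<..<b2} \<Longrightarrow> t \<in> {a1<..<b1} \<union> {a2<..<b2} \<Longrightarrow>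
        s \<noteq> t \<Longrightarrow> f s = s \<Longrightarrow> f t = t \<Longrightarrow> f = id"
    and p: "p \<in> {a1<..<b1}" and q: "q \<in> {a2<..<b2}"
    and tr2: "s \<in> {a2<..<b2} \<Longrightarrow> t \<in> {a2<..<b2} \<Longrightarrow> \<exists>f\<in>L. f p = p \<and> f s = t"
    and tr1: "s \<in> {a1<..<b1} \<Longrightarrow> t \<in> {a1<..<b1} \<Longrightarrow> \<exists>f\<in>L. f q = q \<and> f s = t"
begin

definition "A = {f \<in> L. f p = p}"
definition "B = {f \<in> L. f q = q}"
abbreviation "I \<equiv> {a1<..<b1} \<union> {a2<..<b2}"

lemma pres: "f \<in> L \<Longrightarrow> t \<in> I \<Longrightarrow> f t \<in> I"
  using pres1 pres2 by blast

lemma A_L: "f \<in> A \<Longrightarrow> f \<in> L" and B_L: "f \<in> B \<Longrightarrow> f \<in> L"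
  by (auto simp: A_def B_def)

lemma A_inv: "f \<in> A \<Longrightarrow> rinv f \<in> A" and B_inv: "f \<in> B \<Longrightarrow> rinv f \<in> B"
  by (auto simp: A_def B_def inv_in incr_inv_eq[OF incr])

lemma A_free: "free_line_group A a2 b2"
proof
  show "f = id" if "f \<in> A" "t \<in> {a2<..<b2}" "f t = t" for f t
    using uniq[of f p t] that p disj by (auto simp: A_def)
  show "a2 < b2" using q by auto
  show "\<exists>f\<in>A. f s = t" if "s \<in> {a2<..<b2}" "t \<in> {a2<..<b2}" for s t
    using tr2[OF that] by (auto simp: A_def)
qed (use incr id_in comp_in A_inv pres2 in \<open>auto simp: A_def\<close>)

lemma B_free: "free_line_group B a1 b1"
proof
  show "f = id" if "f \<in> B" "t \<in> {a1<..<b1}" "f t = t" for f t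
    using uniq[of f q t] that q disj by (auto simp: B_def)
  show "a1 < b1" using p by auto
  show "\<exists>f\<in>B. f s = t" if "s \<in> {a1<..<b1}" "t \<in> {a1<..<b1}" for s t
    using tr1[OF that] by (auto simp: B_def)
qed (use incr id_in comp_in B_inv pres1 in \<open>auto simp: B_def\<close>)

lemmas A_comm = free_line_group.abelian[OF A_free]
lemmas B_comm = free_line_group.abelian[OF B_free]

text \<open>The right factor is an element of the stabilizer of q that carries g^-1 p to p; what
  remains of g then fixes p.\<close>

lemma factor_AB:
  assumes g: "g \<in> L"
  shows "\<exists>f\<in>A. \<exists>h\<in>B. \<forall>t. g t = f (h t)"
proof -
  obtain h where h: "h \<in> L" "h q = q" "h (rinv g p) = p"
    using tr1[OF pres1[OF inv_in[OF g] p] p] by blast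
  have "rinv h p = rinv g p" using h by (simp add: incr_inv_eq[OF incr])
  then have "g \<circ> rinv h \<in> A" using g h by (simp add: A_def comp_in inv_in)
  moreover have "g t = (g \<circ> rinv h) (h t)" for t using h by simp
  moreover have "h \<in> B" using h by (simp add: B_def)
  ultimately show ?thesis by blast
qed

lemma factor_BA:
  assumes g: "g \<in> L"
  shows "\<exists>f\<in>A. \<exists>h\<in>B. \<forall>t. g t = h (f t)"
proof -
  obtain f h where fh: "f \<in> A" "h \<in> B" "\<And>t. rinv g t = f (h t)"
    using factor_AB[OF inv_in[OF g]] by blast
  have "rinv h (rinv f t) = g t" for t
    using fh(3)[of "g t"] A_L[OF fh(1)] B_L[OF fh(2)] g
    by (simp add: incr_inv_eq[OF incr])
  then have "g t = rinv h (rinv f t)" for t by simp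
  then show ?thesis using A_inv[OF fh(1)] B_inv[OF fh(2)] by blast
qed

section \<open>Commutators in a product of two abelian groups\<close>

definition "commutator f h = f \<circ> h \<circ> rinv f \<circ> rinv h"

lemma commutator_in: "f \<in> L \<Longrightarrow> h \<in> L \<Longrightarrow> commutator f h \<in> L"
  by (simp add: commutator_def comp_in inv_in)

text \<open>Write k h k^-1 = h' k' with k' in \<open>A\<close>. As \<open>A\<close> is abelian, k
  commutes with f and k' cancels, so k [f, h] k^-1 = [f, h' k'] = [f, h']. The order of the
  quantifiers matters: h' does not depend on f, and \<open>commutator_commute\<close> relies on
  this.\<close>

lemma conj_A:
  assumes h: "h \<in> B" and k: "k \<in> A"
  shows "\<exists>h'\<in>B. \<forall>f\<in>A. \<forall>t. k (commutator f h (rinv k t)) = commutator f h' t"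
proof -
  have "k \<circ> h \<circ> rinv k \<in> L" using h k by (simp add: A_L B_L comp_in inv_in)
  from factor_BA[OF this] obtain k' h' where h': "k' \<in> A" "h' \<in> B"
    and e: "\<And>t. k (h (rinv k t)) = h' (k' t)" by auto
  note L = A_L[OF k] A_L[OF h'(1)] B_L[OF h] B_L[OF h'(2)]
  have h'_eq: "h' t = k (h (rinv k (rinv k' t)))" for t
    using e[of "rinv k' t"] L by simp
  have invh': "rinv h' t = k' (k (rinv h (rinv k t)))" for t
    unfolding incr_inv_eq[OF incr[OF L(4)]] h'_eq using L by simp
  have "k (commutator f h (rinv k t)) = commutator f h' t" if f: "f \<in> A" for f t
  proof -
    have "commutator f h' t = f (k (h (rinv k (rinv k' (rinv f (k' (k (rinv h (rinv k t)))))))))"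
      by (simp add: commutator_def h'_eq invh')
    also have "rinv f (k' (k (rinv h (rinv k t)))) = k' (k (rinv f (rinv h (rinv k t))))"
      using A_comm[OF A_inv[OF f]] h'(1) k by metis
    also have "f (k (h (rinv k (rinv k' (k' (k (rinv f (rinv h (rinv k t)))))))))
      = k (f (h (rinv f (rinv h (rinv k t)))))"
      using L A_comm[OF f k] by simp
    finally show ?thesis by (simp add: commutator_def)
  qed
  then show ?thesis using h' by blast
qed

lemma conj_B:
  assumes f: "f \<in> A" and k: "k \<in> B"
  shows "\<exists>f'\<in>A. \<forall>h\<in>B. \<forall>t. k (commutator f h (rinv k t)) = commutator f' h t"
proof -
  have "k \<circ> f \<circ> rinv k \<in> L" using f k by (simp add: A_L B_L comp_in inv_in)
  from factor_AB[OF this] obtain f' k' where f': "f' \<in> A" "k' \<in> B"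
    and e: "\<And>t. k (f (rinv k t)) = f' (k' t)" by auto
  note L = A_L[OF f] A_L[OF f'(1)] B_L[OF k] B_L[OF f'(2)]
  have f'_eq: "f' t = k (f (rinv k (rinv k' t)))" for t
    using e[of "rinv k' t"] L by simp
  have invf': "rinv f' t = k' (k (rinv f (rinv k t)))" for t
    unfolding incr_inv_eq[OF incr[OF L(2)]] f'_eq using L by simp
  have "k (commutator f h (rinv k t)) = commutator f' h t" if h: "h \<in> B" for h t
  proof -
    have "commutator f' h t = k (f (rinv k (rinv k' (h (k' (k (rinv f (rinv k (rinv h t)))))))))"
      by (simp add: commutator_def f'_eq invf')
    also have "h (k' (k (rinv f (rinv k (rinv h t))))) = k' (k (h (rinv f (rinv k (rinv h t)))))"
      using B_comm[OF h] f'(2) k by metis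
    also have "rinv k (rinv h t) = rinv h (rinv k t)"
      using B_comm[OF B_inv[OF k] B_inv[OF h]] .
    finally show ?thesis using L by (simp add: commutator_def)
  qed
  then show ?thesis using f' by blast
qed

text \<open>Ito's theorem: a product of two abelian groups is metabelian.\<close>

lemma commutator_commute:
  assumes f: "f \<in> A" and h: "h \<in> B" and f1: "f1 \<in> A" and h1: "h1 \<in> B"
  shows "commutator f h (commutator f1 h1 t) = commutator f1 h1 (commutator f h t)"
proof -
  define k where "k = rinv f1"
  define l where "l = rinv h1"
  have k: "k \<in> A" and l: "l \<in> B" by (auto simp: k_def l_def A_inv B_inv f1 h1)
  note L = A_L[OF f1] B_L[OF h1] A_L[OF k] B_L[OF l]
  have ik: "rinv k t = f1 t" "rinv l t = h1 t" for t
    using L by (simp_all add: incr_inv_eq[OF incr] k_def l_def)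
  obtain h' where h': "h' \<in> B" "\<And>f t. f \<in> A \<Longrightarrow> k (commutator f h (rinv k t)) = commutator f h' t"
    using conj_A[OF h k] by blast
  obtain f' where f': "f' \<in> A" "\<And>h t. h \<in> B \<Longrightarrow> l (commutator f h (rinv l t)) = commutator f' h t"
    using conj_B[OF f l] by blast
  \<comment> \<open>Conjugating [f, h] by l and k in either order leads to the same [f', h'],
    because f' and h' were chosen uniformly. Hence f1 h1 and h1 f1 conjugate [f', h'] in the same
    way, so that [f1, h1] commutes with [f, h].\<close>
  have 1: "k (l (commutator f h (h1 (f1 t)))) = commutator f' h' t" for t
    using f'(2)[OF h] h'(2)[OF f'(1)] by (simp add: ik)
  have 2: "l (k (commutator f h (f1 (h1 t)))) = commutator f' h' t" for t
    using h'(2)[OF f] f'(2)[OF h'(1)] by (simp add: ik)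
  have e1: "commutator f h (h1 (f1 t)) = h1 (f1 (commutator f' h' t))" for t
    unfolding 1[of t, symmetric] k_def l_def using L by simp
  have e2: "commutator f h (f1 (h1 t)) = f1 (h1 (commutator f' h' t))" for t
    unfolding 2[of t, symmetric] k_def l_def using L by simp
  define s where "s = rinv f1 (rinv h1 t)"
  have t: "t = h1 (f1 s)" using L by (simp add: s_def)
  have c1: "commutator f1 h1 (h1 (f1 u)) = f1 (h1 u)" for u
    using L by (simp add: commutator_def)
  show ?thesis unfolding t e1 c1 e2 ..
qed

text \<open>The last clause says that n commutes with its conjugates under \<open>A\<close>. This
  much of the commutation of commutators is also inherited by the inverse of n.\<close>

definition "good n \<longleftrightarrow> n \<in> L \<and> (\<forall>t\<in>I. n t \<noteq> t) \<and>
  (\<forall>f\<in>A. \<forall>t. n (rinv f (n (f t))) = rinv f (n (f (n t))))"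

lemma good_L: "good n \<Longrightarrow> n \<in> L"
  unfolding good_def by blast

lemma good_free: "good n \<Longrightarrow> t \<in> I \<Longrightarrow> n t \<noteq> t"
  unfolding good_def by blast

lemma good_comm: "good n \<Longrightarrow> f \<in> A \<Longrightarrow> n (rinv f (n (f t))) = rinv f (n (f (n t)))"
  unfolding good_def by blast

lemma goodI: "n \<in> L \<Longrightarrow> (\<And>t. t \<in> I \<Longrightarrow> n t \<noteq> t) \<Longrightarrow>
    (\<And>f t. f \<in> A \<Longrightarrow> n (rinv f (n (f t))) = rinv f (n (f (n t)))) \<Longrightarrow> good n"
  unfolding good_def by blast

text \<open>A nontrivial commutator n = [f, h] will do. If it fixed r in \<open>I\<close>, then r
  would be its only fixed point there, hence fixed by all commutators, as these commute with n. The
  conjugates of n under \<open>A\<close> and \<open>B\<close> are commutators, so all of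
  \<open>A\<close> and \<open>B\<close> would have to fix r, against transitivity.\<close>

lemma good_commutator: "\<exists>n. good n"
proof -
  have p': "(p + b1) / 2 \<in> {a1<..<b1}" "(p + b1) / 2 \<noteq> p" and
    q': "(q + b2) / 2 \<in> {a2<..<b2}" "(q + b2) / 2 \<noteq> q" using p q by auto
  obtain f where f: "f \<in> A" "f q \<noteq> q" using tr2[OF q q'(1)] q'(2) by (auto simp: A_def)
  obtain h where h: "h \<in> B" "h p \<noteq> p" using tr1[OF p p'(1)] p'(2) by (auto simp: B_def)
  define n where "n = commutator f h"
  have nL: "n \<in> L" using f h by (simp add: n_def commutator_in A_L B_L)
  have n_ne: "n \<noteq> id"
  proof
    assume "n = id"
    then have "commutator f h (h (f t)) = h (f t)" for t by (simp add: n_def)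
    then have "f (h p) = h (f p)" using A_L[OF f(1)] B_L[OF h(1)] by (simp add: commutator_def)
    then have "f (h p) = h p" "f p = p" using f by (auto simp: A_def)
    then have "f = id" using uniq[OF A_L[OF f(1)], of "h p" p] h p pres1[OF B_L[OF h(1)] p] by blast
    then show False using f by simp
  qed
  have free: "n r \<noteq> r" if r: "r \<in> I" for r
  proof
    assume nr: "n r = r"
    have fixr: "commutator f' h' r = r" if "f' \<in> A" "h' \<in> B" for f' h'
    proof (rule ccontr)
      assume ne: "commutator f' h' r \<noteq> r"
      have "n (commutator f' h' r) = commutator f' h' r"
        using commutator_commute[OF f(1) h(1) that] nr by (simp add: n_def)
      moreover have "commutator f' h' r \<in> I" using pres[OF commutator_in r] that A_L B_L by blast
      ultimately have "n = id" using uniq[OF nL] ne nr r by metis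
      then show False using n_ne by simp
    qed
    have inv_fix: "k r = r" if k: "k \<in> A \<or> k \<in> B" for k
    proof (rule ccontr)
      assume ne: "k r \<noteq> r"
      have kL: "k \<in> L" using k A_L B_L by blast
      have ir: "rinv k r \<noteq> r" using ne kL by (metis inv2)
      have "k (n (rinv k r)) = r"
        using k conj_A[OF h(1), of k] conj_B[OF f(1), of k] fixr f h unfolding n_def by metis
      then have "n (rinv k r) = rinv k r" using kL by (metis inv1)
      moreover have "rinv k r \<in> I" using pres[OF inv_in[OF kL] r] .
      ultimately have "n = id" using uniq[OF nL] ir nr r by metis
      then show False using n_ne by simp
    qed
    show False
    proof (cases "r \<in> {a1<..<b1}")
      case True
      have "(r + b1) / 2 \<in> {a1<..<b1}" "(r + b1) / 2 \<noteq> r" using True by auto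
      then show False using tr1[OF True] inv_fix by (metis (mono_tags, lifting) B_def mem_Collect_eq)
    next
      case False
      then have r2: "r \<in> {a2<..<b2}" using r by blast
      have "(r + b2) / 2 \<in> {a2<..<b2}" "(r + b2) / 2 \<noteq> r" using r2 by auto
      then show False using tr2[OF r2] inv_fix by (metis (mono_tags, lifting) A_def mem_Collect_eq)
    qed
  qed
  have "n (rinv k (n (k t))) = rinv k (n (k (n t)))" if k: "k \<in> A" for k t
  proof -
    obtain h' where h': "h' \<in> B" "\<And>t. rinv k (commutator f h (rinv (rinv k) t)) = commutator f h' t"
      using conj_A[OF h(1) A_inv[OF k]] f(1) by blast
    have "rinv (rinv k) t = k t" for t
      using A_L[OF k] by (simp add: incr_inv_eq[OF incr] inv_in)
    then have "rinv k (n (k t)) = commutator f h' t" for t using h'(2) by (simp add: n_def)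
    then show ?thesis using commutator_commute[OF f(1) h(1) f(1) h'(1)] by (simp add: n_def)
  qed
  then show ?thesis using goodI[OF nL free] by blast
qed

lemma good_inv:
  assumes "good n"
  shows "good (rinv n)"
proof -
  note n = good_L[OF assms]
  have fr: "rinv n t \<noteq> t" if "t \<in> I" for t
    using good_free[OF assms that] inv2[OF n, of t] by metis
  have "rinv n (rinv f (rinv n (f t))) = rinv f (rinv n (f (rinv n t)))" if f: "f \<in> A" for f t
  proof -
    note L = n A_L[OF f]
    define s where "s = rinv n (rinv f (rinv n (f t)))"
    have "n (rinv f (n (f s))) = rinv f (n (f (n s)))" by (rule good_comm[OF assms f])
    also have "\<dots> = t" using L by (simp add: s_def)
    finally have "n (rinv f (n (f s))) = t" .
    then have "rinv n t = rinv f (n (f s))" using inv1[OF n] by metis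
    then have "f (rinv n t) = n (f s)" using inv2[OF A_L[OF f]] by simp
    then have "rinv f (rinv n (f (rinv n t))) = s" using L by simp
    then show ?thesis by (simp add: s_def)
  qed
  then show ?thesis using goodI[OF inv_in[OF n] fr] by blast
qed

text \<open>Take n positive at p and f in \<open>A\<close> with f (n q) = q. The map f n fixes q but
  moves p, so it has no fixed point in the first interval, and f^-1 < n holds there because it holds
  at p. On the other hand, F = f^-1 n f n^-1 commutes with n, whence f^-1 n^j f = F^j n^j. If F is
  positive, some power F^j exceeds n everywhere on the first interval, and evaluating at p shows
  f^-1 > n at n^j p. If F is negative, the same relation is used for the inverses of n and
  F.\<close>

lemma contradiction: False
proof -
  obtain n0 where n0: "good n0" using good_commutator by blast
  obtain n where n: "good n" "p < n p"
  proof (cases "p < n0 p")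
    case False
    then have "n0 p < p" using good_free[OF n0, of p] p by force
    moreover have "n0 \<in> L" by (rule good_L[OF n0])
    ultimately have "p < rinv n0 p" using less[of n0 p "rinv n0 p"] by simp
    then show ?thesis using that good_inv[OF n0] by blast
  qed (use n0 that in blast)
  have nL: "n \<in> L" and n_free: "\<And>t. t \<in> I \<Longrightarrow> n t \<noteq> t"
    and n_comm: "\<And>f t. f \<in> A \<Longrightarrow> n (rinv f (n (f t))) = rinv f (n (f (n t)))"
    using good_L[OF n(1)] good_free[OF n(1)] good_comm[OF n(1)] by blast+
  obtain f where f: "f \<in> L" "f p = p" "f (n q) = q" using tr2[OF pres2[OF nL q] q] by blast
  have fA: "f \<in> A" using f by (simp add: A_def)
  have fn: "f (n r) \<noteq> r" if r: "r \<in> {a1<..<b1}" for r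
  proof
    assume e: "f (n r) = r"
    have "f \<circ> n = id"
      using uniq[OF comp_in[OF f(1) nL], of r q] e r q f(3) disj by auto
    then have "f (n p) = f p" using f(2) by (metis comp_apply id_apply)
    then have "n p = p" using eq[OF f(1)] by blast
    then show False using n by simp
  qed
  \<comment> \<open>\<open>m\<close> stands for \<open>n\<close> or its inverse, and
    \<open>F\<close> for the commutator of the conjugation or its inverse, whichever is positive on
    the first interval.\<close>
  have step: False if m: "m \<in> L" "\<And>t. t \<in> {a1<..<b1} \<Longrightarrow> m t \<in> {a1<..<b1}"
    and F: "F \<in> L" "\<And>t. rinv f (m (f t)) = F (m t)" "\<And>t. F (m t) = m (F t)" "\<And>t. F (n t) = n (F t)"
    and pos: "\<And>t. t \<in> {a1<..<b1} \<Longrightarrow> t < F t" for m F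
  proof -
    obtain j where j: "n p < (F ^^ j) p"
      using powers_unbounded[OF F(1) p _ pos] pres1[OF nL p] by auto
    have Fj: "(F ^^ j) \<in> L" by (rule pow_in[OF F(1)])
    have comm: "(F ^^ j) (n t) = n ((F ^^ j) t)" for t by (induction j) (auto simp: F(4))
    have gt: "n t < (F ^^ j) t" if t: "t \<in> {a1<..<b1}" for t
    proof (rule ordered_on_interval[OF nL Fj p t _ j])
      fix r assume r: "r \<in> {a1<..<b1}"
      show "n r \<noteq> (F ^^ j) r"
      proof
        assume e: "n r = (F ^^ j) r"
        \<comment> \<open>\<open>W\<close> commutes with n, so that a fixed point r brings along a
          second one, n r.\<close>
        define W where "W = rinv n \<circ> (F ^^ j)"
        have W: "W \<in> L" unfolding W_def by (intro comp_in inv_in nL Fj)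
        have "W r = r" using e nL by (metis W_def comp_apply inv1)
        moreover have "W (n r) = n r"
          unfolding W_def comp_apply comm inv1[OF nL] by (rule e[symmetric])
        moreover have "n r \<in> I" "n r \<noteq> r" using pres1[OF nL r] n_free r by auto
        ultimately have "W = id" using uniq[OF W, of r "n r"] r by auto
        then have "n (W p) = n p" by simp
        then have "(F ^^ j) p = n p" using nL by (simp add: W_def)
        then show False using j by simp
      qed
    qed
    define r where "r = (m ^^ j) p"
    have rI: "r \<in> {a1<..<b1}" unfolding r_def using p m(2) by (induction j) auto
    have Fm: "(F ^^ i) (m t) = m ((F ^^ i) t)" for i t by (induction i) (auto simp: F(3))
    have "rinv f ((m ^^ i) (f t)) = (F ^^ i) ((m ^^ i) t)" for i t
    proof (induction i)
      case (Suc i)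
      have "rinv f ((m ^^ Suc i) (f t)) = rinv f (m (f (rinv f ((m ^^ i) (f t)))))"
        using f(1) by simp
      also have "\<dots> = F (m ((F ^^ i) ((m ^^ i) t)))" unfolding F(2) Suc.IH ..
      finally show ?case by (simp add: Fm)
    qed (use f(1) in simp)
    from this[of j p] have "rinv f r = (F ^^ j) r" by (simp add: r_def f(2))
    then have 1: "n r < rinv f r" using gt[OF rI] by simp
    have ifp: "rinv f p = p" using f by (simp add: incr_inv_eq[OF incr])
    have "n p < rinv f p"
    proof (rule ordered_on_interval[OF nL inv_in[OF f(1)] rI p _ 1])
      show "n t \<noteq> rinv f t" if "t \<in> {a1<..<b1}" for t using fn[OF that] f(1) by auto
    qed
    then show False using ifp n by simp
  qed
  \<comment> \<open>Chosen so that f^-1 n f = F n; it commutes with n because n commutes with that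
    conjugate.\<close>
  define F where "F = rinv f \<circ> n \<circ> f \<circ> rinv n"
  have FL: "F \<in> L" unfolding F_def by (intro comp_in inv_in nL f)
  have Fn: "F (n t) = n (F t)" for t
    using n_comm[OF fA, of "rinv n t"] nL by (simp add: F_def)
  have F_free: "F r \<noteq> r" if r: "r \<in> I" for r
  proof
    assume e: "F r = r"
    then have "F (n r) = n r" using Fn by simp
    then have "F = id" using uniq[OF FL, of r "n r"] r pres[OF nL r] n_free[OF r] e by metis
    then have "F (n p) = n p" by simp
    then have "rinv f (n p) = n p" using nL f by (simp add: F_def)
    then have "f (n p) = n p" using f by (metis inv2)
    moreover have "n p \<in> {a1<..<b1}" using pres1[OF nL p] .
    ultimately have "f = id" using uniq[OF f(1), of p "n p"] p f(2) n(2) by auto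
    then show False using f(3) n_free[of q] q by simp
  qed
  have Fi: "rinv F \<in> L" using FL by (rule inv_in)
  show False
  proof (cases "p < F p")
    case True
    have pos: "t < F t" if "t \<in> {a1<..<b1}" for t
      using no_fixed_point_sign[OF FL _ p that True] F_free by blast
    have conj: "rinv f (n (f t)) = F (n t)" for t unfolding F_def comp_apply inv1[OF nL] ..
    show False by (rule step[OF nL pres1[OF nL] FL conj Fn Fn pos])
  next
    case False
    then have "F p < p" using F_free[of p] p by force
    then have ip: "p < rinv F p" using less[OF FL, of p "rinv F p"] FL by simp
    have iF: "rinv F (n t) = n (rinv F t)" for t
      using Fn[of "rinv F t"] inv2[OF FL, of t] inv1[OF FL, of "n (rinv F t)"] by simp
    have iF_free: "rinv F t \<noteq> t" if "t \<in> I" for t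
      using F_free[OF that] inv2[OF FL, of t] by metis
    have iF_in: "rinv F (rinv n t) = rinv n (rinv F t)" for t
      using iF[of "rinv n t"] inv2[OF nL, of t] inv1[OF nL, of "rinv F (rinv n t)"] by simp
    have pos: "t < rinv F t" if "t \<in> {a1<..<b1}" for t
      using no_fixed_point_sign[OF Fi _ p that ip] iF_free by blast
    have conj: "rinv f (rinv n (f t)) = rinv F (rinv n t)" for t
    proof -
      have "F (n (rinv f (rinv n (f t)))) = t"
        using nL f(1) by (simp add: F_def)
      then have "n (rinv f (rinv n (f t))) = rinv F t" using inv1[OF FL] by metis
      then show ?thesis unfolding iF_in using inv1[OF nL] by metis
    qed
    show False
      by (rule step[OF inv_in[OF nL] pres1[OF inv_in[OF nL]] Fi conj iF_in iF pos])
  qed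
qed

end

section \<open>Mountain climbing for continua\<close>

text \<open>The numbers 0, 1, 2, 3 stand for the directions right, up, left, down in the plane.\<close>

definition turn :: "nat \<Rightarrow> nat \<Rightarrow> int" where
  "turn x y = (if y = Suc x mod 4 then 1 else if x = Suc y mod 4 then - 1 else 0)"

definition opposite :: "nat \<Rightarrow> nat \<Rightarrow> bool" where
  "opposite x y \<longleftrightarrow> (x + 2) mod 4 = y"

text \<open>Three pairwise non-opposite directions take at most two values, which are neighbours,
  and there turns add up.\<close>

lemma turn_triangle:
  assumes "x < 4" "y < 4" "z < 4" "\<not> opposite x y" "\<not> opposite y z" "\<not> opposite x z"
  shows "turn x y + turn y z = turn x z"
proof -
  have "x \<in> {0,1,2,3}" "y \<in> {0,1,2,3}" "z \<in> {0,1,2,3}" using assms by auto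
  then show ?thesis using assms by (elim insertE emptyE) (simp_all add: turn_def opposite_def)
qed

text \<open>If left never occurs, down can be renumbered as -1 and a turn becomes a difference of
  numbers, so that sums of turns telescope. If right never occurs, the numbers 1, 2, 3 already
  serve.\<close>

lemma turn_low:
  assumes "x < 4" "y < 4" "\<not> opposite x y" "x \<noteq> 2" "y \<noteq> 2"
  shows "turn x y = (if y = 3 then - 1 else int y) - (if x = 3 then - 1 else int x)"
proof -
  have "x \<in> {0,1,3}" "y \<in> {0,1,3}" using assms by auto
  then show ?thesis using assms by (elim insertE emptyE) (simp_all add: turn_def opposite_def)
qed

lemma turn_high:
  assumes "x < 4" "y < 4" "\<not> opposite x y" "x \<noteq> 0" "y \<noteq> 0"
  shows "turn x y = int y - int x"
proof -
  have "x \<in> {1,2,3}" "y \<in> {1,2,3}" using assms by auto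
  then show ?thesis using assms by (elim insertE emptyE) (simp_all add: turn_def opposite_def)
qed

lemma sum_turn_low:
  assumes "\<And>i. i \<le> m \<Longrightarrow> s i < 4 \<and> s i \<noteq> 2" "\<And>i. i < m \<Longrightarrow> \<not> opposite (s i) (s (Suc i))"
  shows "(\<Sum>i<m. turn (s i) (s (Suc i))) = (if s m = 3 then - 1 else int (s m)) - (if s 0 = 3 then - 1 else int (s 0))"
  using assms by (induction m) (auto simp: turn_low)

lemma sum_turn_high:
  assumes "\<And>i. i \<le> m \<Longrightarrow> s i < 4 \<and> s i \<noteq> 0" "\<And>i. i < m \<Longrightarrow> \<not> opposite (s i) (s (Suc i))"
  shows "(\<Sum>i<m. turn (s i) (s (Suc i))) = int (s m) - int (s 0)"
  using assms by (induction m) (auto simp: turn_high)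

text \<open>A discrete winding number: around each cell the turns cancel, but along the boundary
  they would add up to a full rotation.\<close>

lemma grid_winding:
  fixes s :: "nat \<Rightarrow> nat \<Rightarrow> nat"
  assumes s4: "\<And>i j. i \<le> m \<Longrightarrow> j \<le> n \<Longrightarrow> s i j < 4"
    and h: "\<And>i j. i < m \<Longrightarrow> j \<le> n \<Longrightarrow> \<not> opposite (s i j) (s (Suc i) j)"
    and v: "\<And>i j. i \<le> m \<Longrightarrow> j < n \<Longrightarrow> \<not> opposite (s i j) (s i (Suc j))"
    and d: "\<And>i j. i < m \<Longrightarrow> j < n \<Longrightarrow> \<not> opposite (s i j) (s (Suc i) (Suc j))"
    and bottom: "\<And>i. i \<le> m \<Longrightarrow> s i 0 \<noteq> 2" and right: "\<And>j. j \<le> n \<Longrightarrow> s m j \<noteq> 2"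
    and left: "\<And>j. j \<le> n \<Longrightarrow> s 0 j \<noteq> 0" and top: "\<And>i. i \<le> m \<Longrightarrow> s i n \<noteq> 0"
    and c0: "s 0 0 = 3" and c1: "s m n = 1"
  shows False
proof -
  define H where "H j = (\<Sum>i<m. turn (s i j) (s (Suc i) j))" for j
  define V where "V i j = turn (s i j) (s i (Suc j))" for i j
  \<comment> \<open>The diagonal cuts the cell into two triangles, and both routes agree with the
    turn along the diagonal.\<close>
  have cell: "turn (s i j) (s (Suc i) j) + V (Suc i) j = V i j + turn (s i (Suc j)) (s (Suc i) (Suc j))"
    if "i < m" "j < n" for i j
    unfolding V_def using that
    by (simp add: turn_triangle s4 h v d)
  have row: "H j + V m j = V 0 j + H (Suc j)" if j: "j < n" for j
  proof -
    have "(\<Sum>i<k. turn (s i j) (s (Suc i) j)) + V k j = V 0 j + (\<Sum>i<k. turn (s i (Suc j)) (s (Suc i) (Suc j)))"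
      if "k \<le> m" for k
      using that
    proof (induction k)
      case (Suc k)
      then show ?case using cell[of k j] j by simp
    qed simp
    then show ?thesis by (simp add: H_def)
  qed
  have "H 0 + (\<Sum>j<k. V m j) = (\<Sum>j<k. V 0 j) + H k" if "k \<le> n" for k
    using that
  proof (induction k)
    case (Suc k)
    then show ?case using row[of k] by simp
  qed simp
  from this[of n] have eq: "H 0 + (\<Sum>j<n. V m j) = (\<Sum>j<n. V 0 j) + H n" by simp
  \<comment> \<open>Both boundary routes lead from down to up, but the one along the bottom and the
    right turns by +2 quarters and the one along the left and the top by -2.\<close>
  have "H 0 = (if s m 0 = 3 then - 1 else int (s m 0)) - (- 1)"
    unfolding H_def using sum_turn_low[of m "\<lambda>i. s i 0"] s4 bottom h c0 by simp
  moreover have "(\<Sum>j<n. V m j) = 1 - (if s m 0 = 3 then - 1 else int (s m 0))"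
    unfolding V_def using sum_turn_low[of n "\<lambda>j. s m j"] s4 right v c1 by simp
  moreover have "(\<Sum>j<n. V 0 j) = int (s 0 n) - 3"
    unfolding V_def using sum_turn_high[of n "\<lambda>j. s 0 j"] s4 left v c0 by simp
  moreover have "H n = 1 - int (s 0 n)"
    unfolding H_def using sum_turn_high[of m "\<lambda>i. s i n"] s4 top h c1 by simp
  ultimately show False using eq by simp
qed

text \<open>Within C, the e/2-neighbourhoods of the points reachable by chains and of the
  unreachable ones are disjoint, since a common point would extend a chain by a step shorter than e.
  They would disconnect C.\<close>

lemma connected_chain:
  fixes C :: "'a::metric_space set"
  assumes C: "connected C" and a: "a \<in> C" and b: "b \<in> C" and e: "e > 0"
  obtains n :: nat and c where "c 0 = a" "c n = b" "\<And>i. i \<le> n \<Longrightarrow> c i \<in> C"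
    "\<And>i. i < n \<Longrightarrow> dist (c i) (c (Suc i)) < e"
proof -
  define R where "R x \<longleftrightarrow> (\<exists>n c. c 0 = a \<and> c n = x \<and> (\<forall>i\<le>n. c i \<in> C) \<and>
    (\<forall>i<n. dist (c i) (c (Suc i)) < e))" for x
  have ext: "R y" if x: "R x" and y: "y \<in> C" "dist x y < e" for x y
  proof -
    obtain n c where c: "c 0 = a" "c n = x" "\<forall>i\<le>n. c i \<in> C" "\<forall>i<n. dist (c i) (c (Suc i)) < e"
      using x unfolding R_def by blast
    define c' where "c' = c(Suc n := y)"
    show ?thesis unfolding R_def
    proof (rule exI[of _ "Suc n"], rule exI[of _ c'], intro conjI allI impI)
      show "c' 0 = a" "c' (Suc n) = y" using c(1) by (auto simp: c'_def)
      show "c' i \<in> C" if "i \<le> Suc n" for i using that c(3) y by (auto simp: c'_def le_Suc_eq)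
      show "dist (c' i) (c' (Suc i)) < e" if "i < Suc n" for i
        using that c(2,4) y by (auto simp: c'_def less_Suc_eq)
    qed
  qed
  have "R b"
  proof (rule ccontr)
    assume nb: "\<not> R b"
    define U where "U = (\<Union>x\<in>{x\<in>C. R x}. ball x (e/2))"
    define W where "W = (\<Union>x\<in>{x\<in>C. \<not> R x}. ball x (e/2))"
    have "R a" unfolding R_def by (rule exI[of _ 0], rule exI[of _ "\<lambda>_. a"]) (use a in auto)
    then have "a \<in> U \<inter> C" using a e by (auto simp: U_def intro!: exI[of _ a])
    then have "U \<inter> C \<noteq> {}" by blast
    moreover have "b \<in> W \<inter> C" using b nb e by (auto simp: W_def intro!: exI[of _ b])
    then have "W \<inter> C \<noteq> {}" by blast
    moreover have "C \<subseteq> U \<union> W"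
    proof
      fix x assume "x \<in> C"
      moreover have "x \<in> ball x (e/2)" using e by simp
      ultimately show "x \<in> U \<union> W" unfolding U_def W_def by blast
    qed
    moreover have "U \<inter> W \<inter> C = {}"
    proof (rule ccontr)
      assume "U \<inter> W \<inter> C \<noteq> {}"
      then obtain z x y where "z \<in> C" and x: "x \<in> C" "R x" "dist x z < e/2" and y: "y \<in> C" "\<not> R y" "dist y z < e/2"
        by (auto simp: U_def W_def)
      then have "dist x y < e" using dist_triangle2[of x y z] by linarith
      then show False using ext[OF x(2) y(1)] y(2) by blast
    qed
    moreover have "open U" "open W" by (auto simp: U_def W_def)
    ultimately show False using C unfolding connected_def by blast
  qed
  then show thesis unfolding R_def using that by blast
qed

text \<open>If the component of (a0, b0) in the zero set of w = u1 - u2 missed (a1, b1), the zero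
  set would split into two closed parts P and Q. A function that separates P from Q, together with
  w, would form a planar vector field without zeros on C1 x C2, and its behaviour on the boundary
  contradicts \<open>grid_winding\<close>. Finite chains stand in for paths, which the continua need
  not contain.\<close>

lemma climb:
  fixes C1 :: "'a::metric_space set" and C2 :: "'b::metric_space set" and u1 u2 :: "_ \<Rightarrow> real"
  assumes C1: "compact C1" "connected C1" and C2: "compact C2" "connected C2"
    and u1: "continuous_on C1 u1" "\<And>x. x \<in> C1 \<Longrightarrow> m \<le> u1 x \<and> u1 x \<le> M"
    and u2: "continuous_on C2 u2" "\<And>x. x \<in> C2 \<Longrightarrow> m \<le> u2 x \<and> u2 x \<le> M"
    and a0: "a0 \<in> C1" "u1 a0 = m" and a1: "a1 \<in> C1" "u1 a1 = M"
    and b0: "b0 \<in> C2" "u2 b0 = m" and b1: "b1 \<in> C2" "u2 b1 = M"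
  shows "\<exists>D. D \<subseteq> {z \<in> C1 \<times> C2. u1 (fst z) = u2 (snd z)} \<and> compact D \<and> connected D \<and>
    (a0, b0) \<in> D \<and> (a1, b1) \<in> D"
proof -
  define K where "K = C1 \<times> C2"
  define w where "w z = u1 (fst z) - u2 (snd z)" for z
  define Z where "Z = {z \<in> K. w z = 0}"
  have K: "compact K" using C1 C2 by (simp add: K_def compact_Times)
  have w: "continuous_on K w" unfolding K_def w_def
    by (intro continuous_intros continuous_on_compose2[OF u1(1)] continuous_on_compose2[OF u2(1)]) auto
  have Z: "compact Z"
  proof -
    have "Z = K \<inter> w -` {0}" by (auto simp: Z_def)
    moreover have "closed (K \<inter> w -` {0})"
      by (intro continuous_closed_preimage w compact_imp_closed K) auto
    ultimately show ?thesis using K by (metis compact_Int_closed inf.left_idem)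
  qed
  define X where "X = top_of_set Z"
  define D where "D = connected_component_of_set X (a0, b0)"
  have z0: "(a0, b0) \<in> Z" and z1: "(a1, b1) \<in> Z" using a0 a1 b0 b1 by (auto simp: Z_def K_def w_def)
  have X: "compact_space X" "Hausdorff_space X" "topspace X = Z"
    using Z by (auto intro!: Hausdorff_space_subtopology compact_space_subtopology simp: X_def)
  have D_closed: "closedin X D" unfolding D_def by (rule closedin_connected_component_of)
  have D_compact: "compactin X D" by (rule closedin_compact_space[OF X(1) D_closed])
  have "(a1, b1) \<in> D"
  proof (rule ccontr)
    assume nD: "(a1, b1) \<notin> D"
    \<comment> \<open>In a compact Hausdorff space components are quasi-components, so a point
      outside the component can be split off by a clopen set.\<close>
    have "separated_between X D {(a1, b1)}"
    proof (rule separated_between_compact_connected_component)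
      show "locally_compact_space X" using X(1) by (rule compact_imp_locally_compact_space)
      show "D \<in> connected_components_of X"
        unfolding D_def using z0 X(3) by (simp add: connected_component_in_connected_components_of)
      show "closedin X {(a1, b1)}" using X z1 by (simp add: closedin_Hausdorff_singleton)
    qed (use X D_compact nD in auto)
    then obtain P Q where PQ: "closedin X P" "closedin X Q" "P \<union> Q = Z" "P \<inter> Q = {}" "D \<subseteq> P" "(a1, b1) \<in> Q"
      unfolding separated_between_alt X(3) disjnt_def by auto
    have "(a0, b0) \<in> D" using z0 X(3) by (simp add: D_def connected_component_of_refl)
    then have P: "closed P" "P \<subseteq> Z" "(a0,b0) \<in> P" and Q: "closed Q" "P \<inter> Q = {}" "P \<union> Q = Z" "(a1,b1) \<in> Q"
      using PQ Z compact_imp_closed[OF Z] by (auto simp: X_def closedin_closed_eq)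
    have cP: "compact P" using P(1,2) Z by (metis compact_Int_closed inf.absorb_iff2 inf_commute)
    obtain d where d: "d > 0" "\<And>x y. x \<in> P \<Longrightarrow> y \<in> Q \<Longrightarrow> d \<le> dist x y"
    proof -
      have "P \<subseteq> - Q" using Q(2) by blast
      then obtain d where "d > 0" "(\<Union>x\<in>P. ball x d) \<subseteq> - Q"
        using compact_subset_open_imp_ball_epsilon_subset[OF cP, of "- Q"] Q(1) by blast
      then show ?thesis using that[of d] by (force simp: not_le)
    qed
    define UP where "UP = (\<Union>x\<in>P. ball x (d/3))"
    define UQ where "UQ = (\<Union>x\<in>Q. ball x (d/3))"
    have far: "d/3 < dist x y" if xy: "x \<in> UP" "y \<in> UQ" for x y
    proof -
      obtain x' where "x' \<in> P" "x \<in> ball x' (d/3)" using xy(1) unfolding UP_def by blast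
      then have x': "x' \<in> P" "dist x' x < d/3" by (simp_all only: mem_ball)
      obtain y' where "y' \<in> Q" "y \<in> ball y' (d/3)" using xy(2) unfolding UQ_def by blast
      then have y': "y' \<in> Q" "dist y' y < d/3" by (simp_all only: mem_ball)
      show ?thesis using d(2)[OF x'(1) y'(1)] x' y' dist_triangle[of x' y' x] dist_triangle[of x y' y]
        by (simp add: dist_commute)
    qed
    define K' where "K' = K - (UP \<union> UQ)"
    have "compact K'" unfolding K'_def using K by (intro compact_diff) (auto simp: UP_def UQ_def)
    moreover have "continuous_on K' w" using w by (rule continuous_on_subset) (auto simp: K'_def)
    moreover have nz: "w z \<noteq> 0" if "z \<in> K'" for z
    proof
      assume "w z = 0"
      then have "z \<in> P \<union> Q" using that Q by (auto simp: Z_def K'_def)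
      then have "z \<in> UP \<union> UQ" using d(1) by (force simp: UP_def UQ_def)
      then show False using that by (simp add: K'_def)
    qed
    ultimately obtain \<eta> where \<eta>: "\<eta> > 0" "\<And>z. z \<in> K' \<Longrightarrow> \<eta> \<le> \<bar>w z\<bar>"
    proof (cases "K' = {}")
      case False
      have "continuous_on K' (\<lambda>z. \<bar>w z\<bar>)" using \<open>continuous_on K' w\<close> by (intro continuous_intros)
      then obtain z where "z \<in> K'" "\<And>y. y \<in> K' \<Longrightarrow> \<bar>w z\<bar> \<le> \<bar>w y\<bar>"
        using continuous_attains_inf[OF \<open>compact K'\<close> False] by blast
      then show ?thesis using that[of "\<bar>w z\<bar>"] nz by auto
    qed (use that[of 1] in auto)
    obtain r where r: "r > 0" "\<And>z z'. z \<in> K \<Longrightarrow> z' \<in> K \<Longrightarrow> dist z z' < r \<Longrightarrow> \<bar>w z - w z'\<bar> < \<eta>"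
      using compact_uniformly_continuous[OF w K] \<eta>(1) unfolding uniformly_continuous_on_def dist_real_def
      by metis
    \<comment> \<open>Halved because a diagonal step moves in both factors, and distances in the
      product are bounded by the sum of the two.\<close>
    define e where "e = min r (d/3) / 2"
    have e: "e > 0" using r d by (simp add: e_def)
    obtain N1 c1 where c1: "c1 0 = a0" "c1 N1 = a1" "\<And>i. i \<le> N1 \<Longrightarrow> c1 i \<in> C1"
      "\<And>i. i < N1 \<Longrightarrow> dist (c1 i) (c1 (Suc i)) < e"
      using connected_chain[OF C1(2) a0(1) a1(1) e] by metis
    obtain N2 c2 where c2: "c2 0 = b0" "c2 N2 = b1" "\<And>i. i \<le> N2 \<Longrightarrow> c2 i \<in> C2"
      "\<And>i. i < N2 \<Longrightarrow> dist (c2 i) (c2 (Suc i)) < e"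
      using connected_chain[OF C2(2) b0(1) b1(1) e] by metis
    \<comment> \<open>the direction of the nowhere vanishing vector whose coordinates are \<open>w\<close> and a function that
      is positive on \<open>Q\<close> and negative on \<open>P\<close>\<close>
    define st where "st z = (if z \<in> UP then 3 else if z \<in> UQ then 1 else if w z > 0 then 0 else 2::nat)" for z
    have st: "\<not> opposite (st z) (st z')" if z: "z \<in> K" "z' \<in> K" "dist z z' < min r (d/3)" for z z'
    proof
      assume o: "opposite (st z) (st z')"
      have cases: "(z \<in> UP \<and> z' \<in> UQ) \<or> (z \<in> UQ \<and> z' \<in> UP) \<or> (z \<in> K' \<and> z' \<in> K' \<and> w z > 0 \<and> w z' \<le> 0)
        \<or> (z \<in> K' \<and> z' \<in> K' \<and> w z \<le> 0 \<and> w z' > 0)"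
        using o z by (auto simp: opposite_def st_def K'_def split: if_splits)
      then show False
      proof (elim disjE)
        assume "z \<in> K' \<and> z' \<in> K' \<and> w z > 0 \<and> w z' \<le> 0"
        then show False using \<eta>(2)[of z] \<eta>(2)[of z'] r(2)[OF z(1,2)] z(3) \<eta>(1) by linarith
      next
        assume "z \<in> K' \<and> z' \<in> K' \<and> w z \<le> 0 \<and> w z' > 0"
        then show False using \<eta>(2)[of z] \<eta>(2)[of z'] r(2)[OF z(1,2)] z(3) \<eta>(1) by linarith
      qed (use far[of z z'] far[of z' z] z(3) in \<open>auto simp: dist_commute\<close>)
    qed
    define s where "s i j = st (c1 i, c2 j)" for i j
    have inK: "(c1 i, c2 j) \<in> K" if "i \<le> N1" "j \<le> N2" for i j
      using that c1 c2 by (simp add: K_def)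
    have dst: "dist (x, y) (x', y') < min r (d/3)" if "dist x x' < e" "dist y y' < e" for x x' :: 'a and y y' :: 'b
    proof -
      have "dist (x, y) (x', y') \<le> dist x x' + dist y y'"
        by (simp add: dist_Pair_Pair sqrt_sum_squares_le_sum)
      then show ?thesis using that by (simp add: e_def)
    qed
    have w_out: "w z \<noteq> 0" if "z \<in> K" "z \<notin> UP" "z \<notin> UQ" for z using nz that by (simp add: K'_def)
    \<comment> \<open>The boundary conditions come from the extreme heights: w \<ge> 0 where u2 = m
      or u1 = M, and w \<le> 0 where u1 = m or u2 = M. Since 2 is also the default of
      \<open>st\<close> at a zero of w, \<open>w_out\<close> is needed here.\<close>
    have ne2: "st z \<noteq> 2" if "z \<in> K" "w z \<ge> 0" for z
      using that w_out[of z] by (auto simp: st_def)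
    have ne0: "st z \<noteq> 0" if "z \<in> K" "w z \<le> 0" for z
      using that by (auto simp: st_def)
    show False
    proof (rule grid_winding[of N1 N2 s])
      show "s i j < 4" for i j by (simp add: s_def st_def)
      show "\<not> opposite (s i j) (s (Suc i) j)" if "i < N1" "j \<le> N2" for i j
        unfolding s_def by (rule st) (use that inK c1 e dst in auto)
      show "\<not> opposite (s i j) (s i (Suc j))" if "i \<le> N1" "j < N2" for i j
        unfolding s_def by (rule st) (use that inK c2 e dst in auto)
      show "\<not> opposite (s i j) (s (Suc i) (Suc j))" if "i < N1" "j < N2" for i j
        unfolding s_def by (rule st) (use that inK c1 c2 e dst in auto)
      show "s i 0 \<noteq> 2" if "i \<le> N1" for i
        unfolding s_def by (rule ne2) (use that inK c1 c2 u1(2) b0 in \<open>auto simp: w_def\<close>)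
      show "s N1 j \<noteq> 2" if "j \<le> N2" for j
        unfolding s_def by (rule ne2) (use that inK c1 c2 u2(2) a1 in \<open>auto simp: w_def\<close>)
      show "s 0 j \<noteq> 0" if "j \<le> N2" for j
        unfolding s_def by (rule ne0) (use that inK c1 c2 u2(2) a0 in \<open>auto simp: w_def\<close>)
      show "s i N2 \<noteq> 0" if "i \<le> N1" for i
        unfolding s_def by (rule ne0) (use that inK c1 c2 u1(2) b1 in \<open>auto simp: w_def\<close>)
      have "(a0, b0) \<in> UP" using P(3) d(1) by (force simp: UP_def)
      then show "s 0 0 = 3" by (simp add: s_def c1 c2 st_def)
      have q: "(a1, b1) \<in> UQ" using Q(4) d(1) by (force simp: UQ_def)
      have "(a1, b1) \<notin> UP" using far[OF _ q, of "(a1, b1)"] d(1) by auto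
      then show "s N1 N2 = 1" using q by (simp add: s_def c1 c2 st_def)
    qed
  qed
  moreover have "compact D" using D_compact by (simp add: X_def compactin_subtopology)
  moreover have "connected D"
    using connectedin_connected_component_of[of X "(a0, b0)"] by (simp add: D_def X_def connectedin_subtopology)
  moreover have "D \<subseteq> Z" using closedin_subset[OF D_closed] X(3) by simp
  moreover have "(a0, b0) \<in> D" using z0 X(3) by (simp add: D_def connected_component_of_refl)
  ultimately show ?thesis by (intro exI[of _ D]) (auto simp: Z_def K_def w_def)
qed

section \<open>Circle homeomorphisms in coordinates\<close>

declare mem_sphere [simp del] mem_sphere_0 [simp del]

lemma cis_eq_iff: "cis s = cis t \<longleftrightarrow> (\<exists>k::int. s = t + 2 * pi * of_int k)"
proof -
  have "cis s = cis t \<longleftrightarrow> sin s = sin t \<and> cos s = cos t"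
    by (auto simp: complex_eq_iff)
  also have "\<dots> \<longleftrightarrow> (\<exists>k::int. s = t + 2 * pi * of_int k)"
    by (subst sin_cos_eq_iff) (auto simp: algebra_simps)
  finally show ?thesis .
qed

lemma cis_inj_interval:
  assumes "cis s = cis t" "\<bar>s - t\<bar> < 2 * pi"
  shows "s = t"
proof -
  obtain k :: int where k: "s = t + 2 * pi * of_int k" using assms(1) cis_eq_iff by blast
  then have "\<bar>of_int k\<bar> * (2 * pi) < 1 * (2 * pi)" using assms(2) by (simp add: abs_mult)
  then have "\<bar>of_int k\<bar> < (1::real)" by (subst (asm) mult_less_cancel_right) auto
  then have "k = 0" by linarith
  then show ?thesis using k by simp
qed

lemma cis_coordinate:
  assumes "z \<in> S1"
  obtains t where "b \<le> t" "t < b + 2 * pi" "z = cis t"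
proof -
  obtain s where s: "z = cis s" using assms S1_eq_cis by blast
  define t where "t = b + (s - b - 2 * pi * of_int \<lfloor>(s - b) / (2 * pi)\<rfloor>)"
  have "z = cis t" unfolding s cis_eq_iff t_def by (intro exI[of _ "\<lfloor>(s - b) / (2 * pi)\<rfloor>"]) simp
  moreover have "b \<le> t" "t < b + 2 * pi"
  proof -
    define x where "x = (s - b) / (2 * pi)"
    have sx: "s - b = 2 * pi * x" by (simp add: x_def)
    have t: "t = b + 2 * pi * (x - of_int \<lfloor>x\<rfloor>)" unfolding t_def x_def[symmetric] sx by (simp add: algebra_simps)
    have "0 \<le> x - of_int \<lfloor>x\<rfloor>" "x - of_int \<lfloor>x\<rfloor> < 1" by linarith+
    then have "0 \<le> 2 * pi * (x - of_int \<lfloor>x\<rfloor>)" "2 * pi * (x - of_int \<lfloor>x\<rfloor>) < 2 * pi * 1"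
      by (auto intro!: mult_strict_left_mono)
    then show "b \<le> t" "t < b + 2 * pi" unfolding t by auto
  qed
  ultimately show ?thesis using that by blast
qed

definition "hmul f g = compose S1 f g"
definition "hinv f = restrict (inv_into S1 f) S1"
definition "hid = (\<lambda>x\<in>S1. x)"

lemma hmul_in: "f \<in> homeo_S1 \<Longrightarrow> g \<in> homeo_S1 \<Longrightarrow> hmul f g \<in> homeo_S1"
  by (simp add: hmul_def compose_in_homeo_S1)

lemma hinv_in: "f \<in> homeo_S1 \<Longrightarrow> hinv f \<in> homeo_S1"
  by (simp add: hinv_def inv_in_homeo_S1)

lemma hid_in: "hid \<in> homeo_S1"
  unfolding hid_def by (rule id_in_homeo_S1)

lemma homeo_bij: "f \<in> homeo_S1 \<Longrightarrow> bij_betw f S1 S1"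
  by (simp add: homeo_S1_def Bij_def)

lemma homeo_range: "f \<in> homeo_S1 \<Longrightarrow> z \<in> S1 \<Longrightarrow> f z \<in> S1"
  by (rule homeo_S1_in_S1)

lemma hmul_apply: "z \<in> S1 \<Longrightarrow> hmul f g z = f (g z)"
  unfolding hmul_def by (rule compose_eq)

lemma hid_apply: "z \<in> S1 \<Longrightarrow> hid z = z"
  unfolding hid_def by (rule restrict_apply')

lemma hinv_left: "f \<in> homeo_S1 \<Longrightarrow> z \<in> S1 \<Longrightarrow> hinv f (f z) = z"
  using homeo_bij[of f] homeo_range[of f z]
  unfolding hinv_def by (metis bij_betw_inv_into_left restrict_apply')

lemma hinv_right: "f \<in> homeo_S1 \<Longrightarrow> z \<in> S1 \<Longrightarrow> f (hinv f z) = z"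
  using homeo_bij[of f]
  unfolding hinv_def by (metis bij_betw_inv_into_right restrict_apply')

lemma homeo_eqI: "f \<in> homeo_S1 \<Longrightarrow> g \<in> homeo_S1 \<Longrightarrow> (\<And>z. z \<in> S1 \<Longrightarrow> f z = g z) \<Longrightarrow> f = g"
  by (rule extensionalityI[of f S1]) (auto simp: homeo_S1_def Bij_def)

lemma homeo_inj: "f \<in> homeo_S1 \<Longrightarrow> x \<in> S1 \<Longrightarrow> y \<in> S1 \<Longrightarrow> f x = f y \<longleftrightarrow> x = y"
  using hinv_left by metis

lemma homeo_continuous: "f \<in> homeo_S1 \<Longrightarrow> continuous_on S1 f"
  by (simp add: homeo_S1_def homeomorphism_def)

lemma cis_S1: "cis t \<in> S1"
  using S1_eq_cis by blast

text \<open>Translation by a multiple of 2 pi adjusts the value of a lift at a; surjectivity comes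
  from its growth by 2 pi in each period.\<close>

lemma homeo_lift_at:
  assumes f: "f \<in> homeo_S1" and "f (cis a) = cis b"
  obtains F where "incr F" "\<And>t. F (t + 2 * pi) = F t + 2 * pi" "\<And>t. f (cis t) = cis (F t)" "F a = b"
proof -
  have lift: "\<exists>F. continuous_on UNIV F \<and> strict_mono F \<and> (\<forall>t. F (t + 2 * pi) = F t + 2 * pi) \<and> (\<forall>t. f (cis t) = cis (F t))"
    using f by (auto simp: homeo_S1_def orientation_preserving_def)
  then obtain F where F: "continuous_on UNIV F" "strict_mono F" "\<And>t. F (t + 2 * pi) = F t + 2 * pi"
    "\<And>t. f (cis t) = cis (F t)" by blast
  have "cis (F a) = cis b" using F(4)[of a] assms(2) by simp
  then obtain k :: int where k: "F a = b + 2 * pi * of_int k" using cis_eq_iff by blast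
  define H where "H t = F t - 2 * pi * of_int k" for t
  have per: "F (t + 2 * pi * of_nat n) = F t + 2 * pi * of_nat n" for t n
  proof (induction n)
    case (Suc n)
    have "F (t + 2 * pi * real (Suc n)) = F ((t + 2 * pi * real n) + 2 * pi)" by (simp add: algebra_simps)
    then show ?case unfolding F(3) Suc.IH by (simp add: algebra_simps)
  qed simp
  have "surj F"
  proof (rule surjI)
    fix y
    obtain n :: nat where n: "\<bar>y - F 0\<bar> < real n * (2 * pi)" using reals_Archimedean3[of "2 * pi"] by auto
    have "F (2 * pi * real n) = F 0 + 2 * pi * real n" "F (- (2 * pi * real n)) = F 0 - 2 * pi * real n"
      using per[of 0 n] per[of "- (2 * pi * real n)" n] by simp_all
    then have "F (- (2 * pi * real n)) \<le> y" "y \<le> F (2 * pi * real n)" using n by (auto simp: abs_less_iff algebra_simps)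
    moreover have "continuous_on S F" for S using F(1) continuous_on_subset by blast
    moreover have "- (2 * pi * real n) \<le> 2 * pi * real n" by simp
    ultimately have "\<exists>x. F x = y" using IVT'[of F "- (2 * pi * real n)" y "2 * pi * real n"] by blast
    then show "F (SOME x. F x = y) = y" by (rule someI_ex)
  qed
  then have "surj H" unfolding H_def surj_def by (metis add_diff_cancel_right')
  moreover have "strict_mono H" using F(2) by (auto simp: H_def strict_mono_def)
  ultimately have "incr H" by (simp add: incr_def)
  moreover have "f (cis t) = cis (H t)" for t
    unfolding F(4) cis_eq_iff H_def by (intro exI[of _ k]) simp
  moreover have "H a = b" using k by (simp add: H_def)
  moreover have "H (t + 2 * pi) = H t + 2 * pi" for t by (simp add: H_def F(3))
  ultimately show thesis using that[of H] by blast
qed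

text \<open>A circle map fixing \<open>cis b\<close> in the angular coordinate of the circle cut open at \<open>cis b\<close>, extended
  by the identity to an increasing bijection of the line.\<close>

definition act :: "real \<Rightarrow> (complex \<Rightarrow> complex) \<Rightarrow> real \<Rightarrow> real" where
  "act b f t = (if b < t \<and> t < b + 2 * pi then b + Arg2pi (f (cis t) / cis b) else t)"

abbreviation "J b \<equiv> {b<..<b + 2 * pi}"

definition hfix :: "complex set \<Rightarrow> (complex \<Rightarrow> complex) set" where
  "hfix A = {f \<in> homeo_S1. \<forall>a\<in>A. f a = a}"

lemma Arg2pi_cis: "0 \<le> t \<Longrightarrow> t < 2 * pi \<Longrightarrow> Arg2pi (cis t) = t"
  by (rule Arg2pi_unique[of 1]) (auto simp: cis_conv_exp)

text \<open>The lift that fixes b also fixes b + 2 pi and so preserves \<open>J b\<close>, where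
  \<open>Arg2pi\<close> recovers its values without ambiguity.\<close>

lemma hfix_lift:
  assumes "f \<in> hfix {cis b}"
  obtains F where "incr F" "\<And>t. f (cis t) = cis (F t)" "F b = b" "F (b + 2 * pi) = b + 2 * pi"
    "\<And>t. t \<in> J b \<Longrightarrow> act b f t = F t"
proof -
  have f: "f \<in> homeo_S1" "f (cis b) = cis b" using assms by (auto simp: hfix_def)
  obtain F where F: "incr F" "\<And>t. F (t + 2 * pi) = F t + 2 * pi" "\<And>t. f (cis t) = cis (F t)" "F b = b"
    using homeo_lift_at[OF f] by blast
  have "act b f t = F t" if t: "t \<in> J b" for t
  proof -
    have "F b < F t" "F t < F (b + 2 * pi)" using t incr_less[OF F(1)] by auto
    then have "b < F t" "F t < b + 2 * pi" using F by auto
    then show ?thesis using t Arg2pi_cis[of "F t - b"] by (simp add: act_def F(3) cis_divide)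
  qed
  moreover have "F (b + 2 * pi) = b + 2 * pi" using F(2)[of b] F(4) by simp
  ultimately show thesis using that[of F] F(1,3,4) by blast
qed

lemma act_J:
  assumes "f \<in> hfix {cis b}" "t \<in> J b"
  shows "act b f t \<in> J b" "f (cis t) = cis (act b f t)"
proof -
  obtain F where F: "incr F" "\<And>t. f (cis t) = cis (F t)" "F b = b" "F (b + 2 * pi) = b + 2 * pi"
    "\<And>t. t \<in> J b \<Longrightarrow> act b f t = F t" using hfix_lift[OF assms(1)] by blast
  show "act b f t \<in> J b" using incr_less[OF F(1), of b t] incr_less[OF F(1), of t "b + 2 * pi"] assms(2) F by auto
  show "f (cis t) = cis (act b f t)" using F assms(2) by simp
qed

lemma act_out: "t \<notin> J b \<Longrightarrow> act b f t = t"
  by (auto simp: act_def)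

lemma act_eqI: "t \<in> J b \<Longrightarrow> s \<in> J b \<Longrightarrow> f (cis t) = cis s \<Longrightarrow> act b f t = s"
  using Arg2pi_cis[of "s - b"] by (simp add: act_def cis_divide)

lemma hfix_mul: "f \<in> hfix A \<Longrightarrow> g \<in> hfix A \<Longrightarrow> A \<subseteq> S1 \<Longrightarrow> hmul f g \<in> hfix A"
  by (auto simp: hfix_def hmul_in hmul_apply)

lemma hfix_inv: "f \<in> hfix A \<Longrightarrow> A \<subseteq> S1 \<Longrightarrow> hinv f \<in> hfix A"
proof -
  assume f: "f \<in> hfix A" and A: "A \<subseteq> S1"
  then have fh: "f \<in> homeo_S1" by (simp add: hfix_def)
  have "hinv f a = a" if "a \<in> A" for a
  proof -
    have "f a = a" "a \<in> S1" using f A that by (auto simp: hfix_def)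
    then show ?thesis using hinv_left[OF fh, of a] by simp
  qed
  then show ?thesis using fh by (simp add: hfix_def hinv_in)
qed

lemma hfix_id: "A \<subseteq> S1 \<Longrightarrow> hid \<in> hfix A"
  by (auto simp: hfix_def hid_in hid_apply)

lemma cis_sub: "{cis b} \<subseteq> S1" using cis_S1 by blast

lemma act_mul:
  assumes "f \<in> hfix {cis b}" "g \<in> hfix {cis b}"
  shows "act b (hmul f g) t = act b f (act b g t)"
proof (cases "t \<in> J b")
  case True
  then show ?thesis
    using act_J[OF assms(2) True] act_J[OF assms(1), of "act b g t"] 
    by (intro act_eqI) (auto simp: hmul_apply[OF cis_S1])
qed (simp add: act_out)

lemma act_id: "act b hid t = t"
proof (cases "t \<in> J b")
  case True then show ?thesis by (intro act_eqI) (auto simp: hid_apply[OF cis_S1])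
qed (simp add: act_out)

lemma act_inv:
  assumes "f \<in> hfix {cis b}"
  shows "act b (hinv f) (act b f t) = t" "act b f (act b (hinv f) t) = t"
proof -
  have f: "f \<in> homeo_S1" using assms by (simp add: hfix_def)
  have "hmul (hinv f) f = hid" "hmul f (hinv f) = hid"
    by (rule homeo_eqI; simp add: hmul_in hinv_in f hid_in hmul_apply hid_apply hinv_left hinv_right)+
  then show "act b (hinv f) (act b f t) = t" "act b f (act b (hinv f) t) = t"
    using act_mul[OF hfix_inv[OF assms cis_sub] assms, of t] act_mul[OF assms hfix_inv[OF assms cis_sub], of t]
    by (simp_all only: act_id)
qed

lemma act_less:
  assumes "f \<in> hfix {cis b}"
  shows "act b f s < act b f t \<longleftrightarrow> s < t"
proof -
  obtain F where F0: "incr F" "\<And>t. f (cis t) = cis (F t)" "F b = b" "F (b + 2 * pi) = b + 2 * pi"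
    "\<And>t. t \<in> J b \<Longrightarrow> act b f t = F t" using hfix_lift[OF assms] by blast
  note F = F0(1,3,4,5)
  have bd: "b < F u" "F u < b + 2 * pi" if "u \<in> J b" for u
    using incr_less[OF F(1), of b u] incr_less[OF F(1), of u "b + 2 * pi"] that F by auto
  have lt: "act b f s < act b f t" if "s < t" for s t
  proof (cases "s \<in> J b \<and> t \<in> J b")
    case True
    then show ?thesis using incr_less[OF F(1)] F(4) that by simp
  next
    case False
    then show ?thesis
      using bd[of s] bd[of t] F(4)[of s] F(4)[of t] act_out[of s b f] act_out[of t b f] that
      by (cases "s \<in> J b"; cases "t \<in> J b") auto
  qed
  show ?thesis using lt[of s t] lt[of t s] by (cases s t rule: linorder_cases) auto
qed

lemma act_incr:
  assumes "f \<in> hfix {cis b}"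
  shows "incr (act b f)"
proof -
  have "surj (act b f)" by (rule surjI[of _ "act b (hinv f)"]) (rule act_inv(2)[OF assms])
  then show ?thesis unfolding incr_def strict_mono_def using act_less[OF assms] by blast
qed

lemma act_inv_eq: "f \<in> hfix {cis b} \<Longrightarrow> rinv (act b f) = act b (hinv f)"
  by (rule ext) (simp add: incr_inv_eq[OF act_incr] act_inv)

lemma act_fix_iff:
  assumes "f \<in> hfix {cis b}" "t \<in> J b"
  shows "act b f t = t \<longleftrightarrow> f (cis t) = cis t"
  using act_J(2)[OF assms] act_eqI[OF assms(2) assms(2), of f] by metis

section \<open>Topology of the homeomorphism group\<close>

text \<open>An embedding of \<open>Homeo_top\<close> into a normed space, which gives access to topology on types.\<close>

definition E :: "(complex \<Rightarrow> complex) \<Rightarrow> (real \<Rightarrow>\<^sub>C complex)" where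
  "E f = Bcontfun (\<lambda>t. f (cis t))"

lemma E_apply:
  assumes "f \<in> homeo_S1"
  shows "apply_bcontfun (E f) t = f (cis t)"
proof -
  have "continuous_on UNIV (\<lambda>t. f (cis t))"
    by (rule continuous_on_compose2[OF homeo_continuous[OF assms]])
       (auto intro!: continuous_intros cis_S1)
  moreover have "range (\<lambda>t. f (cis t)) \<subseteq> cball 0 1"
    using homeo_range[OF assms cis_S1] by (auto simp: mem_sphere)
  then have "bounded (range (\<lambda>t. f (cis t)))" by (rule bounded_subset[OF bounded_cball])
  ultimately have "(\<lambda>t. f (cis t)) \<in> bcontfun" by (simp add: bcontfun_def)
  then show ?thesis by (simp add: E_def Bcontfun_inverse)
qed

lemma E_dist_le:
  assumes "f \<in> homeo_S1" "g \<in> homeo_S1" "\<And>z. z \<in> S1 \<Longrightarrow> dist (f z) (g z) \<le> e"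
  shows "dist (E f) (E g) \<le> e"
  by (rule dist_bound) (simp add: E_apply assms cis_S1)

lemma dist_le_E:
  assumes "f \<in> homeo_S1" "g \<in> homeo_S1" "z \<in> S1"
  shows "dist (f z) (g z) \<le> dist (E f) (E g)"
proof -
  obtain t where "z = cis t" using assms(3) S1_eq_cis by blast
  then show ?thesis using dist_bounded[of "E f" t "E g"] by (simp add: E_apply assms)
qed

lemma E_inj: "f \<in> homeo_S1 \<Longrightarrow> g \<in> homeo_S1 \<Longrightarrow> E f = E g \<longleftrightarrow> f = g"
  using dist_le_E[of f g] by (auto intro!: homeo_eqI)

definition "Einv = inv_into homeo_S1 E"

lemma Einv_E: "f \<in> homeo_S1 \<Longrightarrow> Einv (E f) = f"
  unfolding Einv_def by (rule inv_into_f_f) (auto simp: inj_on_def E_inj)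

lemma dist_S1_le: "x \<in> S1 \<Longrightarrow> y \<in> S1 \<Longrightarrow> dist x y \<le> 2"
  using norm_triangle_ineq4[of x y] by (simp add: dist_norm mem_sphere)

lemma homeo_dist_ge:
  assumes "f \<in> homeo_S1" "g \<in> homeo_S1" "z \<in> S1"
  shows "dist (f z) (g z) \<le> homeo_dist f g" "dist (hinv f z) (hinv g z) \<le> homeo_dist f g"
proof -
  let ?D = "\<lambda>x. max (dist (f x) (g x)) (dist (inv_into S1 f x) (inv_into S1 g x))"
  have "?D x \<le> 2" if "x \<in> S1" for x
    using that assms dist_S1_le homeo_S1_in_S1 by (metis max.boundedI)
  then have bdd: "bdd_above (?D ` S1)" by (rule bdd_aboveI2)
  have "?D z \<le> (SUP x\<in>S1. ?D x)" by (rule cSUP_upper[OF assms(3) bdd])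
  then have "?D z \<le> homeo_dist f g" using assms by (simp add: homeo_dist_def)
  then show "dist (f z) (g z) \<le> homeo_dist f g" "dist (hinv f z) (hinv g z) \<le> homeo_dist f g"
    using assms(3) by (auto simp: hinv_def)
qed

lemma homeo_dist_leI:
  assumes "f \<in> homeo_S1" "g \<in> homeo_S1" "\<And>z. z \<in> S1 \<Longrightarrow> dist (f z) (g z) \<le> e"
    "\<And>z. z \<in> S1 \<Longrightarrow> dist (hinv f z) (hinv g z) \<le> e"
  shows "homeo_dist f g \<le> e"
proof -
  have "S1 \<noteq> {}" using cis_S1 by blast
  then have "(SUP x\<in>S1. max (dist (f x) (g x)) (dist (inv_into S1 f x) (inv_into S1 g x))) \<le> e"
    by (rule cSUP_least) (use assms in \<open>auto simp: hinv_def\<close>)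
  then show ?thesis using assms by (simp add: homeo_dist_def)
qed

lemma homeo_uniform:
  assumes "f \<in> homeo_S1" "e > 0"
  obtains d where "d > 0" "\<And>x y. x \<in> S1 \<Longrightarrow> y \<in> S1 \<Longrightarrow> dist x y < d \<Longrightarrow> dist (f x) (f y) < e"
  using compact_uniformly_continuous[OF homeo_continuous[OF assms(1)] compact_sphere] assms(2)
  unfolding uniformly_continuous_on_def by metis

text \<open>Uniform closeness to a fixed homeomorphism already controls the inverses.\<close>

lemma homeo_dist_uniform:
  assumes f: "f \<in> homeo_S1" and e: "e > 0"
  obtains d where "d > 0" "\<And>g. g \<in> homeo_S1 \<Longrightarrow> (\<And>z. z \<in> S1 \<Longrightarrow> dist (f z) (g z) < d) \<Longrightarrow> homeo_dist f g < e"
proof -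
  obtain d where d: "d > 0" "\<And>x y. x \<in> S1 \<Longrightarrow> y \<in> S1 \<Longrightarrow> dist x y < d \<Longrightarrow> dist (hinv f x) (hinv f y) < e/2"
    using homeo_uniform[OF hinv_in[OF f], of "e/2"] e by auto
  show thesis
  proof (rule that[of "min d (e/2)"])
    fix g assume g: "g \<in> homeo_S1" and fg: "\<And>z. z \<in> S1 \<Longrightarrow> dist (f z) (g z) < min d (e/2)"
    have "dist (hinv f z) (hinv g z) \<le> e/2" if z: "z \<in> S1" for z
    proof -
      define v where "v = hinv g z"
      have v: "v \<in> S1" "g v = z"
        using homeo_range[OF hinv_in[OF g] z] hinv_right[OF g z] by (simp_all add: v_def)
      have "dist (f v) (g v) < d" using fg[OF v(1)] by simp
      then have "dist (hinv f (f v)) (hinv f (g v)) < e/2"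
        by (rule d(2)[OF homeo_range[OF f v(1)] homeo_range[OF g v(1)]])
      then have "dist v (hinv f z) < e/2" unfolding hinv_left[OF f v(1)] v(2) .
      then show ?thesis by (simp add: dist_commute v_def)
    qed
    moreover have "dist (f z) (g z) \<le> e/2" if "z \<in> S1" for z using fg[OF that] by simp
    ultimately have "homeo_dist f g \<le> e/2" by (intro homeo_dist_leI[OF f g]) auto
    then show "homeo_dist f g < e" using e by simp
  qed (use d e in auto)
qed

text \<open>The quotient f^-1 g. Inverses and products are instances of it, so one proof of
  continuity serves both.\<close>

definition "hq f g = hmul (hinv f) g"

lemma hq_in: "f \<in> homeo_S1 \<Longrightarrow> g \<in> homeo_S1 \<Longrightarrow> hq f g \<in> homeo_S1"
  by (simp add: hq_def hmul_in hinv_in)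

lemma hq_apply: "z \<in> S1 \<Longrightarrow> hq f g z = hinv f (g z)"
  by (simp add: hq_def hmul_apply)

lemma hq_eqs:
  assumes "f \<in> homeo_S1" "g \<in> homeo_S1"
  shows "hq f f = hid" "hq f hid = hinv f" "hq (hinv f) g = hmul f g"
proof -
  note h = hq_in hid_in hinv_in hmul_in assms
  show "hq f f = hid"
    by (rule homeo_eqI) (simp_all add: h hq_apply hid_apply hinv_left)
  show "hq f hid = hinv f"
    by (rule homeo_eqI) (simp_all add: h hq_apply hid_apply)
  show "hq (hinv f) g = hmul f g"
  proof (rule homeo_eqI)
    fix z assume z: "z \<in> S1"
    have gz: "g z \<in> S1" by (rule homeo_range[OF assms(2) z])
    have "hinv (hinv f) (g z) = hinv (hinv f) (hinv f (f (g z)))" by (simp add: hinv_left[OF assms(1) gz])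
    also have "\<dots> = f (g z)" by (rule hinv_left[OF hinv_in[OF assms(1)] homeo_range[OF assms(1) gz]])
    finally show "hq (hinv f) g z = hmul f g z" unfolding hq_apply[OF z] hmul_apply[OF z] .
  qed (simp_all add: h)
qed

text \<open>\<open>E\<close> records forward values only. That f^-1 is close to f0^-1 comes from
  \<open>homeo_dist_uniform\<close>; replacing g by g0 underneath f0^-1 uses the uniform continuity
  of f0^-1.\<close>

lemma continuous_on_hq:
  "continuous_on (E ` homeo_S1 \<times> E ` homeo_S1) (\<lambda>z. E (hq (Einv (fst z)) (Einv (snd z))))"
  unfolding continuous_on_iff
proof (intro ballI allI impI)
  fix z and e :: real assume z: "z \<in> E ` homeo_S1 \<times> E ` homeo_S1" and e: "e > 0"
  obtain f0 g0 where z0: "z = (E f0, E g0)" "f0 \<in> homeo_S1" "g0 \<in> homeo_S1" using z by auto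
  obtain d1 where d1: "d1 > 0" "\<And>x y. x \<in> S1 \<Longrightarrow> y \<in> S1 \<Longrightarrow> dist x y < d1 \<Longrightarrow> dist (hinv f0 x) (hinv f0 y) < e/4"
    using homeo_uniform[OF hinv_in[OF z0(2)], of "e/4"] e by auto
  obtain d2 where d2: "d2 > 0" "\<And>g. g \<in> homeo_S1 \<Longrightarrow> (\<And>z. z \<in> S1 \<Longrightarrow> dist (f0 z) (g z) < d2) \<Longrightarrow> homeo_dist f0 g < e/4"
    using homeo_dist_uniform[OF z0(2), of "e/4"] e by auto
  have "dist (E (hq f g)) (E (hq f0 g0)) < e"
    if f: "f \<in> homeo_S1" and g: "g \<in> homeo_S1" and d: "dist (E f) (E f0) < min d1 d2" "dist (E g) (E g0) < min d1 d2" for f g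
  proof -
    have "dist (f0 z) (f z) < d2" if "z \<in> S1" for z
      using dist_le_E[OF f z0(2) that] d by (simp add: dist_commute)
    then have hd: "homeo_dist f0 f < e/4" using d2(2)[OF f] by blast
    have "dist (hq f g z) (hq f0 g0 z) \<le> e/2" if z: "z \<in> S1" for z
    proof -
      have gz: "g z \<in> S1" "g0 z \<in> S1" using homeo_range g z0(3) z by blast+
      have 1: "dist (hinv f0 (g z)) (hinv f (g z)) < e/4"
        using homeo_dist_ge(2)[OF z0(2) f gz(1)] hd by linarith
      have "dist (g z) (g0 z) < d1" using dist_le_E[OF g z0(3) z] d by linarith
      then have 2: "dist (hinv f0 (g z)) (hinv f0 (g0 z)) < e/4" by (rule d1(2)[OF gz])
      show ?thesis using 1 2 dist_triangle[of "hinv f (g z)" "hinv f0 (g0 z)" "hinv f0 (g z)"]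
        by (simp add: hq_apply[OF z] dist_commute)
    qed
    then have "dist (E (hq f g)) (E (hq f0 g0)) \<le> e/2" by (intro E_dist_le hq_in f g z0)
    then show ?thesis using e by simp
  qed
  note * = this
  have "dist (E (hq (Einv (fst y)) (Einv (snd y)))) (E (hq (Einv (fst z)) (Einv (snd z)))) < e"
    if y: "y \<in> E ` homeo_S1 \<times> E ` homeo_S1" "dist y z < min d1 d2" for y
  proof -
    obtain f g where fg: "y = (E f, E g)" "f \<in> homeo_S1" "g \<in> homeo_S1" using y by auto
    have "dist (E f) (E f0) \<le> dist y z" "dist (E g) (E g0) \<le> dist y z"
      using dist_fst_le[of y z] dist_snd_le[of y z] by (simp_all add: fg z0)
    then show ?thesis using *[OF fg(2,3)] y(2) by (simp add: fg z0 Einv_E)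
  qed
  then show "\<exists>d>0. \<forall>y\<in>E ` homeo_S1 \<times> E ` homeo_S1. dist y z < d \<longrightarrow>
    dist (E (hq (Einv (fst y)) (Einv (snd y)))) (E (hq (Einv (fst z)) (Einv (snd z)))) < e"
    using d1(1) d2(1) by (intro exI[of _ "min d1 d2"]) auto
qed

definition continuum :: "(complex \<Rightarrow> complex) set \<Rightarrow> bool" where
  "continuum C \<longleftrightarrow> C \<subseteq> homeo_S1 \<and> compact (E ` C) \<and> connected (E ` C)"

lemma continuum_hq_image:
  assumes D: "D \<subseteq> E ` homeo_S1 \<times> E ` homeo_S1" "compact D" "connected D"
  shows "continuum ((\<lambda>z. hq (Einv (fst z)) (Einv (snd z))) ` D)"
proof -
  have c: "continuous_on D (\<lambda>z. E (hq (Einv (fst z)) (Einv (snd z))))"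
    using continuous_on_hq D(1) by (rule continuous_on_subset)
  have "hq (Einv (fst z)) (Einv (snd z)) \<in> homeo_S1" if "z \<in> D" for z
    using D(1) that by (auto simp: Einv_E hq_in)
  then show ?thesis
    using compact_continuous_image[OF c D(2)] connected_continuous_image[OF c D(3)]
    unfolding continuum_def image_image by auto
qed

lemma continuum_hq:
  assumes "continuum C1" "continuum C2"
  shows "continuum ((\<lambda>(f, g). hq f g) ` (C1 \<times> C2))"
proof -
  have "C1 \<subseteq> homeo_S1" "C2 \<subseteq> homeo_S1" using assms by (auto simp: continuum_def)
  then have "(\<lambda>z. hq (Einv (fst z)) (Einv (snd z))) ` (E ` C1 \<times> E ` C2) = (\<lambda>(f, g). hq f g) ` (C1 \<times> C2)"
    by (force simp: Einv_E subset_iff)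
  moreover have "continuum ((\<lambda>z. hq (Einv (fst z)) (Einv (snd z))) ` (E ` C1 \<times> E ` C2))"
    by (rule continuum_hq_image) (use assms in \<open>auto simp: continuum_def compact_Times connected_Times\<close>)
  ultimately show ?thesis by simp
qed

lemma continuum_single: "f \<in> homeo_S1 \<Longrightarrow> continuum {f}"
  by (simp add: continuum_def)

lemma continuum_Un: "continuum C \<Longrightarrow> continuum D \<Longrightarrow> f \<in> C \<Longrightarrow> f \<in> D \<Longrightarrow> continuum (C \<union> D)"
  unfolding continuum_def image_Un by (auto intro!: compact_Un connected_Un)

lemma continuum_inv:
  assumes "continuum C"
  shows "continuum (hinv ` C)"
proof -
  have C: "C \<subseteq> homeo_S1" using assms by (simp add: continuum_def)
  have "(\<lambda>(f, g). hq f g) ` (C \<times> {hid}) = hinv ` C"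
    using C hq_eqs(2)[OF _ hid_in] by force
  then show ?thesis using continuum_hq[OF assms continuum_single[OF hid_in]] by simp
qed

lemma continuum_mul:
  assumes "continuum C" "continuum D"
  shows "continuum ((\<lambda>(f, g). hmul f g) ` (C \<times> D))"
proof -
  have C: "C \<subseteq> homeo_S1" "D \<subseteq> homeo_S1" using assms by (auto simp: continuum_def)
  have "(\<lambda>(f, g). hq f g) ` (hinv ` C \<times> D) = (\<lambda>(f, g). hq (hinv f) g) ` (C \<times> D)" by force
  also have "\<dots> = (\<lambda>(f, g). hmul f g) ` (C \<times> D)"
    using C hq_eqs(3) by (intro image_cong) auto
  finally show ?thesis using continuum_hq[OF continuum_inv[OF assms(1)] assms(2)] by simp
qed

section \<open>Continuum components of stabilizers\<close>

locale circle_group =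
  fixes G :: "(complex \<Rightarrow> complex) set"
  assumes G_homeo: "f \<in> G \<Longrightarrow> f \<in> homeo_S1"
    and G_id: "hid \<in> G"
    and G_mul: "f \<in> G \<Longrightarrow> g \<in> G \<Longrightarrow> hmul f g \<in> G"
    and G_inv: "f \<in> G \<Longrightarrow> hinv f \<in> G"
begin

definition K :: "complex set \<Rightarrow> (complex \<Rightarrow> complex) set" where
  "K A = {g. \<exists>C. C \<subseteq> G \<inter> hfix A \<and> hid \<in> C \<and> g \<in> C \<and> continuum C}"

definition Fx :: "complex set \<Rightarrow> complex set" where
  "Fx A = {z \<in> S1. \<forall>k\<in>K A. k z = z}"

lemma K_G: "g \<in> K A \<Longrightarrow> g \<in> G" and K_hfix: "g \<in> K A \<Longrightarrow> g \<in> hfix A"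
  by (auto simp: K_def)

lemma K_homeo: "g \<in> K A \<Longrightarrow> g \<in> homeo_S1"
  using K_G G_homeo by blast

lemma K_id: "A \<subseteq> S1 \<Longrightarrow> hid \<in> K A"
  unfolding K_def using continuum_single[OF hid_in] G_id hfix_id by blast

lemma hmul_id: "f \<in> homeo_S1 \<Longrightarrow> hmul hid f = f" "f \<in> homeo_S1 \<Longrightarrow> hmul f hid = f"
  by (auto intro!: homeo_eqI simp: hmul_in hid_in hmul_apply hid_apply homeo_range)

lemma K_mul:
  assumes A: "A \<subseteq> S1" and "f \<in> K A" "g \<in> K A"
  shows "hmul f g \<in> K A"
proof -
  obtain C where C: "C \<subseteq> G \<inter> hfix A" "hid \<in> C" "f \<in> C" "continuum C" using assms(2) by (auto simp: K_def)
  obtain D where D: "D \<subseteq> G \<inter> hfix A" "hid \<in> D" "g \<in> D" "continuum D" using assms(3) by (auto simp: K_def)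
  let ?P = "(\<lambda>(f, g). hmul f g) ` (C \<times> D)"
  have "?P \<subseteq> G \<inter> hfix A" using C(1) D(1) A by (auto intro!: G_mul hfix_mul)
  moreover have "hid = hmul hid hid" by (simp add: hmul_id hid_in)
  then have "hid \<in> ?P" using C(2) D(2) by force
  moreover have "hmul f g \<in> ?P" using C(3) D(3) by force
  ultimately show ?thesis using continuum_mul[OF C(4) D(4)] unfolding K_def by blast
qed

lemma K_inv:
  assumes A: "A \<subseteq> S1" and "f \<in> K A"
  shows "hinv f \<in> K A"
proof -
  obtain C where C: "C \<subseteq> G \<inter> hfix A" "hid \<in> C" "f \<in> C" "continuum C" using assms(2) by (auto simp: K_def)
  have "hinv hid = hid" using hq_eqs(1,2)[OF hid_in hid_in] by simp
  then have "hid \<in> hinv ` C" using C(2) by force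
  moreover have "hinv ` C \<subseteq> G \<inter> hfix A" using C(1) A by (auto intro!: G_inv hfix_inv)
  ultimately show ?thesis using continuum_inv[OF C(4)] C(3) unfolding K_def by blast
qed

lemma K_mono: "B \<subseteq> A \<Longrightarrow> K A \<subseteq> K B"
proof
  fix g assume "B \<subseteq> A" "g \<in> K A"
  then obtain C where "C \<subseteq> G \<inter> hfix A" "hid \<in> C" "g \<in> C" "continuum C" by (auto simp: K_def)
  moreover have "hfix A \<subseteq> hfix B" using \<open>B \<subseteq> A\<close> by (auto simp: hfix_def)
  ultimately show "g \<in> K B" unfolding K_def by blast
qed

text \<open>A continuum that witnesses membership in \<open>K A\<close> lies in \<open>K A\<close>
  as a whole, so all its elements fix p.\<close>

lemma K_absorb:
  assumes "p \<in> Fx A"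
  shows "K A \<subseteq> K (insert p A)"
proof
  fix g assume "g \<in> K A"
  then obtain C where C: "C \<subseteq> G \<inter> hfix A" "hid \<in> C" "g \<in> C" "continuum C" by (auto simp: K_def)
  then have "C \<subseteq> K A" unfolding K_def by blast
  then have "C \<subseteq> G \<inter> hfix (insert p A)" using C(1) assms by (auto simp: Fx_def hfix_def)
  then show "g \<in> K (insert p A)" using C unfolding K_def by blast
qed

lemma Fx_sub: "A \<subseteq> S1 \<Longrightarrow> A \<subseteq> Fx A"
  using K_hfix by (auto simp: Fx_def hfix_def)

lemma Fx_S1: "Fx A \<subseteq> S1"
  by (auto simp: Fx_def)

lemma Fx_mono: "B \<subseteq> A \<Longrightarrow> Fx B \<subseteq> Fx A"
  using K_mono[of B A] unfolding Fx_def by blast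

lemma Fx_absorb: "p \<in> Fx A \<Longrightarrow> Fx (insert p A) \<subseteq> Fx A"
  using K_absorb[of p A] unfolding Fx_def by blast

text \<open>Conjugation by g is continuous and fixes the identity, so it carries the witnessing
  continua along.\<close>

lemma K_conj:
  assumes A: "A \<subseteq> S1" and g: "g \<in> G" and f: "f \<in> K A"
  shows "hmul (hmul g f) (hinv g) \<in> K (g ` A)"
proof -
  obtain C where C: "C \<subseteq> G \<inter> hfix A" "hid \<in> C" "f \<in> C" "continuum C" using f by (auto simp: K_def)
  let ?c = "\<lambda>f. hmul (hmul g f) (hinv g)"
  have gh: "g \<in> homeo_S1" using g G_homeo by blast
  have fx: "?c f \<in> hfix (g ` A)" if "f \<in> G" "f \<in> hfix A" for f
  proof -
    have fh: "f \<in> homeo_S1" using that G_homeo by blast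
    have "?c f (g a) = g a" if a: "a \<in> A" for a
    proof -
      have aS: "a \<in> S1" "f a = a" using a A \<open>f \<in> hfix A\<close> by (auto simp: hfix_def)
      then show ?thesis by (simp add: hmul_apply homeo_range[OF gh] hinv_left[OF gh])
    qed
    then show ?thesis using gh fh by (auto simp: hfix_def hmul_in hinv_in)
  qed
  have "continuum ((\<lambda>(f, g). hmul f g) ` ((\<lambda>(f, g). hmul f g) ` ({g} \<times> C) \<times> {hinv g}))"
    by (intro continuum_mul continuum_single gh hinv_in C)
  moreover have "(\<lambda>(f, g). hmul f g) ` ((\<lambda>(f, g). hmul f g) ` ({g} \<times> C) \<times> {hinv g}) = ?c ` C" by force
  ultimately have "continuum (?c ` C)" by simp
  moreover have "?c f \<in> G \<inter> hfix (g ` A)" if "f \<in> C" for f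
    using that C(1) fx[of f] by (intro IntI G_mul G_inv g) auto
  then have "?c ` C \<subseteq> G \<inter> hfix (g ` A)" by (rule image_subsetI)
  moreover have "hid = ?c hid"
    by (rule homeo_eqI) (simp_all add: hid_in hmul_in gh hinv_in hmul_apply hid_apply homeo_range[OF hinv_in[OF gh]] hinv_right[OF gh])
  then have "hid \<in> ?c ` C" using C(2) by (rule image_eqI)
  moreover have "?c f \<in> ?c ` C" using C(3) by (rule imageI)
  ultimately show ?thesis unfolding K_def mem_Collect_eq by (intro exI[of _ "?c ` C"] conjI)
qed

lemma hinv_image: "g \<in> homeo_S1 \<Longrightarrow> A \<subseteq> S1 \<Longrightarrow> hinv g ` (g ` A) = A"
proof -
  assume g: "g \<in> homeo_S1" and A: "A \<subseteq> S1"
  have "hinv g (g a) = a" if "a \<in> A" for a using hinv_left[OF g] A that by blast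
  then show ?thesis unfolding image_image by simp
qed

lemma image_S1: "g \<in> homeo_S1 \<Longrightarrow> A \<subseteq> S1 \<Longrightarrow> g ` A \<subseteq> S1"
  using homeo_range by blast

lemma Fx_image:
  assumes A: "A \<subseteq> S1" and g: "g \<in> G" and z: "z \<in> Fx A"
  shows "g z \<in> Fx (g ` A)"
proof -
  have gh: "g \<in> homeo_S1" using g G_homeo by blast
  have zS: "z \<in> S1" using z Fx_S1 by blast
  have gz: "g z \<in> S1" using homeo_range[OF gh zS] .
  have "k (g z) = g z" if k: "k \<in> K (g ` A)" for k
  proof -
    have kh: "k \<in> homeo_S1" using K_homeo[OF k] .
    have "hmul (hmul (hinv g) k) (hinv (hinv g)) \<in> K (hinv g ` (g ` A))"
      by (rule K_conj[OF image_S1[OF gh A] G_inv[OF g] k])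
    then have "hmul (hmul (hinv g) k) (hinv (hinv g)) z = z"
      using z unfolding hinv_image[OF gh A] Fx_def by blast
    moreover have "hinv (hinv g) z = g z"
      using hinv_left[OF hinv_in[OF gh] gz] hinv_left[OF gh zS] by simp
    ultimately have "hinv g (k (g z)) = z" by (simp add: hmul_apply zS gz homeo_range kh)
    then show ?thesis using hinv_right[OF gh homeo_range[OF kh gz]] by simp
  qed
  then show ?thesis using gz by (simp add: Fx_def)
qed

lemma Fx_image_iff:
  assumes A: "A \<subseteq> S1" and g: "g \<in> G" and z: "z \<in> S1"
  shows "g z \<in> Fx (g ` A) \<longleftrightarrow> z \<in> Fx A"
proof
  have gh: "g \<in> homeo_S1" using g G_homeo by blast
  assume "g z \<in> Fx (g ` A)"
  from Fx_image[OF image_S1[OF gh A] G_inv[OF g] this] show "z \<in> Fx A"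
    by (simp add: hinv_image[OF gh A] hinv_left[OF gh z])
qed (rule Fx_image[OF A g])

text \<open>The coordinate action at a fixed t as a function of the embedded map, so that its
  continuity can be stated in a normed space.\<close>

definition ev :: "real \<Rightarrow> real \<Rightarrow> (real \<Rightarrow>\<^sub>C complex) \<Rightarrow> real" where
  "ev b t \<phi> = b + Arg2pi (apply_bcontfun \<phi> t / cis b)"

lemma ev_act: "f \<in> homeo_S1 \<Longrightarrow> t \<in> J b \<Longrightarrow> ev b t (E f) = act b f t"
  by (simp add: ev_def E_apply act_def)

text \<open>\<open>Arg2pi\<close> jumps only at the nonnegative reals. Maps that fix
  \<open>cis b\<close> keep \<open>J b\<close> inside \<open>J b\<close>, so the quotient by
  \<open>cis b\<close> stays off that ray.\<close>

lemma continuous_on_ev: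
  assumes t: "t \<in> J b"
  shows "continuous_on (E ` hfix {cis b}) (ev b t)"
proof -
  have c: "continuous_on S (\<lambda>\<phi>. apply_bcontfun \<phi> t)" for S :: "(real \<Rightarrow>\<^sub>C complex) set"
  proof (rule continuous_onI)
    fix x :: "real \<Rightarrow>\<^sub>C complex" and e :: real assume e: "e > 0"
    have "dist (apply_bcontfun x' t) (apply_bcontfun x t) \<le> e" if "dist x' x < e" for x'
      using dist_bounded[of x' t x] that by simp
    then show "\<exists>d>0. \<forall>x'\<in>S. dist x' x < d \<longrightarrow> dist (apply_bcontfun x' t) (apply_bcontfun x t) \<le> e"
      using e by blast
  qed
  have "continuous_on (E ` hfix {cis b}) (\<lambda>\<phi>. Arg2pi (apply_bcontfun \<phi> t / cis b))"
  proof (rule continuous_on_compose2[of "- \<real>\<^sub>\<ge>\<^sub>0" Arg2pi])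
    show "continuous_on (- \<real>\<^sub>\<ge>\<^sub>0) Arg2pi"
      by (intro continuous_at_imp_continuous_on ballI continuous_at_Arg2pi) auto
    show "continuous_on (E ` hfix {cis b}) (\<lambda>\<phi>. apply_bcontfun \<phi> t / cis b)"
      by (intro continuous_intros c) simp
    show "(\<lambda>\<phi>. apply_bcontfun \<phi> t / cis b) ` (E ` hfix {cis b}) \<subseteq> - \<real>\<^sub>\<ge>\<^sub>0"
    proof clarify
      fix f assume f: "f \<in> hfix {cis b}" and r: "apply_bcontfun (E f) t / cis b \<in> \<real>\<^sub>\<ge>\<^sub>0"
      have "apply_bcontfun (E f) t / cis b = cis (act b f t - b)"
        using f act_J(2)[OF f t] by (simp add: E_apply hfix_def cis_divide)
      with r have "cis (act b f t - b) \<in> \<real>\<^sub>\<ge>\<^sub>0" by simp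
      then obtain r where "cis (act b f t - b) = of_real r" "r \<ge> 0" by (auto simp: nonneg_Reals_def)
      moreover then have "r = 1" by (metis norm_cis norm_of_real abs_of_nonneg)
      ultimately have "cis (act b f t - b) = cis 0" by simp
      then have "act b f t - b = 0" using act_J(1)[OF f t] by (intro cis_inj_interval) auto
      then show False using act_J(1)[OF f t] by simp
    qed
  qed
  then show ?thesis unfolding ev_def by (intro continuous_intros)
qed

lemma hfix_single: "f \<in> hfix A \<Longrightarrow> cis b \<in> A \<Longrightarrow> f \<in> hfix {cis b}"
  by (auto simp: hfix_def)

text \<open>Evaluation at t turns a continuum that joins the identity to k into a connected set of
  reals containing both t and its image under k.\<close>

lemma K_orbit_convex:
  assumes A: "A \<subseteq> S1" "cis b \<in> A" and t: "t \<in> J b" and k: "k \<in> K A" and s: "t \<le> s" "s \<le> act b k t"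
  shows "\<exists>l\<in>K A. act b l t = s"
proof -
  obtain C where C: "C \<subseteq> G \<inter> hfix A" "hid \<in> C" "k \<in> C" "continuum C" using k by (auto simp: K_def)
  have CK: "C \<subseteq> K A" using C unfolding K_def by blast
  have Ch: "C \<subseteq> hfix {cis b}" "C \<subseteq> homeo_S1" using C(1) hfix_single A(2) G_homeo by blast+
  have "connected (ev b t ` (E ` C))"
    by (rule connected_continuous_image[OF continuous_on_subset[OF continuous_on_ev[OF t]]])
       (use Ch C(4) in \<open>auto simp: continuum_def\<close>)
  moreover have im: "ev b t ` (E ` C) = (\<lambda>f. act b f t) ` C"
    unfolding image_image using Ch ev_act[OF _ t] by (intro image_cong) auto
  moreover have "t \<in> (\<lambda>f. act b f t) ` C" using C(2) act_id[of b t] by force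
  ultimately have "s \<in> (\<lambda>f. act b f t) ` C"
    using connected_contains_Icc[of "ev b t ` (E ` C)" t "act b k t"] C(3) s by auto
  then show ?thesis using CK by auto
qed

lemma Fx_closed: "closed {s. cis s \<in> Fx A}"
proof -
  have "{s. cis s \<in> Fx A} = (\<Inter>k\<in>K A. {s. k (cis s) = cis s})"
    using cis_S1 by (auto simp: Fx_def)
  moreover have "closed {s. k (cis s) = cis s}" if "k \<in> K A" for k
  proof (rule closed_Collect_eq)
    show "continuous_on UNIV (\<lambda>s. k (cis s))"
      by (rule continuous_on_compose2[OF homeo_continuous[OF K_homeo[OF that]]])
         (auto intro!: continuous_intros cis_S1)
  qed (auto intro!: continuous_intros)
  ultimately show ?thesis by auto
qed

text \<open>The supremum of an orbit is a common fixed point.\<close>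

lemma K_move:
  assumes A: "A \<subseteq> S1" "cis b \<in> A" and t: "t \<in> J b" and t': "t' \<in> J b" and "t \<le> t'"
    and nf: "\<And>s. t \<le> s \<Longrightarrow> s \<le> t' \<Longrightarrow> cis s \<notin> Fx A"
  shows "\<exists>k\<in>K A. act b k t = t'"
proof -
  have hf: "k \<in> hfix {cis b}" if "k \<in> K A" for k using K_hfix[OF that] hfix_single A(2) by blast
  have "\<exists>k\<in>K A. t' \<le> act b k t"
  proof (rule ccontr)
    assume "\<not> ?thesis"
    then have le: "act b k t \<le> t'" if "k \<in> K A" for k using that by force
    define s where "s = (SUP k\<in>K A. act b k t)"
    have bdd: "bdd_above ((\<lambda>k. act b k t) ` K A)" using le by (intro bdd_aboveI2[of _ _ t']) auto
    have up: "act b k t \<le> s" if "k \<in> K A" for k unfolding s_def by (rule cSUP_upper[OF that bdd])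
    have "t \<le> s" using up[OF K_id[OF A(1)]] by (simp add: act_id)
    moreover have ne: "K A \<noteq> {}" using K_id[OF A(1)] by blast
    have st': "s \<le> t'" unfolding s_def by (rule cSUP_least[OF ne]) (rule le)
    moreover have sJ: "s \<in> J b" using calculation t t' by auto
    \<comment> \<open>Otherwise some orbit point lies above k s, and k^-1 would carry it beyond the
      supremum s.\<close>
    have ge: "s \<le> act b k s" if k: "k \<in> K A" for k
    proof (rule ccontr)
      assume "\<not> s \<le> act b k s"
      then obtain l where l: "l \<in> K A" "act b k s < act b l t"
        unfolding s_def using less_cSUP_iff[OF ne bdd] by (auto simp: not_le)
      have "act b k (act b (hmul (hinv k) l) t) = act b l t"
        using act_mul[OF hfix_inv[OF hf[OF k] cis_sub] hf[OF l(1)], of t] act_inv(2)[OF hf[OF k]] by simp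
      moreover have "act b (hmul (hinv k) l) t \<le> s" by (rule up[OF K_mul[OF A(1) K_inv[OF A(1) k] l(1)]])
      ultimately have "act b l t \<le> act b k s" using incr_le[OF act_incr[OF hf[OF k]]] by metis
      then show False using l(2) by simp
    qed
    have "k (cis s) = cis s" if k: "k \<in> K A" for k
    proof -
      have "s \<le> act b (hinv k) s" by (rule ge[OF K_inv[OF A(1) k]])
      then have "act b k s \<le> s" using incr_le[OF act_incr[OF hf[OF k]], of s "act b (hinv k) s"]
        act_inv(2)[OF hf[OF k], of s] by simp
      then have "act b k s = s" using ge[OF k] by simp
      then show ?thesis using act_fix_iff[OF hf[OF k] sJ] by simp
    qed
    then have "cis s \<in> Fx A" using cis_S1 by (simp add: Fx_def)
    ultimately show False using nf by blast
  qed
  then obtain k where "k \<in> K A" "t' \<le> act b k t" by blast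
  then show ?thesis using K_orbit_convex[OF A t _ \<open>t \<le> t'\<close>] by blast
qed

lemma K_move_back:
  assumes A: "A \<subseteq> S1" "cis b \<in> A" and t: "t \<in> J b" and t': "t' \<in> J b"
    and nf: "\<And>s. min t t' \<le> s \<Longrightarrow> s \<le> max t t' \<Longrightarrow> cis s \<notin> Fx A"
  shows "\<exists>k\<in>K A. act b k t = t'"
proof (cases "t \<le> t'")
  case True
  then show ?thesis using K_move[OF A t t'] nf by auto
next
  case False
  then obtain k where k: "k \<in> K A" "act b k t' = t" using K_move[OF A t' t] nf by auto
  then have "act b (hinv k) t = t'" using act_inv(1)[OF hfix_single[OF K_hfix A(2)]] by blast
  then show ?thesis using K_inv[OF A(1) k(1)] by blast
qed

text \<open>Point stabilizers in \<open>K B\<close> are again continuum-connected. A continuum joining the identity to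
  \<open>d\<close> and its translate by \<open>d\<close> reach the same heights at \<open>cis \<tau>\<close>, and climbing both of them
  simultaneously produces a continuum of quotients fixing \<open>cis \<tau>\<close>.\<close>

lemma K_stabilizer:
  assumes B: "B \<subseteq> S1" "cis b \<in> B" and d: "d \<in> K B" and \<tau>: "\<tau> \<in> J b" and dfix: "d (cis \<tau>) = cis \<tau>"
  shows "d \<in> K (insert (cis \<tau>) B)"
proof -
  obtain C where C: "C \<subseteq> G \<inter> hfix B" "hid \<in> C" "d \<in> C" "continuum C" using d by (auto simp: K_def)
  have Ch: "C \<subseteq> hfix {cis b}" "C \<subseteq> homeo_S1" using C(1) hfix_single B(2) G_homeo by blast+
  have dh: "d \<in> homeo_S1" "d \<in> hfix {cis b}" using C(3) Ch by blast+
  \<comment> \<open>The translate C d meets C in d. As d fixes \<open>cis \<tau>\<close>,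
    translating by d does not change the heights there, so C and \<open>C2\<close> have the same
    range.\<close>
  define C2 where "C2 = C \<union> (\<lambda>(f, g). hmul f g) ` (C \<times> {d})"
  have "d \<in> (\<lambda>(f, g). hmul f g) ` (C \<times> {d})" using C(2) hmul_id(1)[OF dh(1)] by force
  then have cc2: "continuum C2" unfolding C2_def by (intro continuum_Un[OF C(4) continuum_mul[OF C(4) continuum_single[OF dh(1)]] C(3)])
  have C2: "C2 \<subseteq> G \<inter> hfix B" using C(1,3) B(1) by (auto simp: C2_def intro!: G_mul hfix_mul)
  have C2h: "C2 \<subseteq> hfix {cis b}" "C2 \<subseteq> homeo_S1" using C2 hfix_single B(2) G_homeo by blast+
  have d\<tau>: "act b d \<tau> = \<tau>" using act_fix_iff[OF dh(2) \<tau>] dfix by simp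
  have ev1: "ev b \<tau> (E f) = act b f \<tau>" if "f \<in> C \<union> C2" for f using ev_act[OF _ \<tau>] that Ch C2h by blast
  have cont1: "continuous_on (E ` C) (ev b \<tau>)" and cont2: "continuous_on (E ` C2) (ev b \<tau>)"
    using continuous_on_subset[OF continuous_on_ev[OF \<tau>]] Ch C2h by blast+
  have cp: "compact (E ` C)" "E ` C \<noteq> {}" using C(2,4) by (auto simp: continuum_def)
  obtain g0 where g0: "g0 \<in> C" "\<And>f. f \<in> C \<Longrightarrow> act b g0 \<tau> \<le> act b f \<tau>"
    using continuous_attains_inf[OF cp cont1] ev1 by auto
  obtain g1 where g1: "g1 \<in> C" "\<And>f. f \<in> C \<Longrightarrow> act b f \<tau> \<le> act b g1 \<tau>"
    using continuous_attains_sup[OF cp cont1] ev1 by auto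
  have act_d: "act b (hmul f d) \<tau> = act b f \<tau>" if "f \<in> C" for f
    using act_mul[OF _ dh(2), of f \<tau>] that Ch d\<tau> by auto
  have rng: "act b g0 \<tau> \<le> act b f \<tau> \<and> act b f \<tau> \<le> act b g1 \<tau>" if "f \<in> C2" for f
    using that g0 g1 act_d by (auto simp: C2_def)
  have gd: "hmul g1 d \<in> C2" using g1(1) by (force simp: C2_def)
  \<comment> \<open>The climb joins the common minimum (g0, g0) to the pair (g1, g1 d) of maximal
    height. The quotients at these two ends are the identity and d.\<close>
  have "\<exists>D. D \<subseteq> {z \<in> E ` C \<times> E ` C2. ev b \<tau> (fst z) = ev b \<tau> (snd z)} \<and> compact D \<and> connected D \<and>
    (E g0, E g0) \<in> D \<and> (E g1, E (hmul g1 d)) \<in> D"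
  proof (rule climb)
    show "act b g0 \<tau> \<le> ev b \<tau> x \<and> ev b \<tau> x \<le> act b g1 \<tau>" if "x \<in> E ` C" for x
      using that g0 g1 ev1 by auto
    show "act b g0 \<tau> \<le> ev b \<tau> x \<and> ev b \<tau> x \<le> act b g1 \<tau>" if "x \<in> E ` C2" for x
      using that rng ev1 by auto
    show "E g0 \<in> E ` C2" using g0 by (auto simp: C2_def)
    show "ev b \<tau> (E (hmul g1 d)) = act b g1 \<tau>" using act_d[OF g1(1)] ev1 gd by simp
  qed (use C(4) cc2 cont1 cont2 g0 g1 gd ev1 in \<open>auto simp: continuum_def\<close>)
  then obtain D where D: "D \<subseteq> {z \<in> E ` C \<times> E ` C2. ev b \<tau> (fst z) = ev b \<tau> (snd z)}"
    "compact D" "connected D" "(E g0, E g0) \<in> D" "(E g1, E (hmul g1 d)) \<in> D" by blast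
  let ?q = "\<lambda>z. hq (Einv (fst z)) (Einv (snd z))"
  have "E ` C \<times> E ` C2 \<subseteq> E ` homeo_S1 \<times> E ` homeo_S1" using Ch(2) C2h(2) by blast
  then have "D \<subseteq> E ` homeo_S1 \<times> E ` homeo_S1" using D(1) by blast
  then have "continuum (?q ` D)" using D(2,3) by (rule continuum_hq_image)
  moreover have "?q ` D \<subseteq> G \<inter> hfix (insert (cis \<tau>) B)"
  proof clarify
    fix x y assume "(x, y) \<in> D"
    then obtain f g where fg: "x = E f" "y = E g" "f \<in> C" "g \<in> C2" "act b f \<tau> = act b g \<tau>"
      using D(1) ev1 by auto
    have h: "f \<in> homeo_S1" "g \<in> homeo_S1" "f \<in> hfix {cis b}" "g \<in> hfix {cis b}" using fg Ch C2h by blast+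
    have "f (cis \<tau>) = g (cis \<tau>)" using act_J(2)[OF h(3) \<tau>] act_J(2)[OF h(4) \<tau>] fg by simp
    then have "hq f g (cis \<tau>) = cis \<tau>" using hinv_left[OF h(1) cis_S1] by (simp add: hq_apply[OF cis_S1] flip: \<open>f (cis \<tau>) = g (cis \<tau>)\<close>)
    moreover have "hq f g \<in> hfix B" unfolding hq_def using fg C(1) C2 B(1) by (intro hfix_mul hfix_inv) auto
    moreover have "hq f g \<in> G" unfolding hq_def using fg C(1) C2 by (intro G_mul G_inv) auto
    ultimately show "?q (x, y) \<in> G \<inter> hfix (insert (cis \<tau>) B)" by (simp add: fg Einv_E h hfix_def)
  qed
  moreover have "hid \<in> ?q ` D"
  proof -
    have "g0 \<in> homeo_S1" using g0 Ch by blast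
    then have "?q (E g0, E g0) = hid" by (simp add: Einv_E hq_eqs)
    then show ?thesis using D(4) by force
  qed
  moreover have "d \<in> ?q ` D"
  proof -
    have g1h: "g1 \<in> homeo_S1" using g1 Ch by blast
    have "hq g1 (hmul g1 d) = d"
      by (rule homeo_eqI) (simp_all add: hq_in hmul_in g1h dh hq_apply hmul_apply hinv_left homeo_range[OF dh(1)])
    then have "?q (E g1, E (hmul g1 d)) = d" by (simp add: Einv_E g1h hmul_in dh)
    then show ?thesis using D(5) by force
  qed
  ultimately show ?thesis unfolding K_def by blast
qed

end

section \<open>Fixed points of the continuum components\<close>

lemma cis_inj_J: "cis s = cis t \<Longrightarrow> s \<in> J b \<Longrightarrow> t \<in> J b \<Longrightarrow> s = t"
  by (rule cis_inj_interval) auto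

lemma cis_J_ne: "t \<in> J b \<Longrightarrow> cis t \<noteq> cis b"
  using cis_inj_interval[of t b] by auto

lemma inj_on_cis_J: "inj_on cis (J b)"
  by (rule inj_onI) (rule cis_inj_J)

lemma infinite_S1: "infinite S1"
proof
  assume "finite S1"
  moreover have "cis ` J 0 \<subseteq> S1" using cis_S1 by blast
  ultimately have "finite (cis ` J 0)" by (rule finite_subset[rotated])
  then have "finite (J 0)" using finite_imageD inj_on_cis_J by blast
  then show False using infinite_Ioo[of 0 "2 * pi"] by simp
qed

lemma coords:
  assumes "A \<subseteq> S1" "cis b \<in> A"
  shows "A = insert (cis b) (cis ` {t \<in> J b. cis t \<in> A})"
proof
  show "A \<subseteq> insert (cis b) (cis ` {t \<in> J b. cis t \<in> A})"
  proof
    fix a assume a: "a \<in> A"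
    then obtain t where t: "b \<le> t" "t < b + 2 * pi" "a = cis t"
      using cis_coordinate[of a b] assms(1) by blast
    then show "a \<in> insert (cis b) (cis ` {t \<in> J b. cis t \<in> A})"
      using a by (cases "t = b") auto
  qed
qed (use assms in auto)

lemma finite_coords: "finite A \<Longrightarrow> finite {t \<in> J b. cis t \<in> A}"
  by (rule finite_imageD[of cis]) (auto intro: finite_subset inj_on_subset[OF inj_on_cis_J])

lemma card_coords:
  assumes "finite A" "A \<subseteq> S1" "cis b \<in> A"
  shows "card A = Suc (card {t \<in> J b. cis t \<in> A})"
proof -
  have "card A = card (insert (cis b) (cis ` {t \<in> J b. cis t \<in> A}))"
    using coords[OF assms(2,3)] by simp
  also have "\<dots> = Suc (card (cis ` {t \<in> J b. cis t \<in> A}))"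
    using cis_J_ne finite_coords[OF assms(1)] by (subst card_insert_disjoint) force+
  also have "card (cis ` {t \<in> J b. cis t \<in> A}) = card {t \<in> J b. cis t \<in> A}"
    by (rule card_image) (auto intro: inj_on_subset[OF inj_on_cis_J])
  finally show ?thesis .
qed

context circle_group
begin

definition tight :: "nat \<Rightarrow> bool" where
  "tight n \<longleftrightarrow> (\<forall>A. A \<subseteq> S1 \<and> finite A \<and> card A = n \<longrightarrow> Fx A \<subseteq> A)"

lemma tight_D: "tight n \<Longrightarrow> A \<subseteq> S1 \<Longrightarrow> finite A \<Longrightarrow> card A = n \<Longrightarrow> Fx A \<subseteq> A"
  unfolding tight_def by blast

text \<open>A common fixed point x outside A would remain one outside the set after adding to A a
  point other than x.\<close>

lemma tight_down:
  assumes "tight (Suc n)"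
  shows "tight n"
  unfolding tight_def
proof (intro allI impI, elim conjE, rule subsetI)
  fix A x assume A: "A \<subseteq> S1" "finite A" "card A = n" and x: "x \<in> Fx A"
  obtain y where y: "y \<in> S1" "y \<notin> insert x A"
    using infinite_S1 A(2) by (meson finite_insert finite_subset subsetI)
  have "Fx (insert y A) \<subseteq> insert y A"
    using A y by (intro tight_D[OF assms]) auto
  then have "x \<in> insert y A" using x Fx_mono[of A "insert y A"] by blast
  then show "x \<in> A" using y by auto
qed

lemma tight_le: "m \<le> n \<Longrightarrow> tight n \<Longrightarrow> tight m"
  by (induction n rule: dec_induct) (auto dest: tight_down)

lemma K_trans:
  assumes "tight n" "A \<subseteq> S1" "finite A" "card A = n" "cis b \<in> A" "t \<in> J b" "t' \<in> J b"
    "\<And>s. min t t' \<le> s \<Longrightarrow> s \<le> max t t' \<Longrightarrow> cis s \<notin> A"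
  shows "\<exists>k\<in>K A. act b k t = t'"
  using K_move_back[OF assms(2,5,6,7)] tight_D[OF assms(1-4)] assms(8) by blast

lemma K_act_fix:
  assumes "k \<in> hfix A" "cis b \<in> A" "cis s \<in> A \<or> s \<notin> J b"
  shows "act b k s = s"
proof (cases "s \<in> J b")
  case True
  then have "k (cis s) = cis s" using assms by (auto simp: hfix_def)
  then show ?thesis using act_fix_iff[OF hfix_single[OF assms(1,2)] True] by simp
qed (simp add: act_out)

text \<open>Points are placed from the lowest upwards. Once the lower ones are in position, the
  image of the largest and its target lie in the same gap above them. The placed points and the cut
  point \<open>cis b\<close> are as many as the points to be arranged, hence the bound
  \<open>m \<le> N\<close>.\<close>

lemma arrange:
  assumes "tight N" "finite X" "finite Y" "X \<subseteq> J b" "Y \<subseteq> J b" "card X = m" "card Y = m" "m \<le> N"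
  shows "\<exists>g\<in>G. g \<in> hfix {cis b} \<and> act b g ` X = Y"
  using assms(2-)
proof (induction m arbitrary: X Y)
  case 0
  then have "X = {}" "Y = {}" by auto
  then show ?case using G_id hfix_id[OF cis_sub] by blast
next
  case (Suc m)
  have ne: "X \<noteq> {}" "Y \<noteq> {}" using Suc.prems by auto
  define x y where "x = Max X" and "y = Max Y"
  have x: "x \<in> X" "\<And>t. t \<in> X \<Longrightarrow> t \<le> x" and y: "y \<in> Y" "\<And>t. t \<in> Y \<Longrightarrow> t \<le> y"
    using Suc.prems ne by (auto simp: x_def y_def)
  have J: "x \<in> J b" "y \<in> J b" using x y Suc.prems by auto
  have "\<exists>g\<in>G. g \<in> hfix {cis b} \<and> act b g ` (X - {x}) = Y - {y}"
    using Suc.prems x y by (intro Suc.IH) auto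
  then obtain g where g: "g \<in> G" "g \<in> hfix {cis b}" "act b g ` (X - {x}) = Y - {y}" by blast
  define A where "A = insert (cis b) (cis ` (Y - {y}))"
  have A: "A \<subseteq> S1" "finite A" "cis b \<in> A" using Suc.prems cis_S1 by (auto simp: A_def)
  have "card A = Suc (card (cis ` (Y - {y})))"
    unfolding A_def using Suc.prems cis_J_ne by (subst card_insert_disjoint) force+
  also have "card (cis ` (Y - {y})) = m"
    using Suc.prems y by (subst card_image) (auto intro!: inj_on_subset[OF inj_on_cis_J])
  finally have cA: "card A = Suc m" .
  have inA: "s \<in> Y - {y}" if "cis s \<in> A" "s \<in> J b" for s
  proof -
    from that obtain s' where "s' \<in> Y - {y}" "cis s = cis s'" using cis_J_ne by (auto simp: A_def)
    then show ?thesis using cis_inj_J[of s s' b] that(2) Suc.prems by auto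
  qed
  have gx: "act b g x \<in> J b" by (rule act_J[OF g(2) J(1)])
  have lt: "s < act b g x" "s < y" if "s \<in> Y - {y}" for s
  proof -
    have "s \<in> act b g ` (X - {x})" unfolding g(3) using that .
    then obtain r where r: "r \<in> X - {x}" "s = act b g r" by blast
    then have "r < x" using x(2)[of r] by auto
    then show "s < act b g x" using act_less[OF g(2)] r by simp
    show "s < y" using that y(2)[of s] by auto
  qed
  have "\<exists>k\<in>K A. act b k (act b g x) = y"
  proof (rule K_trans[OF tight_le[OF _ assms(1)] A(1,2) cA A(3) gx J(2)])
    show "Suc m \<le> N" using Suc.prems by simp
    fix s assume s: "min (act b g x) y \<le> s" "s \<le> max (act b g x) y"
    then have "s \<in> J b" using gx J by auto
    show "cis s \<notin> A"
    proof
      assume "cis s \<in> A"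
      then have "s \<in> Y - {y}" using inA \<open>s \<in> J b\<close> by blast
      then show False using lt[of s] s(1) by simp
    qed
  qed
  then obtain k where k: "k \<in> K A" "act b k (act b g x) = y" by blast
  have kh: "k \<in> hfix {cis b}" using hfix_single[OF K_hfix[OF k(1)] A(3)] .
  have kf: "act b k s = s" if "s \<in> Y - {y}" for s
    by (rule K_act_fix[OF K_hfix[OF k(1)] A(3)]) (use that in \<open>auto simp: A_def\<close>)
  have "act b (hmul k g) ` X = act b k ` act b g ` (insert x (X - {x}))"
    unfolding image_image act_mul[OF kh g(2)] using x(1) by (simp add: insert_absorb)
  also have "\<dots> = insert y (act b k ` (Y - {y}))" by (simp only: image_insert g(3) k(2))
  also have "act b k ` (Y - {y}) = Y - {y}" using kf by simp
  also have "insert y (Y - {y}) = Y" using y(1) by auto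
  finally have "act b (hmul k g) ` X = Y" .
  moreover have "hmul k g \<in> G" "hmul k g \<in> hfix {cis b}"
    using G_mul K_G k(1) g hfix_mul[OF kh g(2) cis_sub] by auto
  ultimately show ?case by blast
qed

text \<open>\<open>\<sigma>\<close> selects the side: 1 is counterclockwise, - 1 is
  clockwise.\<close>

definition isolated :: "real \<Rightarrow> complex set \<Rightarrow> complex \<Rightarrow> bool" where
  "isolated \<sigma> A a \<longleftrightarrow> (\<exists>e>0. \<forall>s. 0 < s \<and> s < e \<longrightarrow> a * cis (\<sigma> * s) \<notin> Fx A)"

text \<open>An increasing lift of g carries one-sided neighbourhoods of a to neighbourhoods of g a
  on the same side.\<close>

lemma isolated_image:
  assumes "isolated \<sigma> A a" "\<sigma> = 1 \<or> \<sigma> = - 1" "A \<subseteq> S1" "a \<in> S1" "g \<in> G"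
  shows "isolated \<sigma> (g ` A) (g a)"
proof -
  have gh: "g \<in> homeo_S1" using G_homeo assms by blast
  obtain \<alpha> where \<alpha>: "a = cis \<alpha>" using assms(4) S1_eq_cis by blast
  obtain \<beta> where \<beta>: "g a = cis \<beta>" using homeo_range[OF gh assms(4)] S1_eq_cis by blast
  obtain F where F: "incr F" "\<And>t. g (cis t) = cis (F t)" "F \<alpha> = \<beta>"
    using homeo_lift_at[OF gh, of \<alpha> \<beta>] \<alpha> \<beta> by blast
  obtain e where e: "e > 0" "\<And>s. 0 < s \<Longrightarrow> s < e \<Longrightarrow> a * cis (\<sigma> * s) \<notin> Fx A"
    using assms(1) unfolding isolated_def by blast
  define e' where "e' = \<sigma> * (F (\<alpha> + \<sigma> * e) - \<beta>)"
  have "e' > 0" using assms(2) e(1) incr_less[OF F(1), of \<alpha> "\<alpha> + e"] incr_less[OF F(1), of "\<alpha> - e" \<alpha>] F(3)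
    by (auto simp: e'_def)
  moreover have "g a * cis (\<sigma> * s) \<notin> Fx (g ` A)" if s: "0 < s" "s < e'" for s
  proof -
    define u where "u = rinv F (\<beta> + \<sigma> * s)"
    have Fu: "F u = \<beta> + \<sigma> * s" by (simp add: u_def incr_inv2[OF F(1)])
    define r where "r = \<sigma> * (u - \<alpha>)"
    have u: "u = \<alpha> + \<sigma> * r" using assms(2) by (auto simp: r_def)
    have "0 < r \<and> r < e"
      using assms(2)
    proof
      assume \<sigma>: "\<sigma> = 1"
      then have "F \<alpha> < F u" "F u < F (\<alpha> + e)" using Fu F(3) s by (auto simp: e'_def)
      then show ?thesis using incr_less[OF F(1)] \<sigma> by (simp add: r_def)
    next
      assume \<sigma>: "\<sigma> = - 1"
      then have "F u < F \<alpha>" "F (\<alpha> - e) < F u" using Fu F(3) s by (auto simp: e'_def)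
      then show ?thesis using incr_less[OF F(1)] \<sigma> by (simp add: r_def)
    qed
    then have "a * cis (\<sigma> * r) \<notin> Fx A" using e(2) by blast
    then have "cis u \<notin> Fx A" by (simp add: \<alpha> u cis_mult)
    then have "g (cis u) \<notin> Fx (g ` A)" using Fx_image_iff[OF assms(3,5) cis_S1] by blast
    then show ?thesis by (simp add: F(2) Fu \<beta> cis_mult)
  qed
  ultimately show ?thesis unfolding isolated_def by blast
qed

text \<open>The gap is bounded because \<open>b\<close> and \<open>b + 2 * pi\<close> both represent
  a common fixed point, and its ends are attained because the fixed set is closed.\<close>

lemma gap_exists:
  assumes "A \<subseteq> S1" "cis b \<in> A" "t \<in> J b" "cis t \<notin> Fx A"
  obtains c d where "c < t" "t < d" "cis c \<in> Fx A" "cis d \<in> Fx A" "\<And>s. c < s \<Longrightarrow> s < d \<Longrightarrow> cis s \<notin> Fx A"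
proof -
  define S where "S = {s. cis s \<in> Fx A}"
  have S: "closed S" unfolding S_def by (rule Fx_closed)
  have cb: "cis b \<in> Fx A" using Fx_sub[OF assms(1)] assms(2) by blast
  have "cis (b + 2 * pi) = cis b" by (simp add: cis_eq_iff exI[of _ 1])
  then have bS: "b \<in> S" "b + 2 * pi \<in> S" using cb by (auto simp: S_def)
  have C: "compact (S \<inter> {b..t})" "S \<inter> {b..t} \<noteq> {}" using S bS assms(3) by (auto intro!: closed_Int_compact)
  then obtain c where c: "c \<in> S \<inter> {b..t}" "\<And>s. s \<in> S \<inter> {b..t} \<Longrightarrow> s \<le> c"
    using compact_attains_sup[OF C] by blast
  have D: "compact (S \<inter> {t..b + 2 * pi})" "S \<inter> {t..b + 2 * pi} \<noteq> {}" using S bS assms(3) by (auto intro!: closed_Int_compact)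
  then obtain d where d: "d \<in> S \<inter> {t..b + 2 * pi}" "\<And>s. s \<in> S \<inter> {t..b + 2 * pi} \<Longrightarrow> d \<le> s"
    using compact_attains_inf[OF D] by blast
  have tS: "t \<notin> S" using assms(4) by (simp add: S_def)
  show thesis
  proof (rule that)
    show "c < t" "t < d" using c d tS by (auto simp: order_less_le)
    show "cis c \<in> Fx A" "cis d \<in> Fx A" using c d by (auto simp: S_def)
    fix s assume s: "c < s" "s < d"
    show "cis s \<notin> Fx A"
    proof
      assume "cis s \<in> Fx A"
      then have "s \<in> S" by (simp add: S_def)
      then show False using c(1) d(1) c(2)[of s] d(2)[of s] s by (cases "s \<le> t") auto
    qed
  qed
qed

text \<open>Adding the common fixed point p to A creates no new fixed points, and dropping another
  point of A can only remove some.\<close>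

lemma exchange:
  assumes "A \<subseteq> S1" "finite A" "A \<noteq> {}" "p \<in> Fx A"
  obtains A' where "A' \<subseteq> S1" "finite A'" "card A' = card A" "p \<in> A'" "Fx A' \<subseteq> Fx A"
proof (cases "p \<in> A")
  case False
  obtain a where a: "a \<in> A" using assms by blast
  show thesis
  proof (rule that[of "insert p (A - {a})"])
    show "card (insert p (A - {a})) = card A" using a False assms card_gt_0_iff[of A] by simp
    have "Fx (insert p (A - {a})) \<subseteq> Fx (insert p A)" by (rule Fx_mono) auto
    then show "Fx (insert p (A - {a})) \<subseteq> Fx A" using Fx_absorb[OF assms(4)] by blast
  qed (use assms Fx_S1 in auto)
qed (use assms that in auto)

end

locale transitive_circle_group = circle_group +
  assumes trans: "x \<in> S1 \<Longrightarrow> y \<in> S1 \<Longrightarrow> \<exists>f\<in>G. f x = y"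
begin

text \<open>Once a has been moved to a', cutting the circle there reduces the claim to
  \<open>arrange\<close> for the remaining m points. Thus \<open>tight N\<close> handles sets of up
  to N + 1 points.\<close>

lemma cyclic_transitive:
  assumes "tight N" "A \<subseteq> S1" "finite A" "card A = Suc m" "m \<le> N" "a \<in> A"
    "A' \<subseteq> S1" "finite A'" "card A' = Suc m" "a' \<in> A'"
  shows "\<exists>g\<in>G. g ` A = A' \<and> g a = a'"
proof -
  obtain f where f: "f \<in> G" "f a = a'" using trans assms by blast
  have fh: "f \<in> homeo_S1" using G_homeo f by blast
  obtain b where b: "a' = cis b" using assms S1_eq_cis by blast
  have "f a \<in> f ` A" using assms(6) by (rule imageI)
  then have fA: "f ` A \<subseteq> S1" "finite (f ` A)" "cis b \<in> f ` A"
    using image_S1[OF fh assms(2)] assms(3) f(2) b by auto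
  have "inj_on f A" using homeo_inj[OF fh] assms(2) by (auto simp: inj_on_def)
  then have cfA: "card (f ` A) = Suc m" using assms(4) by (simp add: card_image)
  have bA': "cis b \<in> A'" using assms b by simp
  have "\<exists>g\<in>G. g \<in> hfix {cis b} \<and> act b g ` {t \<in> J b. cis t \<in> f ` A} = {t \<in> J b. cis t \<in> A'}"
    by (rule arrange[OF assms(1) finite_coords[OF fA(2)] finite_coords[OF assms(8)] _ _ _ _ assms(5)])
       (use card_coords[OF fA(2,1,3)] card_coords[OF assms(8,7) bA'] cfA assms(9) in auto)
  then obtain g where g: "g \<in> G" "g \<in> hfix {cis b}"
    "act b g ` {t \<in> J b. cis t \<in> f ` A} = {t \<in> J b. cis t \<in> A'}" by blast
  have "g ` f ` A = insert (g (cis b)) (g ` cis ` {t \<in> J b. cis t \<in> f ` A})"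
    by (subst coords[OF fA(1,3)]) (rule image_insert)
  also have "g (cis b) = cis b" using g(2) by (simp add: hfix_def)
  also have "g ` cis ` {t \<in> J b. cis t \<in> f ` A} = cis ` act b g ` {t \<in> J b. cis t \<in> f ` A}"
    unfolding image_image using act_J(2)[OF g(2)] by (intro image_cong) auto
  also have "insert (cis b) \<dots> = A'" unfolding g(3) using coords[OF assms(7) bA'] by simp
  finally have "g ` f ` A = A'" .
  moreover have "hmul g f ` A = g ` f ` A"
    unfolding image_image using assms(2) by (intro image_cong) (auto simp: hmul_apply)
  moreover have "hmul g f a = a'"
    using assms(2,6) f(2) g(2) b by (simp add: hmul_apply subset_iff hfix_def)
  ultimately show ?thesis using G_mul[OF g(1) f(1)] by blast
qed

text \<open>A point moved by k lies in a gap of \<open>Fx A0\<close>. Exchanged into the set, the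
  left end of this gap is isolated on its right and the right end on its left;
  \<open>cyclic_transitive\<close> carries this to every point of every set with N + 1
  elements.\<close>

lemma all_isolated:
  assumes "tight N" and A0: "A0 \<subseteq> S1" "finite A0" "card A0 = Suc N" "k \<in> K A0" "k \<noteq> hid"
    and A: "A \<subseteq> S1" "finite A" "card A = Suc N" "a \<in> A" and \<sigma>: "\<sigma> = 1 \<or> \<sigma> = - 1"
  shows "isolated \<sigma> A a"
proof -
  have ne: "A0 \<noteq> {}" using A0 by auto
  then obtain b where b: "cis b \<in> A0" using A0(1) S1_eq_cis by (metis all_not_in_conv subsetD)
  obtain z where z: "z \<in> S1" "k z \<noteq> z"
    using homeo_eqI[OF K_homeo[OF A0(4)] hid_in] A0(5) hid_apply by metis
  obtain t where t: "b \<le> t" "t < b + 2 * pi" "z = cis t" using cis_coordinate[OF z(1)] by blast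
  have nz: "z \<notin> Fx A0" using z A0(4) by (auto simp: Fx_def)
  then have "t \<noteq> b" using t(3) b Fx_sub[OF A0(1)] by auto
  then have tJ: "t \<in> J b" using t by simp
  obtain c d where cd: "c < t" "t < d" "cis c \<in> Fx A0" "cis d \<in> Fx A0" "\<And>s. c < s \<Longrightarrow> s < d \<Longrightarrow> cis s \<notin> Fx A0"
    using gap_exists[OF A0(1) b tJ] nz t(3) by blast
  have "\<exists>A1 a1. A1 \<subseteq> S1 \<and> finite A1 \<and> card A1 = Suc N \<and> a1 \<in> A1 \<and> isolated \<sigma> A1 a1"
    using \<sigma>
  proof
    assume \<sigma>: "\<sigma> = 1"
    obtain A1 where A1: "A1 \<subseteq> S1" "finite A1" "card A1 = card A0" "cis c \<in> A1" "Fx A1 \<subseteq> Fx A0"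
      using exchange[OF A0(1,2) ne cd(3)] by blast
    have "cis c * cis (\<sigma> * s) \<notin> Fx A1" if "0 < s" "s < d - c" for s
      using cd(5)[of "c + s"] that A1(5) by (auto simp: \<sigma> cis_mult)
    then have "isolated \<sigma> A1 (cis c)" unfolding isolated_def using cd by (intro exI[of _ "d - c"]) auto
    then show ?thesis using A1 A0 by auto
  next
    assume \<sigma>: "\<sigma> = - 1"
    obtain A1 where A1: "A1 \<subseteq> S1" "finite A1" "card A1 = card A0" "cis d \<in> A1" "Fx A1 \<subseteq> Fx A0"
      using exchange[OF A0(1,2) ne cd(4)] by blast
    have "cis d * cis (\<sigma> * s) \<notin> Fx A1" if "0 < s" "s < d - c" for s
      using cd(5)[of "d - s"] that A1(5) by (auto simp: \<sigma> cis_mult)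
    then have "isolated \<sigma> A1 (cis d)" unfolding isolated_def using cd by (intro exI[of _ "d - c"]) auto
    then show ?thesis using A1 A0 by auto
  qed
  then obtain A1 a1 where A1: "A1 \<subseteq> S1" "finite A1" "card A1 = Suc N" "a1 \<in> A1" "isolated \<sigma> A1 a1" by blast
  obtain g where g: "g \<in> G" "g ` A1 = A" "g a1 = a"
    using cyclic_transitive[OF assms(1) A1(1-3) _ A1(4) A] by blast
  show ?thesis using isolated_image[OF A1(5) \<sigma> A1(1) _ g(1)] A1 g by auto
qed

end

section \<open>Isolated fixed points\<close>

text \<open>Convergence of the iterates strictly from below, phrased by order alone so that
  increasing bijections commuting with the iterates transport it.\<close>

definition climbs_to :: "(real \<Rightarrow> real) \<Rightarrow> real \<Rightarrow> real \<Rightarrow> bool" where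
  "climbs_to \<psi> w l \<longleftrightarrow> (\<forall>i::nat. (\<psi> ^^ i) w < l) \<and> (\<forall>z<l. \<exists>i. z < (\<psi> ^^ i) w)"

lemma climbs_to_unique:
  assumes "climbs_to \<psi> w l" "climbs_to \<psi> w l'"
  shows "l = l'"
proof -
  have le: "l \<le> l'" if c: "climbs_to \<psi> w l" "climbs_to \<psi> w l'" for l l'
  proof (rule ccontr)
    assume "\<not> l \<le> l'"
    then have "l' < l" by simp
    then obtain i where "l' < (\<psi> ^^ i) w" using c(1) unfolding climbs_to_def by blast
    moreover have "(\<psi> ^^ i) w < l'" using c(2) unfolding climbs_to_def by blast
    ultimately show False by simp
  qed
  show ?thesis using le[OF assms] le[OF assms(2,1)] by simp
qed

lemma climbs_to_shift:
  assumes "climbs_to \<psi> w l" and mono: "\<And>i. (\<psi> ^^ i) w < (\<psi> ^^ Suc i) w"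
  shows "climbs_to \<psi> ((\<psi> ^^ j) w) l"
proof -
  have le: "(\<psi> ^^ i) w \<le> (\<psi> ^^ (i + j)) w" for i
    using lift_Suc_mono_le[of "\<lambda>i. (\<psi> ^^ i) w" i "i + j"] mono less_imp_le by auto
  show ?thesis unfolding climbs_to_def
  proof (intro conjI allI impI)
    show "(\<psi> ^^ i) ((\<psi> ^^ j) w) < l" for i
      using assms(1) unfolding climbs_to_def by (metis comp_apply funpow_add)
    fix z assume "z < l"
    then obtain i where "z < (\<psi> ^^ i) w" using assms(1) unfolding climbs_to_def by blast
    also have "\<dots> \<le> (\<psi> ^^ i) ((\<psi> ^^ j) w)" using le[of i] by (simp add: funpow_add)
    finally show "\<exists>i. z < (\<psi> ^^ i) ((\<psi> ^^ j) w)" by blast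
  qed
qed

lemma climbs_to_image:
  assumes "climbs_to \<psi> w l" "incr f" "\<And>i. f ((\<psi> ^^ i) w) = (\<psi> ^^ i) (f w)"
  shows "climbs_to \<psi> (f w) (f l)"
  unfolding climbs_to_def
proof (intro conjI allI impI)
  show "(\<psi> ^^ i) (f w) < f l" for i
    unfolding assms(3)[symmetric] incr_less[OF assms(2)] using assms(1) unfolding climbs_to_def by blast
  fix z assume "z < f l"
  then have "rinv f z < l" using incr_less[OF assms(2), of "rinv f z" l] by (simp add: incr_inv2[OF assms(2)])
  then obtain i where "rinv f z < (\<psi> ^^ i) w" using assms(1) unfolding climbs_to_def by blast
  then have "z < f ((\<psi> ^^ i) w)" using incr_less[OF assms(2), of "rinv f z"] by (simp add: incr_inv2[OF assms(2)])
  then show "\<exists>i. z < (\<psi> ^^ i) (f w)" unfolding assms(3) by blast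
qed

section \<open>Absence of further common fixed points\<close>

context transitive_circle_group
begin

text \<open>Only the gap just before \<open>b + 2 * pi\<close> is treated; a suitable choice of the
  cut point makes any gap the last one.\<close>

lemma gap_empty:
  assumes PN: "tight N" and isolated: "\<And>A a \<sigma>. A \<subseteq> S1 \<Longrightarrow> finite A \<Longrightarrow> card A = Suc N \<Longrightarrow> a \<in> A \<Longrightarrow>
      \<sigma> = 1 \<or> \<sigma> = - 1 \<Longrightarrow> isolated \<sigma> A a"
    and A: "A \<subseteq> S1" "finite A" "card A = Suc N" "cis b \<in> A"
    and x: "x \<in> J b" "cis x \<in> A" "\<And>s. x < s \<Longrightarrow> s < b + 2 * pi \<Longrightarrow> cis s \<notin> A"
    and s0: "x < s0" "s0 < b + 2 * pi"
  shows "cis s0 \<notin> Fx A"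
proof
  assume s0F: "cis s0 \<in> Fx A"
  define e where "e = b + 2 * pi"
  define B where "B = A - {cis x}"
  have B: "B \<subseteq> S1" "finite B" "cis b \<in> B" using A cis_J_ne[OF x(1)] by (auto simp: B_def)
  have cB: "card B = N" using A x(2) by (simp add: B_def)
  have AB: "insert (cis x) B = A" using x(2) by (auto simp: B_def)
  \<comment> \<open>\<open>l0\<close> is the point of B preceding x, where the cut point counts at
    its coordinate b. The interval from \<open>l0\<close> to \<open>e\<close> is then a component of
    the complement of B.\<close>
  define X where "X = insert b {t \<in> J b. cis t \<in> B \<and> t < x}"
  have X: "finite X" "X \<noteq> {}" "b \<in> X"
    using finite_subset[OF _ finite_coords[OF B(2), of b], of "{t \<in> J b. cis t \<in> B \<and> t < x}"] by (auto simp: X_def)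
  define l0 where "l0 = Max X"
  have l0X: "l0 \<in> X" unfolding l0_def using X by simp
  have l0: "b \<le> l0" "l0 < x" "l0 \<notin> J b \<or> cis l0 \<in> B" using l0X x(1) by (auto simp: X_def)
  have noB: "cis s \<notin> B" if "l0 < s" "s < e" for s
  proof
    assume sB: "cis s \<in> B"
    have sJ: "s \<in> J b" using that l0 by (simp add: e_def)
    have "s \<noteq> x" using sB by (auto simp: B_def)
    moreover have "\<not> x < s" using x(3)[of s] sB that by (auto simp: B_def e_def)
    ultimately have "s \<in> X" using sB sJ by (simp add: X_def)
    then have "s \<le> l0" unfolding l0_def using X by simp
    then show False using that by simp
  qed
  define I where "I = {l0<..<e}"
  have IJ: "t \<in> J b" if "t \<in> I" for t using that l0 by (simp add: I_def e_def)
  have xI: "x \<in> I" using l0 x(1) by (simp add: I_def e_def)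
  \<comment> \<open>Equivariant under \<open>K B\<close>, hence determined on I by its value at x,
    since \<open>K B\<close> is transitive there.\<close>
  define \<Phi> where "\<Phi> y = {s \<in> J b. cis s \<in> Fx (insert (cis y) B)}" for y
  have hf: "k \<in> hfix {cis b}" if "k \<in> K B" for k using hfix_single[OF K_hfix[OF that] B(3)] .
  have tr: "\<exists>k\<in>K B. act b k y = y'" if "y \<in> I" "y' \<in> I" for y y'
    by (rule K_trans[OF PN B(1,2) cB B(3) IJ[OF that(1)] IJ[OF that(2)]]) (use that noB in \<open>auto simp: I_def\<close>)
  have actI: "act b k y \<in> I" if "k \<in> K B" "y \<in> I" for k y
  proof -
    have "act b k l0 = l0" by (rule K_act_fix[OF K_hfix[OF that(1)] B(3)]) (use l0 in blast)
    moreover have "act b k e = e" by (rule act_out) (simp add: e_def)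
    ultimately show ?thesis using act_less[OF hf[OF that(1)], of l0 y] act_less[OF hf[OF that(1)], of y e] that(2)
      by (simp add: I_def)
  qed
  have \<Phi>_act: "act b k s \<in> \<Phi> (act b k y)" if k: "k \<in> K B" and y: "y \<in> I" and s: "s \<in> \<Phi> y" for k y s
  proof -
    have sJ: "s \<in> J b" and sF: "cis s \<in> Fx (insert (cis y) B)" using s by (auto simp: \<Phi>_def)
    have "k (cis s) \<in> Fx (k ` insert (cis y) B)"
      by (rule Fx_image[OF _ K_G[OF k] sF]) (use B cis_S1 in auto)
    moreover have "k ` insert (cis y) B = insert (cis (act b k y)) B"
      using act_J(2)[OF hf[OF k] IJ[OF y]] K_hfix[OF k] by (auto simp: hfix_def)
    ultimately show ?thesis using act_J[OF hf[OF k] sJ] by (simp add: \<Phi>_def)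
  qed
  have s0\<Phi>: "s0 \<in> \<Phi> x" using s0 s0F x(1) by (simp add: \<Phi>_def AB)
  have ex\<Phi>: "\<exists>s\<in>\<Phi> y. y < s" if y: "y \<in> I" for y
  proof -
    obtain k where k: "k \<in> K B" "act b k x = y" using tr[OF xI y] by blast
    then show ?thesis using \<Phi>_act[OF k(1) xI s0\<Phi>] act_less[OF hf[OF k(1)], of x s0] s0(1) by auto
  qed
  have card_y: "insert (cis y) B \<subseteq> S1" "finite (insert (cis y) B)" "card (insert (cis y) B) = Suc N" if "y \<in> I" for y
    using that noB[of y] B cB cis_S1 by (auto simp: I_def)
  have next_ex: "\<exists>m. m \<in> \<Phi> y \<and> y < m \<and> (\<forall>s\<in>\<Phi> y. y < s \<longrightarrow> m \<le> s)" if y: "y \<in> I" for y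
  proof -
    obtain s1 where s1: "s1 \<in> \<Phi> y" "y < s1" using ex\<Phi>[OF y] by blast
    \<comment> \<open>Isolation on the right of y keeps the fixed points above y at a distance, so
      that a least one exists.\<close>
    obtain \<epsilon> where \<epsilon>: "\<epsilon> > 0" "\<And>s. 0 < s \<Longrightarrow> s < \<epsilon> \<Longrightarrow> cis y * cis (1 * s) \<notin> Fx (insert (cis y) B)"
      using isolated[OF card_y[OF y], of "cis y" 1] unfolding isolated_def by auto
    have near: "y + \<epsilon> \<le> s" if "s \<in> \<Phi> y" "y < s" for s
      using \<epsilon>(2)[of "s - y"] that by (force simp: cis_mult \<Phi>_def)
    define S where "S = {s. cis s \<in> Fx (insert (cis y) B)} \<inter> {y + \<epsilon>..s1}"
    have "compact S" unfolding S_def by (intro closed_Int_compact Fx_closed) simp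
    moreover have "S \<noteq> {}" using s1 near[OF s1] by (auto simp: S_def \<Phi>_def)
    ultimately obtain m where m: "m \<in> S" "\<And>s. s \<in> S \<Longrightarrow> m \<le> s" using compact_attains_inf[of S] by blast
    have "m \<in> \<Phi> y" using m(1) s1(1) \<epsilon>(1) IJ[OF y] by (auto simp: S_def \<Phi>_def)
    moreover have "y < m" using m(1) \<epsilon>(1) by (simp add: S_def)
    moreover have "m \<le> s" if "s \<in> \<Phi> y" "y < s" for s
    proof (cases "s \<le> s1")
      case True
      then show ?thesis using that near[OF that] by (intro m(2)) (auto simp: S_def \<Phi>_def)
    qed (use m(1) in \<open>auto simp: S_def\<close>)
    ultimately show ?thesis by blast
  qed
  define \<psi> where "\<psi> y = (SOME m. m \<in> \<Phi> y \<and> y < m \<and> (\<forall>s\<in>\<Phi> y. y < s \<longrightarrow> m \<le> s))" for y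
  have \<psi>: "\<psi> y \<in> \<Phi> y \<and> y < \<psi> y \<and> (\<forall>s\<in>\<Phi> y. y < s \<longrightarrow> \<psi> y \<le> s)" if "y \<in> I" for y
    unfolding \<psi>_def by (rule someI_ex[OF next_ex[OF that]])
  have \<psi>I: "\<psi> y \<in> I" if "y \<in> I" for y using \<psi>[OF that] that l0 by (auto simp: I_def \<Phi>_def e_def)
  have \<psi>_act: "act b k (\<psi> y) = \<psi> (act b k y)" if k: "k \<in> K B" and y: "y \<in> I" for k y
  proof (rule antisym)
    have ay: "act b k y \<in> I" by (rule actI[OF k y])
    note p = \<psi>[OF ay]
    have ik: "hinv k \<in> K B" by (rule K_inv[OF B(1) k])
    note i = act_inv[OF hf[OF k]]
    have "act b (hinv k) (\<psi> (act b k y)) \<in> \<Phi> y"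
      using \<Phi>_act[OF ik ay] p i(1)[of y] by auto
    moreover have "y < act b (hinv k) (\<psi> (act b k y))"
      using p act_less[OF hf[OF ik], of "act b k y" "\<psi> (act b k y)"] i(1)[of y] by simp
    ultimately have "\<psi> y \<le> act b (hinv k) (\<psi> (act b k y))" using \<psi>[OF y] by blast
    then have "act b k (\<psi> y) \<le> act b k (act b (hinv k) (\<psi> (act b k y)))"
      using incr_le[OF act_incr[OF hf[OF k]]] by blast
    then show "act b k (\<psi> y) \<le> \<psi> (act b k y)" by (simp add: i(2))
    have "act b k (\<psi> y) \<in> \<Phi> (act b k y)" using \<Phi>_act[OF k y] \<psi>[OF y] by blast
    moreover have "act b k y < act b k (\<psi> y)" using act_less[OF hf[OF k]] \<psi>[OF y] by blast
    ultimately show "\<psi> (act b k y) \<le> act b k (\<psi> y)" using p by blast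
  qed
  have itI: "(\<psi> ^^ i) y \<in> I" if "y \<in> I" for i y by (induction i) (use that \<psi>I in auto)
  have it_act: "act b k ((\<psi> ^^ i) y) = (\<psi> ^^ i) (act b k y)" if "k \<in> K B" "y \<in> I" for k i y
    by (induction i) (use that \<psi>_act itI in auto)
  have it_mono: "(\<psi> ^^ i) y < (\<psi> ^^ Suc i) y" if "y \<in> I" for i y using \<psi>[OF itI[OF that, of i]] by simp
  \<comment> \<open>A common fixed point m of \<open>K (insert (cis y) B)\<close> is absorbed into
    the set. As a consequence, all iterates at x remain in \<open>Fx A\<close>.\<close>
  have \<Phi>_trans: "\<Phi> m \<subseteq> \<Phi> y" if "m \<in> \<Phi> y" for m y
  proof -
    have "cis m \<in> Fx (insert (cis y) B)" using that by (simp add: \<Phi>_def)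
    then have "Fx (insert (cis m) (insert (cis y) B)) \<subseteq> Fx (insert (cis y) B)" by (rule Fx_absorb)
    moreover have "Fx (insert (cis m) B) \<subseteq> Fx (insert (cis m) (insert (cis y) B))" by (rule Fx_mono) auto
    ultimately show ?thesis by (auto simp: \<Phi>_def)
  qed
  have it\<Phi>: "(\<psi> ^^ Suc i) x \<in> \<Phi> x" for i
  proof (induction i)
    case 0
    then show ?case using \<psi>[OF xI] by simp
  next
    case (Suc i)
    have "\<psi> ((\<psi> ^^ Suc i) x) \<in> \<Phi> ((\<psi> ^^ Suc i) x)" using \<psi>[OF itI[OF xI, of "Suc i"]] by blast
    then show ?case using \<Phi>_trans[OF Suc] by auto
  qed
  define l where "l = (SUP i. (\<psi> ^^ i) x)"
  have bdd: "bdd_above (range (\<lambda>i. (\<psi> ^^ i) x))"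
    by (rule bdd_aboveI2[of _ _ e]) (use itI[OF xI] in \<open>auto simp: I_def less_imp_le\<close>)
  have up: "(\<psi> ^^ i) x \<le> l" for i unfolding l_def by (rule cSUP_upper[OF _ bdd]) simp
  have lim: "climbs_to \<psi> x l" unfolding climbs_to_def
  proof (intro conjI allI impI)
    show "(\<psi> ^^ i) x < l" for i using it_mono[OF xI, of i] up[of "Suc i"] by simp
    show "\<exists>i. z < (\<psi> ^^ i) x" if "z < l" for z
      using that less_cSUP_iff[OF _ bdd, of z] unfolding l_def by auto
  qed
  have "l \<le> e" unfolding l_def by (rule cSUP_least) (use itI[OF xI] in \<open>auto simp: I_def less_imp_le\<close>)
  moreover have "x < l" using lim unfolding climbs_to_def by (metis funpow_0)
  moreover have "l \<noteq> e"
  proof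
    assume le: "l = e"
    \<comment> \<open>\<open>e\<close> represents the same point of A as \<open>b\<close>, and the
      iterates, all of them in \<open>Fx A\<close>, would accumulate there from the clockwise
      side.\<close>
    obtain \<epsilon> where \<epsilon>: "\<epsilon> > 0" "\<And>s. 0 < s \<Longrightarrow> s < \<epsilon> \<Longrightarrow> cis b * cis (- 1 * s) \<notin> Fx A"
      using isolated[OF A, of "- 1"] unfolding isolated_def by auto
    obtain i where i: "e - \<epsilon> < (\<psi> ^^ i) x" using lim \<epsilon>(1) le unfolding climbs_to_def by (metis diff_less_eq less_add_same_cancel1)
    define s where "s = (\<psi> ^^ Suc i) x"
    have s: "e - \<epsilon> < s" "s < e" using i it_mono[OF xI, of i] itI[OF xI, of "Suc i"] by (auto simp: s_def I_def)
    have "cis b * cis (- 1 * (e - s)) = cis s"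
      unfolding cis_mult cis_eq_iff by (intro exI[of _ "- 1"]) (simp add: e_def)
    then have "cis s \<notin> Fx A" using \<epsilon>(2)[of "e - s"] s by simp
    then show False using it\<Phi>[of i] by (simp add: s_def \<Phi>_def AB)
  qed
  ultimately have lI: "l \<in> I" using xI by (simp add: I_def)
  define Al where "Al = insert (cis l) B"
  note cA = card_y[OF lI, folded Al_def]
  obtain \<epsilon> where \<epsilon>: "\<epsilon> > 0" "\<And>s. 0 < s \<Longrightarrow> s < \<epsilon> \<Longrightarrow> cis l * cis (- 1 * s) \<notin> Fx Al"
    using isolated[OF cA, of "cis l" "- 1"] unfolding isolated_def Al_def by auto
  define e0 where "e0 = max (l - \<epsilon>) l0"
  have e0: "e0 < l" using \<epsilon>(1) lI by (simp add: e0_def I_def)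
  have UI: "w \<in> I" if "e0 < w" "w < l" for w using that lI by (simp add: e0_def I_def)
  have U_conv: "climbs_to \<psi> w l" if w: "e0 < w" "w < l" for w
  proof -
    obtain j where j: "e0 < (\<psi> ^^ j) x" using lim e0 unfolding climbs_to_def by blast
    define v where "v = (\<psi> ^^ j) x"
    have v: "e0 < v" "v < l" using j lim unfolding v_def climbs_to_def by auto
    have cv: "climbs_to \<psi> v l" unfolding v_def by (rule climbs_to_shift[OF lim it_mono[OF xI]])
    have "\<exists>k\<in>K Al. act b k v = w"
    proof (rule K_move_back[OF cA(1) _ IJ[OF UI[OF v]] IJ[OF UI[OF w]]])
      show "cis b \<in> Al" using B by (simp add: Al_def)
      fix s assume "min v w \<le> s" "s \<le> max v w"
      then have "0 < l - s" "l - s < \<epsilon>" using v w by (auto simp: e0_def)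
      then show "cis s \<notin> Fx Al" using \<epsilon>(2)[of "l - s"] by (simp add: cis_mult)
    qed
    then obtain k where k: "k \<in> K Al" "act b k v = w" by blast
    have kB: "k \<in> K B" using k(1) K_mono[of B Al] by (auto simp: Al_def)
    have "act b k l = l" by (rule K_act_fix[OF K_hfix[OF k(1)]]) (use B in \<open>auto simp: Al_def\<close>)
    then show ?thesis
      using climbs_to_image[OF cv act_incr[OF hf[OF kB]] it_act[OF kB UI[OF v]]] k(2) by simp
  qed
  define l' where "l' = (e0 + l) / 2"
  have l': "e0 < l'" "l' < l" using e0 by (auto simp: l'_def)
  obtain g where g: "g \<in> K B" "act b g l = l'" using tr[OF lI UI[OF l']] by blast
  \<comment> \<open>Lies in the interval from \<open>e0\<close> to l and also in its image under g,
    which ends at l'; so its iterates converge to both l and l'.\<close>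
  define w where "w = (max e0 (act b g e0) + l') / 2"
  have ge0: "act b g e0 < l'" using act_less[OF hf[OF g(1)], of e0 l] e0 g(2) by simp
  have w: "e0 < w" "act b g e0 < w" "w < l'" using ge0 l' by (auto simp: w_def max_def)
  have "climbs_to \<psi> w l" using U_conv[of w] w l' by simp
  moreover have "climbs_to \<psi> w l'"
  proof -
    define v where "v = act b (hinv g) w"
    have gv: "act b g v = w" unfolding v_def by (rule act_inv(2)[OF hf[OF g(1)]])
    have v: "e0 < v" "v < l" using w act_less[OF hf[OF g(1)], of e0 v] act_less[OF hf[OF g(1)], of v l] gv g(2) by auto
    show ?thesis
      using climbs_to_image[OF U_conv[OF v] act_incr[OF hf[OF g(1)]] it_act[OF g(1) UI[OF v]]] gv g(2) by simp
  qed
  ultimately have "l = l'" by (rule climbs_to_unique)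
  then show False using l' by simp
qed

lemma tight_step:
  assumes N: "tight N" "N \<ge> 1" and A0: "A0 \<subseteq> S1" "finite A0" "card A0 = Suc N" "k \<in> K A0" "k \<noteq> hid"
  shows "tight (Suc N)"
  unfolding tight_def
proof (intro allI impI, elim conjE, rule subsetI, rule ccontr)
  fix A z assume A: "A \<subseteq> S1" "finite A" "card A = Suc N" and z: "z \<in> Fx A" "z \<notin> A"
  obtain t where t: "z = cis t" using z(1) Fx_S1 S1_eq_cis by blast
  define T where "T = {s \<in> J t. cis s \<in> A}"
  have "finite T" unfolding T_def by (rule finite_coords[OF A(2)])
  obtain a where a: "a \<in> A" using A(3) by fastforce
  obtain s where s: "t \<le> s" "s < t + 2 * pi" "a = cis s" using cis_coordinate[of a t] a A(1) by blast
  have "s \<noteq> t" using a s z(2) t by auto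
  then have "T \<noteq> {}" using s a by (auto simp: T_def)
  define u where "u = Min T"
  have u: "u \<in> J t" "cis u \<in> A" "\<And>s. s \<in> T \<Longrightarrow> u \<le> s"
    using Min_in[OF \<open>finite T\<close> \<open>T \<noteq> {}\<close>] Min_le[OF \<open>finite T\<close>] by (auto simp: u_def T_def)
  \<comment> \<open>The circle is cut at the first point of A after z, so that z falls into the last
    gap.\<close>
  define b where "b = u - 2 * pi"
  have "cis b = cis u" unfolding cis_eq_iff b_def by (intro exI[of _ "- 1"]) simp
  then have bA: "cis b \<in> A" using u by simp
  have tJ: "t \<in> J b" using u by (auto simp: b_def)
  have no: "cis s \<notin> A" if "t < s" "s < b + 2 * pi" for s
    using u(1) u(3)[of s] that by (auto simp: T_def b_def)
  define X where "X = {s \<in> J b. cis s \<in> A}"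
  have X: "finite X" unfolding X_def by (rule finite_coords[OF A(2)])
  have "card X = N" using card_coords[OF A(2,1) bA] A(3) by (simp add: X_def)
  then have "X \<noteq> {}" using N(2) by auto
  define x where "x = Max X"
  have xX: "x \<in> X" unfolding x_def using X \<open>X \<noteq> {}\<close> by simp
  then have x: "x \<in> J b" "cis x \<in> A" by (auto simp: X_def)
  have xmax: "cis s \<notin> A" if "x < s" "s < b + 2 * pi" for s
  proof
    assume "cis s \<in> A"
    then have "s \<in> X" using that x(1) by (simp add: X_def)
    then have "s \<le> x" unfolding x_def using X by simp
    then show False using that by simp
  qed
  have "x \<noteq> t" using x(2) z(2) t by auto
  moreover have "\<not> t < x" using no[of x] x by auto
  ultimately have "cis t \<notin> Fx A"
    using tJ by (intro gap_empty[OF N(1) all_isolated[OF N(1) A0] A bA x xmax]) auto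
  then show False using z t by simp
qed

end

section \<open>Density\<close>

lemma dist_cis_le: "dist (cis s) (cis t) \<le> 2 * \<bar>s - t\<bar>"
proof -
  have 1: "\<bar>sin ((s - t) / 2)\<bar> \<le> \<bar>s - t\<bar> / 2" "\<bar>sin ((t - s) / 2)\<bar> \<le> \<bar>s - t\<bar> / 2"
    using abs_sin_x_le_abs_x[of "(s - t) / 2"] abs_sin_x_le_abs_x[of "(t - s) / 2"] by auto
  have "\<bar>cos s - cos t\<bar> = 2 * (\<bar>sin ((s + t) / 2)\<bar> * \<bar>sin ((t - s) / 2)\<bar>)"
    by (simp add: cos_diff_cos abs_mult)
  also have "\<dots> \<le> 2 * (1 * (\<bar>s - t\<bar> / 2))" using 1 by (intro mult_left_mono mult_mono) auto
  finally have c: "\<bar>cos s - cos t\<bar> \<le> \<bar>s - t\<bar>" by simp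
  have "\<bar>sin s - sin t\<bar> = 2 * (\<bar>sin ((s - t) / 2)\<bar> * \<bar>cos ((s + t) / 2)\<bar>)"
    by (simp add: sin_diff_sin abs_mult)
  also have "\<dots> \<le> 2 * ((\<bar>s - t\<bar> / 2) * 1)" using 1 by (intro mult_left_mono mult_mono) auto
  finally have "\<bar>sin s - sin t\<bar> \<le> \<bar>s - t\<bar>" by simp
  then show ?thesis using c cmod_le[of "cis s - cis t"] by (simp add: dist_norm)
qed

lemma homeo_of_lift:
  assumes ext: "g \<in> extensional S1" and cont: "continuous_on S1 g"
    and F: "incr F" "\<And>t. F (t + 2 * pi) = F t + 2 * pi" "\<And>t. g (cis t) = cis (F t)"
  shows "g \<in> homeo_S1"
proof -
  have im: "g ` S1 = S1"
  proof
    show "g ` S1 \<subseteq> S1" using F(3) S1_eq_cis by (metis image_subsetI)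
    show "S1 \<subseteq> g ` S1"
    proof
      fix z assume "z \<in> S1"
      then obtain t where "z = cis t" using S1_eq_cis by blast
      then have "z = g (cis (rinv F t))" by (simp add: F(3) incr_inv2[OF F(1)])
      then show "z \<in> g ` S1" using cis_S1 by blast
    qed
  qed
  have inj: "inj_on g S1"
  proof (rule inj_onI)
    fix x y assume x: "x \<in> S1" and y: "y \<in> S1" and e: "g x = g y"
    obtain s where s: "0 \<le> s" "s < 0 + 2 * pi" "x = cis s" using cis_coordinate[OF x] by blast
    obtain t where t: "0 \<le> t" "t < 0 + 2 * pi" "y = cis t" using cis_coordinate[OF y] by blast
    have "s < t + 2 * pi" "t < s + 2 * pi" using s t by auto
    then have "F s < F t + 2 * pi" "F t < F s + 2 * pi"
      unfolding F(2)[symmetric] incr_less[OF F(1)] by auto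
    then have "F s = F t" using e s t F(3) by (intro cis_inj_interval) auto
    then have "s = t" using incr_eq[OF F(1)] by blast
    then show "x = y" using s t by simp
  qed
  have bij: "bij_betw g S1 S1" using im inj by (simp add: bij_betw_def)
  have "continuous_on (g ` S1) (inv_into S1 g)" by (rule continuous_on_inv[OF cont compact_sphere]) (simp add: inj)
  then have "homeomorphism S1 S1 g (inv_into S1 g)"
    unfolding homeomorphism_def using im inj cont inv_into_image_cancel[OF inj subset_refl]
    by (auto simp: f_inv_into_f)
  moreover have "orientation_preserving g" unfolding orientation_preserving_def
    using F incr_continuous[OF F(1)] by (intro exI[of _ F]) (simp add: incr_def)
  ultimately show ?thesis using bij ext by (simp add: homeo_S1_def Bij_def)
qed

text \<open>A rotation by an angle proportional to the distance from A, so that A stays fixed. By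
  \<open>dist_cis_le\<close> this distance is 2-Lipschitz in the angle; the factor 1/4 makes the
  added angle 1/2-Lipschitz for s \<le> 1, which keeps the lift increasing.\<close>

definition push :: "complex set \<Rightarrow> real \<Rightarrow> complex \<Rightarrow> complex" where
  "push A s = (\<lambda>z\<in>S1. z * cis (s / 4 * infdist z A))"

lemma infdist_S1_le:
  assumes "A \<subseteq> S1" "A \<noteq> {}" "z \<in> S1"
  shows "infdist z A \<le> 2"
proof -
  obtain a where "a \<in> A" using assms by blast
  then show ?thesis using infdist_le2[of a A z 2] dist_S1_le[OF assms(3), of a] assms(1) by blast
qed

lemma push_homeo:
  assumes A: "A \<subseteq> S1" "A \<noteq> {}" and s: "s \<in> {0..1}"
  shows "push A s \<in> homeo_S1"
proof -
  define F where "F t = t + s / 4 * infdist (cis t) A" for t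
  have cF: "continuous_on S F" for S unfolding F_def by (intro continuous_intros)
  show ?thesis
  proof (rule homeo_of_lift)
    have "continuous_on S1 (\<lambda>z. z * cis (s / 4 * infdist z A))" by (intro continuous_intros)
    then show "continuous_on S1 (push A s)"
      by (rule continuous_on_eq) (simp add: push_def)
    have lt: "F t < F t'" if "t < t'" for t t'
    proof -
      have "infdist (cis t) A \<le> infdist (cis t') A + dist (cis t) (cis t')" by (rule infdist_triangle)
      then have "infdist (cis t) A - infdist (cis t') A \<le> 2 * (t' - t)" using dist_cis_le[of t t'] that by simp
      then have "s / 4 * (infdist (cis t) A - infdist (cis t') A) \<le> s / 4 * (2 * (t' - t))"
        using s by (intro mult_left_mono) auto
      also have "\<dots> \<le> 1 / 4 * (2 * (t' - t))" using s that by (intro mult_right_mono) auto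
      also have "\<dots> < t' - t" using that by simp
      finally show ?thesis by (simp add: F_def algebra_simps)
    qed
    have "\<exists>t. F t = y" for y
    proof -
      \<comment> \<open>Points of the circle are at most 2 apart, so the added angle is at most 1/2
        and starting at y - 1 is low enough.\<close>
      have "s / 4 * infdist (cis (y - 1)) A \<le> 1 / 4 * 2"
        using s infdist_S1_le[OF A cis_S1] by (intro mult_mono) (auto simp: infdist_nonneg)
      then have "F (y - 1) \<le> y" by (simp add: F_def)
      moreover have "y \<le> F y" using s by (simp add: F_def infdist_nonneg)
      ultimately show ?thesis using IVT'[of F "y - 1" y y] cF by auto
    qed
    then show "incr F" using lt by (auto simp: incr_def strict_mono_def surj_def) metis
    have "cis (t + 2 * pi) = cis t" for t unfolding cis_eq_iff by (intro exI[of _ 1]) simp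
    then show "F (t + 2 * pi) = F t + 2 * pi" for t by (simp add: F_def)
    show "push A s (cis t) = cis (F t)" for t by (simp add: push_def cis_S1 F_def cis_mult)
  qed (simp add: push_def)
qed

lemma push_dist:
  assumes A: "A \<subseteq> S1" "A \<noteq> {}" and z: "z \<in> S1"
  shows "dist (push A s z) (push A t z) \<le> \<bar>s - t\<bar>"
proof -
  have "norm z = 1" using z by (simp add: mem_sphere)
  have "dist (push A s z) (push A t z) = norm (z * (cis (s / 4 * infdist z A) - cis (t / 4 * infdist z A)))"
    using z by (simp add: push_def dist_norm algebra_simps)
  also have "\<dots> = dist (cis (s / 4 * infdist z A)) (cis (t / 4 * infdist z A))"
    using \<open>norm z = 1\<close> by (simp add: norm_mult dist_norm)
  also have "\<dots> \<le> 2 * \<bar>s / 4 * infdist z A - t / 4 * infdist z A\<bar>" by (rule dist_cis_le)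
  also have "\<dots> = \<bar>s - t\<bar> / 2 * infdist z A"
    by (simp add: left_diff_distrib[symmetric] diff_divide_distrib[symmetric] abs_mult infdist_nonneg)
  also have "\<dots> \<le> \<bar>s - t\<bar> / 2 * 2" using infdist_S1_le[OF A z] by (intro mult_left_mono) auto
  finally show ?thesis by simp
qed

lemma push_fix: "a \<in> A \<Longrightarrow> A \<subseteq> S1 \<Longrightarrow> push A s a = a"
  by (simp add: push_def subset_iff)

lemma push_0: "z \<in> S1 \<Longrightarrow> push A 0 z = z"
  by (simp add: push_def)

lemma push_move:
  assumes A: "A \<subseteq> S1" "A \<noteq> {}" "finite A" and z: "z \<in> S1" "z \<notin> A"
  shows "push A 1 z \<noteq> z"
proof
  assume "push A 1 z = z"
  then have "z * cis (infdist z A / 4) = z * cis 0" using z by (simp add: push_def)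
  moreover have "z \<noteq> 0" using z by (auto simp: mem_sphere)
  ultimately have "cis (infdist z A / 4) = cis 0" by simp
  moreover have "infdist z A \<le> 2" "0 \<le> infdist z A" using infdist_S1_le[OF A(1,2) z(1)] by (auto simp: infdist_nonneg)
  moreover have "2 < 2 * pi" using pi_gt3 by simp
  ultimately have "infdist z A / 4 = 0" by (intro cis_inj_interval) auto
  moreover have "infdist z A > 0" using A z by (intro infdist_pos_not_in_closed finite_imp_closed)
  ultimately show False by simp
qed

lemma continuous_map_Homeo_top:
  "continuous_map X Homeo_top h \<longleftrightarrow> (\<forall>x \<in> topspace X. h x \<in> homeo_S1 \<and> (\<forall>e>0. \<exists>U. openin X U \<and> x \<in> U \<and>
    (\<forall>y\<in>U. h y \<in> homeo_S1 \<and> homeo_dist (h x) (h y) < e)))"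
proof -
  interpret Metric_space homeo_S1 homeo_dist by (rule Metric_space_homeo)
  have "(\<forall>e>0. \<exists>U. openin X U \<and> x \<in> U \<and> (\<forall>y\<in>U. h y \<in> mball (h x) e)) \<longleftrightarrow>
    h x \<in> homeo_S1 \<and> (\<forall>e>0. \<exists>U. openin X U \<and> x \<in> U \<and> (\<forall>y\<in>U. h y \<in> homeo_S1 \<and> homeo_dist (h x) (h y) < e))"
    (is "?L \<longleftrightarrow> ?R") for x
  proof
    assume L: ?L
    obtain U where "x \<in> U" "\<forall>y\<in>U. h y \<in> mball (h x) 1" using L[rule_format, of 1] by auto
    then have "h x \<in> homeo_S1" by (simp add: in_mball)
    then show ?R using L by (simp add: in_mball)
  next
    assume ?R
    then show ?L by (simp add: in_mball)
  qed
  then show ?thesis unfolding Homeo_top_def continuous_map_to_metric by simp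
qed

lemma path_push:
  assumes A: "A \<subseteq> S1" "A \<noteq> {}"
  shows "pathin Homeo_top (push A)"
  unfolding pathin_def continuous_map_Homeo_top
proof (intro ballI conjI allI impI)
  fix s assume "s \<in> topspace (top_of_set {0..1::real})"
  then have s: "s \<in> {0..1}" by simp
  show h: "push A s \<in> homeo_S1" by (rule push_homeo[OF A s])
  fix e :: real assume "e > 0"
  then obtain d where d: "d > 0" "\<And>g. g \<in> homeo_S1 \<Longrightarrow> (\<And>z. z \<in> S1 \<Longrightarrow> dist (push A s z) (g z) < d) \<Longrightarrow> homeo_dist (push A s) g < e"
    using homeo_dist_uniform[OF h] by blast
  have "push A t \<in> homeo_S1 \<and> homeo_dist (push A s) (push A t) < e" if t: "t \<in> {0..1} \<inter> ball s d" for t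
  proof -
    have th: "push A t \<in> homeo_S1" using push_homeo[OF A] t by blast
    have "dist (push A s z) (push A t z) < d" if "z \<in> S1" for z
      using push_dist[OF A that, of s t] t by (auto simp: dist_real_def)
    then show ?thesis using d(2)[OF th] th by blast
  qed
  moreover have "openin (top_of_set {0..1}) ({0..1} \<inter> ball s d)" by (rule openin_open_Int) simp
  ultimately show "\<exists>U. openin (top_of_set {0..1}) U \<and> s \<in> U \<and> (\<forall>t\<in>U. push A t \<in> homeo_S1 \<and> homeo_dist (push A s) (push A t) < e)"
    using s d(1) by (intro exI[of _ "{0..1} \<inter> ball s d"]) auto
qed

lemma path_continuum:
  assumes "pathin Homeo_top g"
  shows "continuum (g ` {0..1})"
proof -
  have g: "g s \<in> homeo_S1" if "s \<in> {0..1}" for s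
    using assms that unfolding pathin_def continuous_map_Homeo_top by auto
  have "continuous_on {0..1} (\<lambda>s. E (g s))"
    unfolding continuous_on_iff
  proof (intro ballI allI impI)
    fix s e :: real assume s: "s \<in> {0..1}" and "e > 0"
    have "s \<in> topspace (top_of_set {0..1})" using s by simp
    then have "\<exists>U. openin (top_of_set {0..1}) U \<and> s \<in> U \<and> (\<forall>t\<in>U. g t \<in> homeo_S1 \<and> homeo_dist (g s) (g t) < e)"
      using assms[unfolded pathin_def continuous_map_Homeo_top] \<open>e > 0\<close> by blast
    then obtain U where U: "openin (top_of_set {0..1}) U" "s \<in> U" "\<And>t. t \<in> U \<Longrightarrow> homeo_dist (g s) (g t) < e"
      by blast
    obtain d where d: "d > 0" "\<And>t. t \<in> {0..1} \<Longrightarrow> dist t s < d \<Longrightarrow> t \<in> U"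
      using U(1,2) unfolding openin_euclidean_subtopology_iff by blast
    have "dist (E (g t)) (E (g s)) < e" if t: "t \<in> {0..1}" "dist t s < d" for t
    proof -
      have "dist (E (g s)) (E (g t)) \<le> homeo_dist (g s) (g t)"
        by (intro E_dist_le g s t homeo_dist_ge(1))
      then show ?thesis using U(3)[OF d(2)[OF t]] by (simp add: dist_commute)
    qed
    then show "\<exists>d>0. \<forall>t\<in>{0..1}. dist t s < d \<longrightarrow> dist (E (g t)) (E (g s)) < e" using d(1) by blast
  qed
  then have "compact ((\<lambda>s. E (g s)) ` {0..1})" "connected ((\<lambda>s. E (g s)) ` {0..1})"
    by (auto intro: compact_continuous_image connected_continuous_image)
  then show ?thesis using g by (auto simp: continuum_def image_image)
qed

lemma pathin_P_top:
  assumes "\<And>t. t \<in> {0..1} \<Longrightarrow> inj_on (X t) {..<n}" "\<And>t. t \<in> {0..1} \<Longrightarrow> X t \<in> extensional {..<n}"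
    and "\<And>t i. t \<in> {0..1} \<Longrightarrow> i < n \<Longrightarrow> X t i \<in> S1" "\<And>i. i < n \<Longrightarrow> continuous_on {0..1} (\<lambda>t. X t i)"
  shows "pathin (P_top n) X"
  unfolding pathin_def P_top_def continuous_map_in_subtopology continuous_map_componentwise
  using assms by (auto simp: continuous_map_in_subtopology)

context circle_group
begin

text \<open>A common fixed point x outside A is refuted by moving x along \<open>push A\<close>
  while A is held still. The path g in G that realizes this need not start at the identity, but g 0
  fixes A and x; dividing by it gives a continuum in \<open>K A\<close> whose end moves x.\<close>

lemma continuously_transitive_tight:
  assumes G: "continuously_transitive (Suc m) G" and m: "m \<ge> 1"
  shows "tight m"
  unfolding tight_def
proof (intro allI impI, elim conjE, rule subsetI, rule ccontr)
  fix A x assume A: "A \<subseteq> S1" "finite A" "card A = m" and x: "x \<in> Fx A" "x \<notin> A"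
  have xS: "x \<in> S1" using x Fx_S1 by blast
  have ne: "A \<noteq> {}" using A m by auto
  define X where "X = insert x A"
  have X: "finite X" "card X = Suc m" "X \<subseteq> S1" using A x xS by (auto simp: X_def)
  obtain e where e: "bij_betw e {..<Suc m} X"
    using ex_bij_betw_nat_finite[OF X(1)] X(2) by (auto simp: atLeast0LessThan)
  have eX: "e i \<in> X" if "i < Suc m" for i using e that by (auto simp: bij_betw_def)
  have eS: "e i \<in> S1" if "i < Suc m" for i using eX[OF that] X(3) by blast
  have inj_e: "inj_on e {..<Suc m}" using e by (simp add: bij_betw_def)
  define U where "U = (\<lambda>t::real. restrict e {..<Suc m})"
  define V where "V = (\<lambda>t. \<lambda>i\<in>{..<Suc m}. push A t (e i))"
  have "pathin (P_top (Suc m)) U"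
    by (rule pathin_P_top) (use inj_e eS in \<open>auto simp: U_def inj_on_def\<close>)
  moreover have "pathin (P_top (Suc m)) V"
  proof (rule pathin_P_top)
    fix t :: real assume t: "t \<in> {0..1}"
    show "inj_on (V t) {..<Suc m}"
      using inj_e homeo_inj[OF push_homeo[OF A(1) ne t]] eS by (auto simp: V_def inj_on_def)
    show "V t i \<in> S1" if "i < Suc m" for i
      using homeo_range[OF push_homeo[OF A(1) ne t] eS[OF that]] that by (simp add: V_def)
  next
    fix i assume i: "i < Suc m"
    have "continuous_on {0..1} (\<lambda>t. e i * cis (t / 4 * infdist (e i) A))"
      by (intro continuous_intros) simp
    then show "continuous_on {0..1} (\<lambda>t. V t i)"
      by (rule continuous_on_eq) (use i eS[OF i] in \<open>simp add: V_def push_def\<close>)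
  qed (simp add: V_def)
  moreover have "compatible (Suc m) U V" unfolding compatible_def
    by (intro exI[of _ "push A"] conjI path_push[OF A(1) ne]) (simp add: U_def V_def)
  ultimately obtain g where g: "pathin (subtopology Homeo_top G) g"
    "\<And>t i. t \<in> {0..1} \<Longrightarrow> i < Suc m \<Longrightarrow> g t (U t i) = V t i"
    using G unfolding continuously_transitive_def by blast
  have gG: "g t \<in> G" if "t \<in> {0..1}" for t
    using g(1) that unfolding pathin_def continuous_map_in_subtopology by auto
  have gp: "pathin Homeo_top g"
    using g(1) unfolding pathin_def continuous_map_in_subtopology by blast
  have gy: "g t y = push A t y" if ty: "t \<in> {0..1}" "y \<in> X" for t y
  proof -
    obtain i where "i < Suc m" "y = e i" using ty(2) e by (auto simp: bij_betw_def)
    then show ?thesis using g(2)[OF ty(1), of i] by (simp add: U_def V_def)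
  qed
  have 01: "(0::real) \<in> {0..1}" "(1::real) \<in> {0..1}" by auto
  note g0 = G_homeo[OF gG[OF 01(1)]]
  have g0y: "g 0 y = y" if "y \<in> X" for y using gy[OF 01(1) that] push_0 X(3) that by auto
  define C where "C = (\<lambda>(f, g). hq f g) ` ({g 0} \<times> g ` {0..1})"
  have "continuum C" unfolding C_def by (intro continuum_hq continuum_single path_continuum gp g0)
  moreover have "hq (g 0) (g t) \<in> G \<inter> hfix A" if t: "t \<in> {0..1}" for t
  proof -
    have "hq (g 0) (g t) a = a" if a: "a \<in> A" for a
    proof -
      have aX: "a \<in> X" "a \<in> S1" using a A(1) by (auto simp: X_def)
      have "g t a = g 0 a" using gy[OF t aX(1)] push_fix[OF a A(1)] g0y[OF aX(1)] by simp
      then show ?thesis using hinv_left[OF g0 aX(2)] by (simp add: hq_apply[OF aX(2)])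
    qed
    moreover have "hq (g 0) (g t) \<in> G" unfolding hq_def by (intro G_mul G_inv gG t 01)
    ultimately show ?thesis using G_homeo by (auto simp: hfix_def)
  qed
  then have "C \<subseteq> G \<inter> hfix A" by (auto simp: C_def)
  moreover have "hid \<in> C" using hq_eqs(1)[OF g0 g0] 01 by (force simp: C_def)
  moreover have "hq (g 0) (g 1) \<in> C" using 01 by (force simp: C_def)
  ultimately have "hq (g 0) (g 1) \<in> K A" unfolding K_def by blast
  then have "hq (g 0) (g 1) x = x" using x(1) by (simp add: Fx_def)
  then have "hinv (g 0) (g 1 x) = x" by (simp add: hq_apply[OF xS])
  then have "g 1 x = g 0 x" using hinv_right[OF g0 homeo_range[OF G_homeo[OF gG[OF 01(2)]] xS]] by simp
  then have "push A 1 x = x" using gy[OF 01(2), of x] g0y[of x] by (simp add: X_def)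
  then show False using push_move[OF A(1) ne A(2) xS x(2)] by blast
qed

end

section \<open>Nontriviality of the continuum components and approximation\<close>

context transitive_circle_group
begin

lemma K_nontrivial:
  assumes PN: "tight N" and N: "N \<ge> 3" and A0: "A0 \<subseteq> S1" "finite A0" "card A0 = Suc N"
  shows "\<exists>k\<in>K A0. k \<noteq> hid"
proof (rule ccontr)
  assume triv0: "\<not> ?thesis"
  \<comment> \<open>Triviality of one \<open>K A0\<close> passes to all sets with N + 1 points, as G
    carries them to each other.\<close>
  have triv: "f = hid" if f: "f \<in> K A" and A: "A \<subseteq> S1" "finite A" "card A = Suc N" for f A
  proof -
    obtain a where a: "a \<in> A" using A(3) by fastforce
    obtain a0 where a0: "a0 \<in> A0" using A0(3) by fastforce
    obtain g where g: "g \<in> G" "g ` A = A0" using cyclic_transitive[OF PN A _ a A0 a0] by blast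
    have gh: "g \<in> homeo_S1" and fh: "f \<in> homeo_S1" using g(1) G_homeo K_homeo[OF f] by auto
    have h: "hmul (hmul g f) (hinv g) = hid" using K_conj[OF A(1) g(1) f] triv0 g(2) by blast
    show ?thesis
    proof (rule homeo_eqI[OF fh hid_in])
      fix z assume z: "z \<in> S1"
      have "hmul (hmul g f) (hinv g) (g z) = g z" unfolding h by (simp add: hid_apply homeo_range gh z)
      then have "g (f z) = g z" by (simp add: hmul_apply homeo_range gh z hinv_left)
      then show "f z = hid z" using homeo_inj[OF gh homeo_range[OF fh z] z] by (simp add: hid_apply z)
    qed
  qed
  obtain B where B: "B \<subseteq> A0" "card B = N - 1" "finite B"
  proof -
    have "N - 1 \<le> card A0" using A0(3) by arith
    then show ?thesis using obtain_subset_with_card_n that by metis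
  qed
  have BS: "B \<subseteq> S1" using B A0 by blast
  have "B \<noteq> {}" using B N by auto
  then obtain b where b: "cis b \<in> B" using BS S1_eq_cis by (metis all_not_in_conv subsetD)
  define e where "e = b + 2 * pi"
  define X where "X = {t \<in> J b. cis t \<in> B}"
  have X: "finite X" unfolding X_def by (rule finite_coords[OF B(3)])
  have "card X \<noteq> 0" using card_coords[OF B(3) BS b] B(2) N by (simp add: X_def)
  then have Xne: "X \<noteq> {}" by auto
  \<comment> \<open>The two arcs next to the cut point are used; u and v coincide when B has two
    points.\<close>
  define u where "u = Min X"
  define v where "v = Max X"
  have u: "u \<in> X" "\<And>s. s \<in> X \<Longrightarrow> u \<le> s" and v: "v \<in> X" "\<And>s. s \<in> X \<Longrightarrow> s \<le> v"
    using X Xne by (auto simp: u_def v_def)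
  have uJ: "b < u" "u < e" "b < v" "v < e" "cis u \<in> B" "cis v \<in> B" using u v by (auto simp: X_def e_def)
  have uv: "u \<le> v" using u(2)[OF v(1)] .
  have noB: "cis s \<notin> B" if "(b < s \<and> s < u) \<or> (v < s \<and> s < e)" for s
    using u(2)[of s] v(2)[of s] that uJ by (force simp: X_def e_def)
  define p where "p = (b + u) / 2"
  define q where "q = (v + e) / 2"
  have p: "b < p" "p < u" and q: "v < q" "q < e" using uJ by (auto simp: p_def q_def)
  have hf: "k \<in> hfix {cis b}" if "k \<in> K B" for k using hfix_single[OF K_hfix[OF that] b] .
  have afix: "act b k s = s" if "k \<in> K B" "s \<in> {b, u, v, e}" for k s
    by (rule K_act_fix[OF K_hfix[OF that(1)] b]) (use that(2) uJ in \<open>auto simp: e_def\<close>)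
  \<comment> \<open>Adding r to B gives a set of N points, to which tightness applies.\<close>
  have K_pt: "\<exists>k\<in>K B. act b k r = r \<and> act b k s = t"
    if r: "r \<in> J b" "cis r \<notin> B" and st: "s \<in> J b" "t \<in> J b"
      and no: "\<And>x. min s t \<le> x \<Longrightarrow> x \<le> max s t \<Longrightarrow> cis x \<notin> B \<and> x \<noteq> r" for r s t
  proof -
    let ?A = "insert (cis r) B"
    have "\<exists>k\<in>K ?A. act b k s = t"
    proof (rule K_trans[OF PN _ _ _ _ st])
      show "?A \<subseteq> S1" "finite ?A" "cis b \<in> ?A" using BS B b cis_S1 by auto
      show "card ?A = N" using r(2) B N by simp
      fix x assume x: "min s t \<le> x" "x \<le> max s t"
      then have "x \<in> J b" using st by auto
      then show "cis x \<notin> ?A" using no[OF x] cis_inj_J[of x r b] r(1) by auto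
    qed
    then obtain k where k: "k \<in> K ?A" "act b k s = t" by blast
    have "act b k r = r" by (rule K_act_fix[OF K_hfix[OF k(1)]]) (use b in auto)
    then show ?thesis using k K_mono[of B ?A] by blast
  qed
  interpret two_interval_group "act b ` K B" b u v e p q
  proof
    show "incr f" if "f \<in> act b ` K B" for f using that act_incr hf by blast
    have "act b hid = id" by (rule ext) (simp add: act_id)
    then show "id \<in> act b ` K B" using K_id[OF BS] by (metis image_eqI)
    show "f \<circ> g \<in> act b ` K B" if fg: "f \<in> act b ` K B" "g \<in> act b ` K B" for f g
    proof -
      obtain f' g' where f': "f' \<in> K B" "f = act b f'" "g' \<in> K B" "g = act b g'" using fg by blast
      have "f \<circ> g = act b (hmul f' g')" by (rule ext) (simp add: f' act_mul hf)
      then show ?thesis using K_mul[OF BS f'(1,3)] by blast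
    qed
    show "rinv f \<in> act b ` K B" if "f \<in> act b ` K B" for f
      using that act_inv_eq hf K_inv[OF BS] by force
    show "u \<le> v" by (rule uv)
    show "f t \<in> {b<..<u}" if f: "f \<in> act b ` K B" and t: "t \<in> {b<..<u}" for f t
    proof -
      obtain k where k: "k \<in> K B" "f = act b k" using f by blast
      show ?thesis using act_less[OF hf[OF k(1)], of b t] act_less[OF hf[OF k(1)], of t u] afix[OF k(1), of b] afix[OF k(1), of u] t k(2) by simp
    qed
    show "f t \<in> {v<..<e}" if f: "f \<in> act b ` K B" and t: "t \<in> {v<..<e}" for f t
    proof -
      obtain k where k: "k \<in> K B" "f = act b k" using f by blast
      show ?thesis using act_less[OF hf[OF k(1)], of v t] act_less[OF hf[OF k(1)], of t e] afix[OF k(1), of v] afix[OF k(1), of e] t k(2) by simp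
    qed
    show "f = id" if f: "f \<in> act b ` K B" and st: "s \<in> {b<..<u} \<union> {v<..<e}" "t \<in> {b<..<u} \<union> {v<..<e}" "s \<noteq> t"
      and fs: "f s = s" and ft: "f t = t" for f s t
    proof -
      obtain k where k: "k \<in> K B" "f = act b k" using f by blast
      have sJ: "s \<in> J b" "t \<in> J b" using st uJ by (auto simp: e_def)
      have ks: "k (cis s) = cis s" "k (cis t) = cis t"
        using act_fix_iff[OF hf[OF k(1)]] sJ fs ft k(2) by auto
      \<comment> \<open>Adding both fixed points in turn brings B to N + 1 points, where
        \<open>K\<close> is trivial.\<close>
      have k1: "k \<in> K (insert (cis s) B)" by (rule K_stabilizer[OF BS b k(1) sJ(1) ks(1)])
      have k2: "k \<in> K (insert (cis t) (insert (cis s) B))"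
        by (rule K_stabilizer[OF _ _ k1 sJ(2) ks(2)]) (use BS b cis_S1 in auto)
      have "cis s \<notin> B" "cis t \<notin> B" using noB st by auto
      moreover have "cis s \<noteq> cis t" using cis_inj_J[of s t b] sJ st(3) by blast
      ultimately have "k = hid" using BS B N cis_S1 by (intro triv[OF k2]) auto
      then show ?thesis using k(2) by (auto simp: act_id)
    qed
    show "p \<in> {b<..<u}" "q \<in> {v<..<e}" using p q by auto
    have pJ: "p \<in> J b" "q \<in> J b" using p q uJ by (auto simp: e_def)
    have pB: "cis p \<notin> B" "cis q \<notin> B" using noB p q by auto
    show "\<exists>f\<in>act b ` K B. f p = p \<and> f s = t" if st: "s \<in> {v<..<e}" "t \<in> {v<..<e}" for s t
    proof -
      have "\<exists>k\<in>K B. act b k p = p \<and> act b k s = t"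
      proof (rule K_pt[OF pJ(1) pB(1)])
        show "s \<in> J b" "t \<in> J b" using st uJ by (auto simp: e_def)
        fix x assume "min s t \<le> x" "x \<le> max s t"
        then have "v < x" "x < e" using st by auto
        then show "cis x \<notin> B \<and> x \<noteq> p" using noB[of x] p uv by auto
      qed
      then show ?thesis by blast
    qed
    show "\<exists>f\<in>act b ` K B. f q = q \<and> f s = t" if st: "s \<in> {b<..<u}" "t \<in> {b<..<u}" for s t
    proof -
      have "\<exists>k\<in>K B. act b k q = q \<and> act b k s = t"
      proof (rule K_pt[OF pJ(2) pB(2)])
        show "s \<in> J b" "t \<in> J b" using st uJ by (auto simp: e_def)
        fix x assume "min s t \<le> x" "x \<le> max s t"
        then have "b < x" "x < u" using st by auto
        then show "cis x \<notin> B \<and> x \<noteq> q" using noB[of x] q uv by auto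
      qed
      then show ?thesis by blast
    qed
  qed
  show False by (rule contradiction)
qed

lemma tight_all:
  assumes "tight m" "m \<ge> 3"
  shows "tight n"
proof -
  have "tight (m + j)" for j
  proof (induction j)
    case (Suc j)
    obtain A where A: "A \<subseteq> S1" "finite A" "card A = Suc (m + j)"
      using infinite_arbitrarily_large[OF infinite_S1] by blast
    then obtain k where "k \<in> K A" "k \<noteq> hid" using K_nontrivial[OF Suc _ A] assms(2) by auto
    then show ?case using tight_step[OF Suc _ A] assms(2) by simp
  qed (use assms in simp)
  then show ?thesis using tight_le[of n "m + n"] by simp
qed

text \<open>If g is already correct on A, then h = g f^-1 fixes the points of f(A), so f x and its
  image g x under h lie in the same gap of f(A). An element of \<open>K A'\<close> corrects the
  value at x without disturbing the others.\<close>

lemma agree: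
  assumes tight: "\<And>n. tight n" and f: "f \<in> homeo_S1" and A: "finite A" "A \<subseteq> S1"
  shows "\<exists>g\<in>G. \<forall>a\<in>A. g a = f a"
  using A
proof (induction A)
  case (insert x A)
  obtain g where g: "g \<in> G" "\<And>a. a \<in> A \<Longrightarrow> g a = f a" using insert by auto
  have xS: "x \<in> S1" and AS: "A \<subseteq> S1" using insert by auto
  have gh: "g \<in> homeo_S1" using g G_homeo by blast
  show ?case
  proof (cases "A = {}")
    case True
    then show ?thesis using trans[OF xS homeo_range[OF f xS]] by auto
  next
    case False
    define A' where "A' = f ` A"
    have A': "A' \<subseteq> S1" "finite A'" using insert AS homeo_range[OF f] by (auto simp: A'_def)
    obtain b where b: "cis b \<in> A'" using False A'(1) S1_eq_cis unfolding A'_def by (metis all_not_in_conv image_is_empty subsetD)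
    define h where "h = hmul g (hinv f)"
    have "h a' = a'" if a': "a' \<in> A'" for a'
    proof -
      obtain a where "a \<in> A" "a' = f a" using a' by (auto simp: A'_def)
      then show ?thesis using AS A' a' g(2) by (auto simp: h_def hmul_apply subset_iff hinv_left[OF f])
    qed
    then have h: "h \<in> hfix A'" using gh f by (auto simp: hfix_def h_def hmul_in hinv_in)
    have hb: "h \<in> hfix {cis b}" by (rule hfix_single[OF h b])
    have fxA: "f x \<notin> A'" using homeo_inj[OF f xS] AS insert(2) by (auto simp: A'_def)
    obtain t where t: "b \<le> t" "t < b + 2 * pi" "f x = cis t" using cis_coordinate[OF homeo_range[OF f xS]] by blast
    have "t \<noteq> b" using fxA b t by auto
    then have tJ: "t \<in> J b" using t by simp
    have hx: "g x = h (f x)" by (simp add: h_def hmul_apply homeo_range[OF f xS] hinv_left[OF f xS])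
    \<comment> \<open>A point of \<open>A'\<close> between t and its image would be fixed by h,
      which monotonicity allows only for t itself.\<close>
    have no: "cis s \<notin> A'" if s: "min (act b h t) t \<le> s" "s \<le> max (act b h t) t" for s
    proof
      assume sA: "cis s \<in> A'"
      have hs: "act b h s = s" by (rule K_act_fix[OF h b]) (use sA in blast)
      have "s = t" using act_less[OF hb, of s t] act_less[OF hb, of t s] hs s
        by (cases s t rule: linorder_cases) auto
      then show False using sA fxA t by simp
    qed
    obtain k where k: "k \<in> K A'" "act b k (act b h t) = t"
      using K_trans[OF tight A' refl b act_J(1)[OF hb tJ] tJ] no by blast
    have kb: "k \<in> hfix {cis b}" by (rule hfix_single[OF K_hfix[OF k(1)] b])
    have "hmul k g x = f x"
      using act_J(2)[OF hb tJ] act_J(2)[OF kb act_J(1)[OF hb tJ]] k(2) t(3) hx by (simp add: hmul_apply[OF xS])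
    moreover have "hmul k g a = f a" if a: "a \<in> A" for a
    proof -
      have "f a \<in> A'" using a by (simp add: A'_def)
      then show ?thesis using K_hfix[OF k(1)] g(2)[OF a] AS a by (auto simp: hmul_apply hfix_def)
    qed
    ultimately show ?thesis using G_mul[OF K_G[OF k(1)] g(1)] by blast
  qed
qed (use G_id in blast)

text \<open>If g agrees with f at the points of a fine subdivision, then h = f^-1 g fixes these
  points and hence shifts every angle by less than the mesh. Uniform continuity of f makes g = f h
  close to f, and \<open>homeo_dist_uniform\<close> takes care of the inverses.\<close>

lemma dense:
  assumes tight: "\<And>n. tight n" and f: "f \<in> homeo_S1" and r: "r > 0"
  shows "\<exists>g\<in>G. homeo_dist f g < r"
proof -
  obtain d where d: "d > 0" "\<And>g. g \<in> homeo_S1 \<Longrightarrow> (\<And>z. z \<in> S1 \<Longrightarrow> dist (f z) (g z) < d) \<Longrightarrow> homeo_dist f g < r"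
    using homeo_dist_uniform[OF f r] by blast
  obtain \<delta> where \<delta>: "\<delta> > 0" "\<And>x y. x \<in> S1 \<Longrightarrow> y \<in> S1 \<Longrightarrow> dist x y < \<delta> \<Longrightarrow> dist (f x) (f y) < d"
    using homeo_uniform[OF f d(1)] by blast
  \<comment> \<open>Makes twice the mesh w smaller than \<open>\<delta>\<close>; the factor 2 is the
    constant of \<open>dist_cis_le\<close>.\<close>
  obtain n :: nat where n: "4 * pi / \<delta> < real n" using reals_Archimedean2 by blast
  have n0: "real n > 0" using n \<delta>(1) by (smt (verit) divide_nonneg_pos pi_ge_zero)
  define w where "w = 2 * pi / real n"
  have w: "w > 0" "2 * w < \<delta>" "real n * w = 2 * pi" using n n0 \<delta>(1) by (auto simp: w_def field_simps)
  define A where "A = (\<lambda>j. cis (real j * w)) ` {..n}"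
  have A: "finite A" "A \<subseteq> S1" using cis_S1 by (auto simp: A_def)
  obtain g where g: "g \<in> G" "\<And>a. a \<in> A \<Longrightarrow> g a = f a" using agree[OF tight f A] by blast
  have gh: "g \<in> homeo_S1" using g G_homeo by blast
  define h where "h = hq f g"
  have hA: "h \<in> hfix A"
    using A(2) g(2) gh f by (auto simp: h_def hfix_def hq_in hq_apply subset_iff hinv_left)
  have 0: "cis 0 \<in> A" unfolding A_def by (rule image_eqI[of _ _ 0]) auto
  have h0: "h \<in> hfix {cis 0}" by (rule hfix_single[OF hA 0])
  have gf: "g z = f (h z)" if "z \<in> S1" for z
    by (simp add: h_def hq_apply that hinv_right f homeo_range gh)
  have "dist (f z) (g z) < d" if z: "z \<in> S1" for z
  proof -
    obtain t where t: "0 \<le> t" "t < 0 + 2 * pi" "z = cis t" using cis_coordinate[OF z] by blast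
    have "dist z (h z) < \<delta>"
    proof (cases "t = 0")
      case True
      then have "h z = z" using h0 t by (simp add: hfix_def)
      then show ?thesis using \<delta>(1) by simp
    next
      case False
      then have tJ: "t \<in> J 0" using t by simp
      define j where "j = nat \<lfloor>t / w\<rfloor>"
      have "of_int \<lfloor>t / w\<rfloor> = real j" using t w(1) by (simp add: j_def)
      then have "real j \<le> t / w" "t / w < real j + 1" by linarith+
      then have j: "real j * w \<le> t" "t < real (Suc j) * w" using w(1) by (auto simp: field_simps)
      have "real j * w < real n * w" using j t w by simp
      then have jn: "j < n" using w(1) by simp
      have fx: "act 0 h (real i * w) = real i * w" if "i \<le> n" for i
        by (rule K_act_fix[OF hA 0]) (use that in \<open>auto simp: A_def\<close>)
      have "act 0 h (real j * w) \<le> act 0 h t" "act 0 h t < act 0 h (real (Suc j) * w)"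
        using j act_less[OF h0] incr_le[OF act_incr[OF h0]] by auto
      moreover have "act 0 h (real (Suc j) * w) = real (Suc j) * w" "act 0 h (real j * w) = real j * w"
        by (rule fx, use jn in simp)+
      ultimately have "real j * w \<le> act 0 h t" "act 0 h t < real (Suc j) * w" by (simp_all only:)
      then have "\<bar>t - act 0 h t\<bar> < w" using j by (auto simp: algebra_simps)
      then have "2 * \<bar>t - act 0 h t\<bar> < \<delta>" using w(2) by simp
      then have "dist (cis t) (cis (act 0 h t)) < \<delta>" by (rule le_less_trans[OF dist_cis_le])
      then show ?thesis using act_J(2)[OF h0 tJ] t by simp
    qed
    then show ?thesis unfolding gf[OF z] using hA by (intro \<delta>(2) z homeo_range[of h]) (auto simp: hfix_def)
  qed
  then show ?thesis using d(2)[OF gh] g(1) by blast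
qed

end

lemma Homeo_S1_simps:
  "carrier Homeo_S1 = homeo_S1"
  "f \<in> homeo_S1 \<Longrightarrow> g \<in> homeo_S1 \<Longrightarrow> f \<otimes>\<^bsub>Homeo_S1\<^esub> g = hmul f g"
  "\<one>\<^bsub>Homeo_S1\<^esub> = hid"
  by (auto simp: Homeo_S1_def BijGroup_def homeo_S1_def hmul_def hid_def)

lemma Homeo_S1_inv:
  assumes "f \<in> homeo_S1"
  shows "inv\<^bsub>Homeo_S1\<^esub> f = hinv f"
proof (rule group.inv_equality[OF group_Homeo_S1])
  have "hmul (hinv f) f = hid"
    by (rule homeo_eqI) (simp_all add: hmul_in hinv_in assms hid_in hmul_apply hid_apply hinv_left)
  then show "hinv f \<otimes>\<^bsub>Homeo_S1\<^esub> f = \<one>\<^bsub>Homeo_S1\<^esub>"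
    by (simp add: Homeo_S1_simps hinv_in assms)
qed (simp_all add: Homeo_S1_simps hinv_in assms)

theorem mainTheorem4:
  fixes G :: "(complex \<Rightarrow> complex) set" and k :: nat
  assumes "subgroup G Homeo_S1"
    and "transitive_on_S1 G"
    and "contains_nonconstant_path G"
    and "k > 3"
    and "continuously_transitive k G"
  shows "Homeo_top closure_of G = carrier Homeo_S1"
proof -
  have GH: "G \<subseteq> homeo_S1" using subgroup.subset[OF assms(1)] by (simp add: Homeo_S1_simps)
  interpret transitive_circle_group G
  proof
    show "f \<in> homeo_S1" if "f \<in> G" for f using that GH by blast
    show "hid \<in> G" using subgroup.one_closed[OF assms(1)] by (simp add: Homeo_S1_simps)
    show "hmul f g \<in> G" if "f \<in> G" "g \<in> G" for f g
      using subgroup.m_closed[OF assms(1) that] Homeo_S1_simps(2)[OF subsetD[OF GH that(1)] subsetD[OF GH that(2)]]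
      by simp
    show "hinv f \<in> G" if "f \<in> G" for f
      using subgroup.m_inv_closed[OF assms(1) that] Homeo_S1_inv[OF subsetD[OF GH that]] by simp
    show "\<exists>f\<in>G. f x = y" if "x \<in> S1" "y \<in> S1" for x y
      using assms(2) that unfolding transitive_on_S1_def by blast
  qed
  have "tight (k - 1)" using assms(4,5) by (intro continuously_transitive_tight) auto
  then have tight: "tight n" for n using tight_all[of "k - 1" n] assms(4) by simp
  interpret M: Metric_space homeo_S1 homeo_dist by (rule Metric_space_homeo)
  have "f \<in> Homeo_top closure_of G" if f: "f \<in> homeo_S1" for f
    unfolding Homeo_top_def M.metric_closure_of using dense[OF tight f] f GH by (auto simp: M.in_mball)
  moreover have "Homeo_top closure_of G \<subseteq> homeo_S1"
    unfolding Homeo_top_def M.metric_closure_of by blast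
  ultimately show ?thesis by (auto simp: Homeo_S1_simps)
qed

end
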